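(* Let $M$ be a compact manifold and let $\nu$ be a probability measure on $\mathrm{Diff}^1(M)$ such that for some $p>1$, $\int\left(\log\|f\|_{C^1}+\log\|f^{-1}\|_{C^1}\right)^pd\nu(f)<+\infty$. Let $G$ be the closed subsemigroup of $\mathrm{Diff}^1(M)$ generated by the support of $\nu$, let $H\subset G$ be a closed finite index subsemigroup, and let $\nu_H$ be the measure induced by $\nu$ on $H$. Then $\nu$ is uniformly expanding if and only if $\nu_H$ is uniformly expanding.
   Context: $\mathrm{Diff}^1(M)$ is the group of $C^1$ diffeomorphisms of $M$; a Riemannian metric on $M$ is fixed and $\|f\|_{C^1}=\sup\|Df(v)\|$ over unit tangent vectors $v$. A closed subsemigroup $H\subset G$ has finite index if there is a continuous transitive action $G\times F\to F$ on some finite set $F$ such that $H$ is the stabilizer of some element $x_0\in F$. For $\omega=(f_n)_{n\ge0}\in\mathrm{Diff}^1(M)^{\mathbf{N}}$, write $f_\omega^n=f_{n-1}\circ\cdots\circ f_0$. The hitting time of $H$ is $T_H(\omega)=\min\{n\ge1:\ f^n_\omega\in H\}$, which is $\nu^{\mathbf{N}}$-almost surely finite, and the induced (or hitting) measure $\nu_H$ is the law of $f_\omega^{T_H(\omega)}$ for $\omega$ distributed according to $\nu^{\mathbf{N}}$; it is a probability measure on $H$. A probability measure $m$ on $\mathrm{Diff}^1(M)$ is uniformly expanding if there exist $c>0$ and an integer $n_0\ge1$ such that for every unit tangent vector $v\in T_xM$, $x\in M$, $\int\log\|D_xf(v)\|\,dm^{(n_0)}(f)\ge c$, where $m^{(n)}$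 is the $n$-th convolution power of $m$. *)

theory Defs
  imports "HOL-Probability.Probability"
begin

section \<open>Smooth manifolds and Riemannian metrics\<close>

text \<open>
  The manifold is the whole of a Hausdorff type \<open>'m\<close>, equipped with a smooth atlas \<open>A\<close> modelled
  on a Euclidean space \<open>'b\<close>. A chart is a pair of its domain and its coordinate map.
\<close>

type_synonym ('m, 'b) chart = "'m set \<times> ('m \<Rightarrow> 'b)"

abbreviation chart_dom :: "('m, 'b) chart \<Rightarrow> 'm set" where
  "chart_dom c \<equiv> fst c"

abbreviation coord :: "('m, 'b) chart \<Rightarrow> 'm \<Rightarrow> 'b" where
  "coord c \<equiv> snd c"

definition param :: "('m, 'b) chart \<Rightarrow> 'b \<Rightarrow> 'm" where
  "param c = inv_into (chart_dom c) (coord c)"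

definition local_rep :: "('m, 'b) chart \<Rightarrow> ('m, 'b) chart \<Rightarrow> ('m \<Rightarrow> 'm) \<Rightarrow> 'b \<Rightarrow> 'b" where
  "local_rep c d f = coord d \<circ> f \<circ> param c"

text \<open>Only used on open sets \<open>S\<close>.\<close>

primrec Ck_on :: "nat \<Rightarrow> ('b::euclidean_space \<Rightarrow> 'c::real_normed_vector) \<Rightarrow> 'b set \<Rightarrow> bool" where
  "Ck_on 0 f S \<longleftrightarrow> continuous_on S f"
| "Ck_on (Suc k) f S \<longleftrightarrow>
     (\<forall>x\<in>S. f differentiable (at x)) \<and> (\<forall>u. Ck_on k (\<lambda>x. frechet_derivative f (at x) u) S)"

definition smooth_on :: "('b::euclidean_space \<Rightarrow> 'c::real_normed_vector) \<Rightarrow> 'b set \<Rightarrow> bool" where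
  "smooth_on f S \<longleftrightarrow> (\<forall>k. Ck_on k f S)"

definition smooth_atlas :: "('m::t2_space, 'b::euclidean_space) chart set \<Rightarrow> bool" where
  "smooth_atlas A \<longleftrightarrow>
     (\<Union>c\<in>A. chart_dom c) = UNIV \<and>
     (\<forall>c\<in>A. open (chart_dom c) \<and> open (coord c ` chart_dom c) \<and>
        homeomorphism (chart_dom c) (coord c ` chart_dom c) (coord c) (param c)) \<and>
     (\<forall>c\<in>A. \<forall>d\<in>A. smooth_on (local_rep c d id) (coord c ` (chart_dom c \<inter> chart_dom d)))"

text \<open>Second countability is automatic for compact manifolds.\<close>

definition compact_manifold :: "('m::t2_space, 'b::euclidean_space) chart set \<Rightarrow> bool" where
  "compact_manifold A \<longleftrightarrow> compact (UNIV :: 'm set) \<and> smooth_atlas A"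

text \<open>
  The tangent space at \<open>x\<close> is identified with \<open>'b\<close> through one chart \<open>chart_at A x\<close> around \<open>x\<close>,
  chosen once and for all. No regularity of this choice in \<open>x\<close> is used: smoothness is always
  expressed in a fixed chart \<open>c\<close>, with \<open>from_chart A c x\<close> turning the coordinates with respect
  to \<open>c\<close> of a tangent vector at \<open>x\<close> into that vector.
\<close>

definition chart_at :: "('m, 'b) chart set \<Rightarrow> 'm \<Rightarrow> ('m, 'b) chart" where
  "chart_at A x = (SOME c. c \<in> A \<and> x \<in> chart_dom c)"

definition from_chart ::
  "('m, 'b::euclidean_space) chart set \<Rightarrow> ('m, 'b) chart \<Rightarrow> 'm \<Rightarrow> 'b \<Rightarrow> 'b" where
  "from_chart A c x = frechet_derivative (local_rep c (chart_at A x) id) (at (coord c x))"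

definition tangent_map ::
  "('m, 'b::euclidean_space) chart set \<Rightarrow> ('m \<Rightarrow> 'm) \<Rightarrow> 'm \<Rightarrow> 'b \<Rightarrow> 'b" where
  "tangent_map A f x =
     frechet_derivative (local_rep (chart_at A x) (chart_at A (f x)) f) (at (coord (chart_at A x) x))"

definition riemannian_metric ::
  "('m, 'b::euclidean_space) chart set \<Rightarrow> ('m \<Rightarrow> 'b \<Rightarrow> 'b \<Rightarrow> real) \<Rightarrow> bool" where
  "riemannian_metric A g \<longleftrightarrow>
     (\<forall>x. bilinear (g x) \<and> (\<forall>u w. g x u w = g x w u) \<and> (\<forall>u. u \<noteq> 0 \<longrightarrow> g x u u > 0)) \<and>
     (\<forall>c\<in>A. \<forall>u w. smooth_on
        (\<lambda>z. g (param c z) (from_chart A c (param c z) u) (from_chart A c (param c z) w))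
        (coord c ` chart_dom c))"

definition tnorm :: "('m \<Rightarrow> 'b \<Rightarrow> 'b \<Rightarrow> real) \<Rightarrow> 'm \<Rightarrow> 'b \<Rightarrow> real" where
  "tnorm g x v = sqrt (g x v v)"


section \<open>The group of C^1 diffeomorphisms\<close>

definition C1_map :: "('m::t2_space, 'b::euclidean_space) chart set \<Rightarrow> ('m \<Rightarrow> 'm) \<Rightarrow> bool" where
  "C1_map A f \<longleftrightarrow> continuous_on UNIV f \<and>
     (\<forall>c\<in>A. \<forall>d\<in>A. Ck_on 1 (local_rep c d f) (coord c ` (chart_dom c \<inter> f -` chart_dom d)))"

definition Diff1 :: "('m::t2_space, 'b::euclidean_space) chart set \<Rightarrow> ('m \<Rightarrow> 'm) set" where
  "Diff1 A = {f. bij f \<and> C1_map A f \<and> C1_map A (inv f)}"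

definition C1_norm ::
  "('m, 'b::euclidean_space) chart set \<Rightarrow> ('m \<Rightarrow> 'b \<Rightarrow> 'b \<Rightarrow> real) \<Rightarrow> ('m \<Rightarrow> 'm) \<Rightarrow> real" where
  "C1_norm A g f = Sup {tnorm g (f x) (tangent_map A f x v) | x v. tnorm g x v = 1}"

text \<open>
  The C^1 topology, generated by the usual sets: in given charts, values and first derivatives
  are \<open>e\<close>-close on a compact set \<open>K\<close>.
\<close>

definition C1_nbhd ::
  "('m::t2_space, 'b::euclidean_space) chart set \<Rightarrow> ('m \<Rightarrow> 'm) \<Rightarrow> ('m, 'b) chart \<Rightarrow> ('m, 'b) chart \<Rightarrow>
     'm set \<Rightarrow> real \<Rightarrow> ('m \<Rightarrow> 'm) set" where
  "C1_nbhd A f c d K e = {h \<in> Diff1 A. h ` K \<subseteq> chart_dom d \<and>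
     (\<forall>x\<in>K. norm (coord d (h x) - coord d (f x)) < e \<and>
        onorm (\<lambda>u. frechet_derivative (local_rep c d h) (at (coord c x)) u -
                   frechet_derivative (local_rep c d f) (at (coord c x)) u) < e)}"

definition C1_topology ::
  "('m::t2_space, 'b::euclidean_space) chart set \<Rightarrow> ('m \<Rightarrow> 'm) topology" where
  "C1_topology A = topology_generated_by
     {C1_nbhd A f c d K e | f c d K e.
        f \<in> Diff1 A \<and> c \<in> A \<and> d \<in> A \<and> compact K \<and> K \<subseteq> chart_dom c \<and> f ` K \<subseteq> chart_dom d \<and> e > 0}"

definition diff1_borel ::
  "('m::t2_space, 'b::euclidean_space) chart set \<Rightarrow> ('m \<Rightarrow> 'm) measure" where
  "diff1_borel A = sigma (Diff1 A) {U. openin (C1_topology A) U}"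


section \<open>Semigroups\<close>

definition closed_subsemigroup :: "('m \<Rightarrow> 'm) topology \<Rightarrow> ('m \<Rightarrow> 'm) set \<Rightarrow> bool" where
  "closed_subsemigroup T H \<longleftrightarrow> closedin T H \<and> (\<forall>f\<in>H. \<forall>h\<in>H. f \<circ> h \<in> H)"

definition closed_subsemigroup_generated ::
  "('m \<Rightarrow> 'm) topology \<Rightarrow> ('m \<Rightarrow> 'm) set \<Rightarrow> ('m \<Rightarrow> 'm) set" where
  "closed_subsemigroup_generated T S = \<Inter>{H. closed_subsemigroup T H \<and> S \<subseteq> H}"

text \<open>
  Taking the finite set \<open>F\<close> inside \<open>nat\<close> is no restriction, up to bijection. Elements of \<open>G\<close> are
  not required to act by bijections of \<open>F\<close>.
\<close>

definition finite_index ::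
  "('m \<Rightarrow> 'm) topology \<Rightarrow> ('m \<Rightarrow> 'm) set \<Rightarrow> ('m \<Rightarrow> 'm) set \<Rightarrow> bool" where
  "finite_index T G H \<longleftrightarrow>
     (\<exists>(F :: nat set) (act :: ('m \<Rightarrow> 'm) \<Rightarrow> nat \<Rightarrow> nat). \<exists>x0\<in>F.
        finite F \<and>
        continuous_map (prod_topology (subtopology T G) (discrete_topology F))
          (discrete_topology F) (\<lambda>(f, x). act f x) \<and>
        (\<forall>f\<in>G. \<forall>h\<in>G. \<forall>x\<in>F. act (f \<circ> h) x = act f (act h x)) \<and>
        (\<forall>x\<in>F. \<forall>y\<in>F. \<exists>f\<in>G. act f x = y) \<and>
        H = {f \<in> G. act f x0 = x0})"


section \<open>Random walks\<close>

definition measure_support :: "'a topology \<Rightarrow> 'a measure \<Rightarrow> 'a set" where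
  "measure_support T m = {f \<in> topspace T. \<forall>U. openin T U \<and> f \<in> U \<longrightarrow> emeasure m U > 0}"

primrec conv_power ::
  "('m::t2_space, 'b::euclidean_space) chart set \<Rightarrow> ('m \<Rightarrow> 'm) measure \<Rightarrow> nat \<Rightarrow> ('m \<Rightarrow> 'm) measure"
where
  "conv_power A m 0 = return (diff1_borel A) id"
| "conv_power A m (Suc n) =
     distr (m \<Otimes>\<^sub>M conv_power A m n) (diff1_borel A) (\<lambda>(f, h). f \<circ> h)"

primrec walk :: "(nat \<Rightarrow> 'm \<Rightarrow> 'm) \<Rightarrow> nat \<Rightarrow> 'm \<Rightarrow> 'm" where
  "walk \<omega> 0 = id"
| "walk \<omega> (Suc n) = \<omega> n \<circ> walk \<omega> n"

definition hitting_time :: "('m \<Rightarrow> 'm) set \<Rightarrow> (nat \<Rightarrow> 'm \<Rightarrow> 'm) \<Rightarrow> nat" where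
  "hitting_time H \<omega> = (LEAST n. n \<ge> 1 \<and> walk \<omega> n \<in> H)"

text \<open>The induced measure is regarded as a measure on the whole diffeomorphism group.\<close>

definition hitting_measure ::
  "('m::t2_space, 'b::euclidean_space) chart set \<Rightarrow> ('m \<Rightarrow> 'm) measure \<Rightarrow> ('m \<Rightarrow> 'm) set \<Rightarrow>
     ('m \<Rightarrow> 'm) measure" where
  "hitting_measure A m H =
     distr (PiM (UNIV :: nat set) (\<lambda>_. m)) (diff1_borel A) (\<lambda>\<omega>. walk \<omega> (hitting_time H \<omega>))"

text \<open>
  The Bochner integral of a non-integrable function is \<open>0\<close>, so the bound by \<open>c > 0\<close> includes
  integrability.
\<close>

definition uniformly_expanding ::
  "('m::t2_space, 'b::euclidean_space) chart set \<Rightarrow> ('m \<Rightarrow> 'b \<Rightarrow> 'b \<Rightarrow> real) \<Rightarrow>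
     ('m \<Rightarrow> 'm) measure \<Rightarrow> bool" where
  "uniformly_expanding A g m \<longleftrightarrow>
     (\<exists>c>0. \<exists>n0\<ge>1. \<forall>x v. tnorm g x v = 1 \<longrightarrow>
        (\<integral>f. ln (tnorm g (f x) (tangent_map A f x v)) \<partial>conv_power A m n0) \<ge> c)"

end

theory Submission
  imports Defs
begin

text \<open>
  A random diffeomorphism acts on nonzero tangent vectors \<open>q\<close> by its tangent map, and \<open>\<nu>\<close> is
  uniformly expanding when, for some fixed number of steps, the logarithm of the norm increases on
  average by a definite amount from every \<open>q\<close>. This is a condition about several steps; the
  proof replaces it by a condition about one step. Call \<open>w\<close> a Lyapunov function of \<open>m\<close> if it
  stays at bounded distance from the logarithm of the norm and
  \<open>w q + \<epsilon> \<le> \<integral> w (Df q) dm(f)\<close> for some \<open>\<epsilon> > 0\<close> and all \<open>q\<close>. Iterating the inequality shows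
  that \<open>m\<close> is uniformly expanding; conversely the mean of the expected log norms after
  \<open>0, \<dots>, n - 1\<close> steps is a Lyapunov function, because its drift telescopes
  (\<open>lyapunov_imp_expanding\<close>, \<open>expanding_imp_lyapunov\<close>).

  It remains to pass Lyapunov functions between \<open>\<nu>\<close> and the hitting measure. The semigroup acts
  on a finite set \<open>F\<close> with \<open>H\<close> the stabiliser of \<open>x0\<close>, so the hitting measure is the law of the walk
  when its action first brings \<open>x0\<close> back to \<open>x0\<close>. For \<open>y\<close> in \<open>F\<close> let \<open>\<nu>_hit y\<close> be the law of the
  walk when it first brings \<open>y\<close> to \<open>x0\<close>. Decomposing according to the first step
  (\<open>integral_first_step\<close>) relates these laws to each other.
  If \<open>w\<close> has drift \<open>\<epsilon>\<close> under \<open>\<nu>\<close>, let \<open>I\<close> be the infimum of its mean increments under all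
  \<open>\<nu>_hit y\<close>. The first step gains \<open>\<epsilon>\<close>, the remaining steps gain nothing or at least \<open>I\<close>, whence
  \<open>I \<ge> \<epsilon> + min 0 I\<close>; since \<open>I\<close> is finite, \<open>I \<ge> 0\<close>, and so the same \<open>w\<close> has drift \<open>\<epsilon>\<close> under the
  hitting measure (\<open>drift_of_hitting_measure\<close>).
  If \<open>w\<close> has drift \<open>\<epsilon>\<close> under the hitting measure, extend it to pairs \<open>(q, y)\<close>
  by the expected value of \<open>w\<close> when \<open>y\<close> is first brought to \<open>x0\<close>. The extension is invariant in mean
  away from \<open>x0\<close> and gains \<open>\<epsilon>\<close> at \<open>x0\<close>. Subtracting a small multiple of the
  expected hitting time spreads this gain evenly over \<open>F\<close>, and iterating from \<open>(q, x0)\<close>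
  shows that \<open>\<nu>\<close> is uniformly expanding (\<open>expanding_of_hitting_drift\<close>).

  All these means are finite because the expected hitting times are
  (\<open>finite_chain_supersolution\<close>): the support of \<open>\<nu>\<close> generates \<open>G\<close>, and \<open>G\<close> acts transitively, so
  from every point of \<open>F\<close> some word in the support leads to \<open>x0\<close>. A Wald
  estimate (\<open>partial_cost_le\<close>) then bounds the log distortion of the stopped walk.

  Two facts about diffeomorphisms support the argument. Composition is measurable for the Borel
  sets of the \<open>C^1\<close> topology: this is the compact-open topology of the tangent maps on the tangent
  bundle, hence second countable with continuous composition (\<open>comp_measurable\<close>). And a
  diffeomorphism of a compact manifold cannot contract all tangent vectors
  (\<open>C1_norm_ge_1\<close>), so that both terms of the moment condition are nonnegative and their sum bounds
  the change of the log norm.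
\<close>

section \<open>Tangent maps in charts and the topology of the tangent bundle\<close>

abbreviation chart_img :: "('m, 'b) chart \<Rightarrow> 'b set" where
  "chart_img c \<equiv> coord c ` chart_dom c"

definition jac :: "('m, 'b::euclidean_space) chart \<Rightarrow> ('m, 'b) chart \<Rightarrow> ('m \<Rightarrow> 'm) \<Rightarrow> 'b \<Rightarrow> 'b \<Rightarrow> 'b" where
  "jac c d f z = frechet_derivative (local_rep c d f) (at z)"

definition rep_dom :: "('m, 'b::euclidean_space) chart \<Rightarrow> ('m, 'b) chart \<Rightarrow> ('m \<Rightarrow> 'm) \<Rightarrow> 'b set" where
  "rep_dom c d f = {z \<in> chart_img c. f (param c z) \<in> chart_dom d}"

text \<open>
  The tangent map of \<open>f\<close> read in a chart \<open>c\<close> of the source and a chart \<open>d\<close> of the target.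
\<close>

definition tjet ::
  "('m, 'b::euclidean_space) chart \<Rightarrow> ('m, 'b) chart \<Rightarrow> ('m \<Rightarrow> 'm) \<Rightarrow> 'b \<times> 'b \<Rightarrow> 'b \<times> 'b" where
  "tjet c d f = (\<lambda>(z, u). (coord d (f (param c z)), jac c d f z u))"

text \<open>
  The tangent vector whose coordinates with respect to \<open>c\<close> are \<open>(z, u)\<close>, in the identification of
  tangent spaces given by \<open>chart_at\<close>; \<open>tcovec A c\<close> is the inverse.
\<close>

definition tvec :: "('m, 'b::euclidean_space) chart set \<Rightarrow> ('m, 'b) chart \<Rightarrow> 'b \<times> 'b \<Rightarrow> 'm \<times> 'b" where
  "tvec A c = (\<lambda>(z, u). (param c z, jac c (chart_at A (param c z)) id z u))"

definition tcovec :: "('m, 'b::euclidean_space) chart set \<Rightarrow> ('m, 'b) chart \<Rightarrow> 'm \<times> 'b \<Rightarrow> 'b \<times> 'b" where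
  "tcovec A c = (\<lambda>(x, v). (coord c x, jac (chart_at A x) c id (coord (chart_at A x) x) v))"

definition Tmap :: "('m, 'b::euclidean_space) chart set \<Rightarrow> ('m \<Rightarrow> 'm) \<Rightarrow> 'm \<times> 'b \<Rightarrow> 'm \<times> 'b" where
  "Tmap A f = (\<lambda>(x, v). (f x, tangent_map A f x v))"

text \<open>
  Tangent vectors are pairs \<open>(x, v)\<close>, but \<open>v\<close> refers to \<open>chart_at A x\<close>, which jumps with \<open>x\<close>. The
  product topology on pairs is therefore wrong; the right one is the final topology of the chart
  parametrisations \<open>tvec A c\<close>.
\<close>

definition tangent_bundle :: "('m::t2_space, 'b::euclidean_space) chart set \<Rightarrow> ('m \<times> 'b) topology" where
  "tangent_bundle A =
     topology (\<lambda>U. \<forall>c\<in>A. open {p \<in> chart_img c \<times> UNIV. tvec A c p \<in> U})"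

text \<open>
  A derivative is determined, linearly, by its values on the finitely many basis vectors, so
  continuity for each fixed direction gives joint continuity.
\<close>

lemma frechet_derivative_jointly_continuous:
  fixes f :: "'b::euclidean_space \<Rightarrow> 'c::euclidean_space"
  assumes "Ck_on 1 f S"
  shows "continuous_on (S \<times> UNIV) (\<lambda>(z, u). frechet_derivative f (at z) u)"
proof -
  have lin: "linear (frechet_derivative f (at z))" if "z \<in> S" for z
    using assms that by (simp add: linear_frechet_derivative)
  have eq: "frechet_derivative f (at z) u = (\<Sum>b\<in>Basis. (u \<bullet> b) *\<^sub>R frechet_derivative f (at z) b)"
    if "z \<in> S" for z u
  proof -
    have "frechet_derivative f (at z) u = frechet_derivative f (at z) (\<Sum>b\<in>Basis. (u \<bullet> b) *\<^sub>R b)"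
      by (simp add: euclidean_representation)
    also have "\<dots> = (\<Sum>b\<in>Basis. (u \<bullet> b) *\<^sub>R frechet_derivative f (at z) b)"
      using lin[OF that] by (simp add: linear_sum linear_scale)
    finally show ?thesis .
  qed
  have cb: "continuous_on (S \<times> UNIV) (\<lambda>p::'b\<times>'b. frechet_derivative f (at (fst p)) b)" for b
  proof -
    have "continuous_on S (\<lambda>z. frechet_derivative f (at z) b)"
      using assms by simp
    then show ?thesis
      by (rule continuous_on_compose2) (auto intro!: continuous_intros)
  qed
  have "continuous_on (S \<times> UNIV)
     (\<lambda>p::'b\<times>'b. \<Sum>b\<in>Basis. (snd p \<bullet> b) *\<^sub>R frechet_derivative f (at (fst p)) b)"
    by (intro continuous_intros cb)
  then show ?thesis
    by (rule continuous_on_eq) (auto simp: eq split_beta)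
qed

locale compact_atlas =
  fixes A :: "('m::t2_space, 'b::euclidean_space) chart set"
  assumes compact_manifold: "compact_manifold A"
begin

lemma smooth_atlas: "smooth_atlas A" and compact_UNIV: "compact (UNIV :: 'm set)"
  using compact_manifold by (auto simp: compact_manifold_def)

lemma open_chart_dom: "c \<in> A \<Longrightarrow> open (chart_dom c)"
  and open_chart_img: "c \<in> A \<Longrightarrow> open (chart_img c)"
  and chart_homeomorphism: "c \<in> A \<Longrightarrow> homeomorphism (chart_dom c) (chart_img c) (coord c) (param c)"
  using smooth_atlas by (auto simp: smooth_atlas_def)

lemma param_coord [simp]: "c \<in> A \<Longrightarrow> x \<in> chart_dom c \<Longrightarrow> param c (coord c x) = x"
  and coord_param [simp]: "c \<in> A \<Longrightarrow> z \<in> chart_img c \<Longrightarrow> coord c (param c z) = z"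
  and param_in_dom [simp]: "c \<in> A \<Longrightarrow> z \<in> chart_img c \<Longrightarrow> param c z \<in> chart_dom c"
  and continuous_coord: "c \<in> A \<Longrightarrow> continuous_on (chart_dom c) (coord c)"
  and continuous_param: "c \<in> A \<Longrightarrow> continuous_on (chart_img c) (param c)"
  using chart_homeomorphism unfolding homeomorphism_def by blast+

lemma chart_at: "chart_at A x \<in> A" "x \<in> chart_dom (chart_at A x)"
proof -
  have "\<exists>c. c \<in> A \<and> x \<in> chart_dom c"
    using smooth_atlas unfolding smooth_atlas_def by blast
  then show "chart_at A x \<in> A" "x \<in> chart_dom (chart_at A x)"
    unfolding chart_at_def by (metis (mono_tags, lifting) someI_ex)+
qed

lemma coord_image_eq_rep_dom:
  assumes "c \<in> A"
  shows "coord c ` (chart_dom c \<inter> f -` chart_dom d) = rep_dom c d f"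
  using assms by (force simp: rep_dom_def)

lemma C1_map_id: "C1_map A id"
proof -
  have "Ck_on 1 (local_rep c d id) (coord c ` (chart_dom c \<inter> id -` chart_dom d))"
    if "c \<in> A" "d \<in> A" for c d
  proof -
    have "smooth_on (local_rep c d id) (coord c ` (chart_dom c \<inter> chart_dom d))"
      using smooth_atlas that by (auto simp: smooth_atlas_def)
    then show ?thesis
      by (auto simp: smooth_on_def)
  qed
  then show ?thesis
    by (simp add: C1_map_def continuous_on_id)
qed

lemma C1_map_continuous: "C1_map A f \<Longrightarrow> continuous_on UNIV f"
  by (simp add: C1_map_def)

lemma open_rep_dom:
  assumes "c \<in> A" "d \<in> A" "continuous_on UNIV f"
  shows "open (rep_dom c d f)"
proof -
  have "continuous_on (chart_img c) (\<lambda>z. f (param c z))"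
    using continuous_on_compose2[OF assms(3) continuous_param[OF assms(1)]] by simp
  then have "open (chart_img c \<inter> (\<lambda>z. f (param c z)) -` chart_dom d)"
    using open_chart_dom[OF assms(2)] open_chart_img[OF assms(1)] continuous_open_preimage by blast
  moreover have "rep_dom c d f = chart_img c \<inter> (\<lambda>z. f (param c z)) -` chart_dom d"
    by (auto simp: rep_dom_def)
  ultimately show ?thesis by simp
qed

lemma C1_map_Ck:
  assumes "C1_map A f" "c \<in> A" "d \<in> A"
  shows "Ck_on 1 (local_rep c d f) (rep_dom c d f)"
  using assms coord_image_eq_rep_dom[OF assms(2)] unfolding C1_map_def by metis

lemma jac_has_derivative:
  assumes "C1_map A f" "c \<in> A" "d \<in> A" "z \<in> rep_dom c d f"
  shows "(local_rep c d f has_derivative jac c d f z) (at z)"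
  using C1_map_Ck[OF assms(1-3)] assms(4)
  by (simp add: jac_def frechet_derivative_works)

lemma linear_jac:
  assumes "C1_map A f" "c \<in> A" "d \<in> A" "z \<in> rep_dom c d f"
  shows "linear (jac c d f z)"
  using jac_has_derivative[OF assms] has_derivative_linear by blast

lemma continuous_on_jac:
  assumes "C1_map A f" "c \<in> A" "d \<in> A"
  shows "continuous_on (rep_dom c d f \<times> UNIV) (\<lambda>(z, u). jac c d f z u)"
  using frechet_derivative_jointly_continuous[OF C1_map_Ck[OF assms]] by (simp add: jac_def)

lemma jac_unique:
  assumes "open S" "z \<in> S" "\<And>y. y \<in> S \<Longrightarrow> local_rep c d f y = F y" "(F has_derivative F') (at z)"
  shows "(local_rep c d f has_derivative F') (at z)" "jac c d f z = F'"
proof -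
  show *: "(local_rep c d f has_derivative F') (at z)"
    using has_derivative_transform_within_open[OF assms(4,1,2)] assms(3) by simp
  show "jac c d f z = F'"
    unfolding jac_def using frechet_derivative_at[OF *] by simp
qed

lemma rep_dom_comp:
  assumes "c \<in> A" "d \<in> A" "e \<in> A" "z \<in> rep_dom c d h" "f (h (param c z)) \<in> chart_dom e"
  shows "local_rep c d h z \<in> rep_dom d e f" "z \<in> rep_dom c e (f \<circ> h)"
  using assms by (auto simp: rep_dom_def local_rep_def)

text \<open>
  The chain rule in charts, through an arbitrary chart \<open>d\<close> around the intermediate point.
\<close>

lemma jac_comp:
  assumes "C1_map A f" "C1_map A h" "c \<in> A" "d \<in> A" "e \<in> A"
    and "z \<in> rep_dom c d h" "f (h (param c z)) \<in> chart_dom e"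
  shows "(local_rep c e (f \<circ> h) has_derivative
           (\<lambda>u. jac d e f (coord d (h (param c z))) (jac c d h z u))) (at z)"
    and "jac c e (f \<circ> h) z u = jac d e f (coord d (h (param c z))) (jac c d h z u)"
proof -
  have z': "coord d (h (param c z)) = local_rep c d h z"
    by (simp add: local_rep_def)
  have r: "local_rep c d h z \<in> rep_dom d e f"
    by (rule rep_dom_comp(1)[where f = f]) (use assms in auto)
  have 1: "((\<lambda>y. local_rep d e f (local_rep c d h y)) has_derivative
        (\<lambda>u. jac d e f (local_rep c d h z) (jac c d h z u))) (at z)"
    using diff_chain_at[OF jac_has_derivative[OF assms(2,3,4,6)]
        jac_has_derivative[OF assms(1,4,5) r]]
    by (simp add: o_def)
  have 2: "open (rep_dom c d h)"
    using open_rep_dom assms C1_map_continuous by blast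
  have 3: "local_rep c e (f \<circ> h) y = local_rep d e f (local_rep c d h y)" if "y \<in> rep_dom c d h" for y
    using that assms by (simp add: rep_dom_def local_rep_def)
  note * = jac_unique[OF 2 assms(6) 3 1]
  show "(local_rep c e (f \<circ> h) has_derivative
           (\<lambda>u. jac d e f (coord d (h (param c z))) (jac c d h z u))) (at z)"
    using *(1) by (simp add: z')
  show "jac c e (f \<circ> h) z u = jac d e f (coord d (h (param c z))) (jac c d h z u)"
    using *(2) by (simp add: z')
qed

lemma jac_id_self:
  assumes "c \<in> A" "z \<in> chart_img c"
  shows "jac c c id z = id"
proof -
  have "(id has_derivative id) (at z)" by (simp add: id_def)
  with jac_unique(2)[OF open_chart_img[OF assms(1)] assms(2), of c c id id id]
  show ?thesis using assms by (simp add: local_rep_def)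
qed

lemma continuous_on_local_rep:
  assumes "C1_map A f" "c \<in> A" "d \<in> A"
  shows "continuous_on (rep_dom c d f) (local_rep c d f)"
  by (meson assms continuous_at_imp_continuous_on has_derivative_continuous jac_has_derivative)

lemma continuous_on_tjet:
  assumes "C1_map A f" "c \<in> A" "d \<in> A"
  shows "continuous_on (rep_dom c d f \<times> UNIV) (tjet c d f)"
proof -
  have "continuous_on (rep_dom c d f \<times> UNIV) (\<lambda>p::'b\<times>'b. local_rep c d f (fst p))"
    by (rule continuous_on_compose2[OF continuous_on_local_rep[OF assms]]) (auto intro!: continuous_intros)
  moreover have "continuous_on (rep_dom c d f \<times> UNIV) (\<lambda>p. jac c d f (fst p) (snd p))"
    using continuous_on_jac[OF assms] by (simp add: split_beta)
  ultimately have "continuous_on (rep_dom c d f \<times> UNIV) (\<lambda>p. (local_rep c d f (fst p), jac c d f (fst p) (snd p)))"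
    by (rule continuous_on_Pair)
  then show ?thesis
    by (simp add: tjet_def split_beta local_rep_def)
qed

text \<open>
  Near each point the derivative of the composition is the product of two derivatives taken in an
  auxiliary chart at the intermediate point; continuity is a local matter, so different charts
  may serve at different points.
\<close>

lemma C1_map_comp:
  assumes "C1_map A f" "C1_map A h"
  shows "C1_map A (f \<circ> h)"
proof -
  have cont: "continuous_on UNIV (f \<circ> h)"
    using assms C1_map_continuous continuous_on_compose
    by (metis continuous_on_subset subset_UNIV)
  have "Ck_on 1 (local_rep c e (f \<circ> h)) (rep_dom c e (f \<circ> h))" if ce: "c \<in> A" "e \<in> A" for c e
  proof -
    have *: "local_rep c e (f \<circ> h) differentiable (at z) \<and>
       isCont (\<lambda>z. frechet_derivative (local_rep c e (f \<circ> h)) (at z) u) z"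
      if z: "z \<in> rep_dom c e (f \<circ> h)" for z u
    proof
      define d where "d = chart_at A (h (param c z))"
      have d: "d \<in> A" "h (param c z) \<in> chart_dom d"
        using chart_at by (auto simp: d_def)
      define S where "S = rep_dom c d h \<inter> rep_dom c e (f \<circ> h)"
      have S: "open S" "z \<in> S"
        unfolding S_def
        by (intro open_Int open_rep_dom cont C1_map_continuous[OF assms(2)] d ce)
           (use z d in \<open>auto simp: rep_dom_def\<close>)
      have inS: "y \<in> rep_dom c d h" "f (h (param c y)) \<in> chart_dom e" if "y \<in> S" for y
        using that by (auto simp: S_def rep_dom_def)
      show "local_rep c e (f \<circ> h) differentiable (at z)"
        using jac_comp(1)[OF assms ce(1) d(1) ce(2) inS[OF S(2)]] differentiableI by blast
      have eq: "frechet_derivative (local_rep c e (f \<circ> h)) (at y) u =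
         jac d e f (local_rep c d h y) (jac c d h y u)" if "y \<in> S" for y
        using jac_comp(2)[OF assms ce(1) d(1) ce(2) inS[OF that]]
        by (simp add: jac_def local_rep_def)
      have "continuous_on S (\<lambda>y. (\<lambda>(z,u). jac d e f z u) (local_rep c d h y, jac c d h y u))"
      proof (rule continuous_on_compose2[OF continuous_on_jac[OF assms(1) d(1) ce(2)]])
        have 1: "continuous_on S (local_rep c d h)"
          using continuous_on_local_rep[OF assms(2) ce(1) d(1)]
          by (rule continuous_on_subset) (auto simp: S_def)
        have 2: "continuous_on S (\<lambda>y. (\<lambda>(z,u). jac c d h z u) (y, u))"
          by (rule continuous_on_compose2[OF continuous_on_jac[OF assms(2) ce(1) d(1)]])
             (auto simp: S_def intro!: continuous_intros)
        show "continuous_on S (\<lambda>y. (local_rep c d h y, jac c d h y u))"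
          using continuous_on_Pair[OF 1 2] by simp
        show "(\<lambda>y. (local_rep c d h y, jac c d h y u)) ` S \<subseteq> rep_dom d e f \<times> UNIV"
          using rep_dom_comp(1)[OF ce(1) d(1) ce(2)] inS by auto
      qed
      then have "continuous_on S (\<lambda>y. frechet_derivative (local_rep c e (f \<circ> h)) (at y) u)"
        by (rule continuous_on_eq) (simp add: eq)
      then show "isCont (\<lambda>z. frechet_derivative (local_rep c e (f \<circ> h)) (at z) u) z"
        using S continuous_on_eq_continuous_at by blast
    qed
    show ?thesis
      using * by (auto intro!: continuous_at_imp_continuous_on)
  qed
  then show ?thesis
    using cont coord_image_eq_rep_dom by (simp add: C1_map_def)
qed

lemma Diff1_C1_map: "f \<in> Diff1 A \<Longrightarrow> C1_map A f"
  by (simp add: Diff1_def)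

lemma Diff1_bij: "f \<in> Diff1 A \<Longrightarrow> bij f"
  by (simp add: Diff1_def)

lemma id_in_Diff1: "id \<in> Diff1 A"
  by (simp add: Diff1_def C1_map_id)

lemma comp_in_Diff1: "f \<in> Diff1 A \<Longrightarrow> h \<in> Diff1 A \<Longrightarrow> f \<circ> h \<in> Diff1 A"
  by (auto simp: Diff1_def C1_map_comp bij_comp o_inv_distrib)

lemma inv_in_Diff1: "f \<in> Diff1 A \<Longrightarrow> inv f \<in> Diff1 A"
  by (auto simp: Diff1_def inv_inv_eq bij_imp_bij_inv)

lemma funpow_in_Diff1: "f \<in> Diff1 A \<Longrightarrow> f ^^ n \<in> Diff1 A"
  by (induction n) (auto simp: id_in_Diff1 comp_in_Diff1)

lemma tvec_in_dom: "c \<in> A \<Longrightarrow> p \<in> chart_img c \<times> UNIV \<Longrightarrow> fst (tvec A c p) \<in> chart_dom c"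
  by (auto simp: tvec_def)

lemma tcovec_in_img: "c \<in> A \<Longrightarrow> fst q \<in> chart_dom c \<Longrightarrow> tcovec A c q \<in> chart_img c \<times> UNIV"
  by (auto simp: tcovec_def split_beta)

lemma tcovec_tvec:
  assumes "c \<in> A" "d \<in> A" "fst p \<in> rep_dom c d id"
  shows "tcovec A d (tvec A c p) = tjet c d id p"
proof -
  obtain z u where p: "p = (z, u)" by force
  define e where "e = chart_at A (param c z)"
  have e: "e \<in> A" "param c z \<in> chart_dom e"
    using chart_at by (auto simp: e_def)
  have z: "z \<in> rep_dom c e id" "id (id (param c z)) \<in> chart_dom d"
    using assms e by (auto simp: rep_dom_def p)
  have "jac c d (id \<circ> id) z u = jac e d id (coord e (id (param c z))) (jac c e id z u)"
    by (rule jac_comp(2)[OF C1_map_id C1_map_id assms(1) e(1) assms(2) z])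
  then show ?thesis
    by (simp add: p tvec_def tcovec_def tjet_def flip: e_def)
qed

lemma tjet_id_self:
  assumes "c \<in> A" "p \<in> chart_img c \<times> UNIV"
  shows "tjet c c id p = p"
  using assms jac_id_self[OF assms(1), of "fst p"] by (auto simp: tjet_def)

lemma tcovec_tvec_self [simp]:
  assumes "c \<in> A" "p \<in> chart_img c \<times> UNIV"
  shows "tcovec A c (tvec A c p) = p"
  using tcovec_tvec[of c c p] tjet_id_self[OF assms] assms by (auto simp: rep_dom_def)

text \<open>
  Changing both reference charts \<open>chart_at\<close> by the chain rule shows that the tangent map looks like
  \<open>tjet\<close> in every pair of charts, and is thus continuous for the bundle topology.
\<close>

lemma Tmap_tvec:
  assumes "C1_map A f" "c \<in> A" "d \<in> A" "fst p \<in> rep_dom c d f"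
  shows "Tmap A f (tvec A c p) = tvec A d (tjet c d f p)"
proof -
  obtain z u where p: "p = (z, u)" by force
  define x where "x = param c z"
  define e e' where "e = chart_at A x" and "e' = chart_at A (f x)"
  have e: "e \<in> A" "x \<in> chart_dom e" and e': "e' \<in> A" "f x \<in> chart_dom e'"
    using chart_at by (auto simp: e_def e'_def)
  have z: "z \<in> chart_img c" "f x \<in> chart_dom d" "z \<in> rep_dom c d f"
    using assms by (auto simp: rep_dom_def p x_def)
  have 1: "jac c e' (f \<circ> id) z u = jac e e' f (coord e (id (param c z))) (jac c e id z u)"
    by (rule jac_comp(2)[OF assms(1) C1_map_id assms(2) e(1) e'(1)])
       (use z e e' in \<open>auto simp: rep_dom_def x_def\<close>)
  have 2: "jac c e' (id \<circ> f) z u = jac d e' id (coord d (f (param c z))) (jac c d f z u)"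
    by (rule jac_comp(2)[OF C1_map_id assms(1) assms(2,3) e'(1)])
       (use z e e' in \<open>auto simp: rep_dom_def x_def\<close>)
  have 3: "Tmap A f (tvec A c p) = (f x, jac e e' f (coord e x) (jac c e id z u))"
    by (simp add: p Tmap_def tvec_def tangent_map_def jac_def e_def e'_def x_def)
  have 4: "param d (coord d (f x)) = f x" using assms(3) z by simp
  show ?thesis
    unfolding 3 using 1 2 4
    by (simp add: p tvec_def tjet_def x_def[symmetric] e'_def[symmetric])
qed

lemma Tmap_id [simp]: "Tmap A id q = q"
proof -
  obtain x v where q: "q = (x, v)" by force
  have "coord (chart_at A x) x \<in> chart_img (chart_at A x)" using chart_at by simp
  from jac_id_self[OF chart_at(1) this] show ?thesis
    by (simp add: q Tmap_def tangent_map_def jac_def)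
qed

lemma tvec_tjet_id:
  assumes "c \<in> A" "d \<in> A" "fst p \<in> rep_dom c d id"
  shows "tvec A d (tjet c d id p) = tvec A c p"
  using Tmap_tvec[OF C1_map_id assms] by simp

lemma tvec_tcovec [simp]:
  assumes "c \<in> A" "fst q \<in> chart_dom c"
  shows "tvec A c (tcovec A c q) = q"
proof -
  obtain x v where q: "q = (x, v)" by force
  define e where "e = chart_at A x"
  have e: "e \<in> A" "x \<in> chart_dom e"
    using chart_at by (auto simp: e_def)
  have ve: "tvec A e (coord e x, v) = q"
    using e jac_id_self[of e "coord e x"] by (simp add: tvec_def q flip: e_def)
  have "fst (coord e x, v) \<in> rep_dom e c id"
    using e assms by (auto simp: rep_dom_def q)
  from tvec_tjet_id[OF e(1) assms(1) this] tcovec_tvec[OF e(1) assms(1) this]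
  show ?thesis by (simp add: ve)
qed

lemma Tmap_comp:
  assumes "C1_map A f" "C1_map A h"
  shows "Tmap A (f \<circ> h) q = Tmap A f (Tmap A h q)"
proof -
  obtain x v where q: "q = (x, v)" by force
  define c d e where "c = chart_at A x" and "d = chart_at A (h x)" and "e = chart_at A (f (h x))"
  have *: "c \<in> A" "x \<in> chart_dom c" "d \<in> A" "h x \<in> chart_dom d" "e \<in> A" "f (h x) \<in> chart_dom e"
    using chart_at by (auto simp: c_def d_def e_def)
  have "jac c e (f \<circ> h) (coord c x) v =
    jac d e f (coord d (h (param c (coord c x)))) (jac c d h (coord c x) v)"
    by (rule jac_comp(2)[OF assms *(1,3,5)]) (use * in \<open>auto simp: rep_dom_def\<close>)
  then show ?thesis
    using * by (simp add: q Tmap_def tangent_map_def jac_def c_def d_def e_def)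
qed

lemma linear_tangent_map:
  assumes "C1_map A f"
  shows "linear (tangent_map A f x)"
proof -
  have "coord (chart_at A x) x \<in> rep_dom (chart_at A x) (chart_at A (f x)) f"
    using chart_at by (auto simp: rep_dom_def)
  from linear_jac[OF assms chart_at(1) chart_at(1) this]
  show ?thesis by (simp add: tangent_map_def jac_def)
qed

lemma openin_tangent_bundle:
  "openin (tangent_bundle A) U \<longleftrightarrow> (\<forall>c\<in>A. open {p \<in> chart_img c \<times> UNIV. tvec A c p \<in> U})"
proof -
  have "istopology (\<lambda>U. \<forall>c\<in>A. open {p \<in> chart_img c \<times> UNIV. tvec A c p \<in> U})"
    unfolding istopology_def
  proof (intro conjI allI impI ballI)
    fix S T c assume "\<forall>c\<in>A. open {p \<in> chart_img c \<times> UNIV. tvec A c p \<in> S}"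
      "\<forall>c\<in>A. open {p \<in> chart_img c \<times> UNIV. tvec A c p \<in> T}" "c \<in> A"
    then have "open ({p \<in> chart_img c \<times> UNIV. tvec A c p \<in> S} \<inter> {p \<in> chart_img c \<times> UNIV. tvec A c p \<in> T})"
      by blast
    moreover have "{p \<in> chart_img c \<times> UNIV. tvec A c p \<in> S} \<inter> {p \<in> chart_img c \<times> UNIV. tvec A c p \<in> T}
       = {p \<in> chart_img c \<times> UNIV. tvec A c p \<in> S \<inter> T}" by blast
    ultimately show "open {p \<in> chart_img c \<times> UNIV. tvec A c p \<in> S \<inter> T}" by simp
  next
    fix \<U> c assume *: "\<forall>U\<in>\<U>. \<forall>c\<in>A. open {p \<in> chart_img c \<times> UNIV. tvec A c p \<in> U}" "c \<in> A"
    have "{p \<in> chart_img c \<times> UNIV. tvec A c p \<in> \<Union>\<U>} = (\<Union>U\<in>\<U>. {p \<in> chart_img c \<times> UNIV. tvec A c p \<in> U})"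
      by blast
    then show "open {p \<in> chart_img c \<times> UNIV. tvec A c p \<in> \<Union>\<U>}"
      using * by (simp only:) (intro open_UN, blast)
  qed
  then show ?thesis
    by (simp add: tangent_bundle_def topology_inverse')
qed

lemma topspace_tangent_bundle [simp]: "topspace (tangent_bundle A) = UNIV"
proof -
  have "openin (tangent_bundle A) UNIV"
    unfolding openin_tangent_bundle by (simp add: open_Times open_chart_img)
  then show ?thesis
    using openin_subset by blast
qed

text \<open>
  Seen from another chart, the image of an open set is its preimage under a coordinate change.
\<close>

lemma openin_tvec_image:
  assumes "c \<in> A" "open V" "V \<subseteq> chart_img c \<times> UNIV"
  shows "openin (tangent_bundle A) (tvec A c ` V)"
  unfolding openin_tangent_bundle
proof
  fix d assume d: "d \<in> A"
  have eq: "{p \<in> chart_img d \<times> UNIV. tvec A d p \<in> tvec A c ` V} =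
      (rep_dom d c id \<times> UNIV) \<inter> tjet d c id -` V" (is "?l = ?r")
  proof (intro equalityI subsetI)
    fix p assume "p \<in> ?l"
    then obtain q where q: "p \<in> chart_img d \<times> UNIV" "tvec A d p = tvec A c q" "q \<in> V" by auto
    have "fst (tvec A d p) \<in> chart_dom c"
      using q assms tvec_in_dom by (metis subsetD)
    then have r: "fst p \<in> rep_dom d c id"
      using q(1) by (auto simp: rep_dom_def tvec_def split_beta)
    have "tjet d c id p = q"
      using tcovec_tvec[OF d assms(1) r] q assms tcovec_tvec_self by (metis subsetD)
    then show "p \<in> ?r" using r q by (auto simp: mem_Times_iff)
  next
    fix p assume p: "p \<in> ?r"
    then have r: "fst p \<in> rep_dom d c id" by auto
    show "p \<in> ?l"
      using tvec_tjet_id[OF d assms(1) r] p by (force simp: rep_dom_def)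
  qed
  show "open {p \<in> chart_img d \<times> UNIV. tvec A d p \<in> tvec A c ` V}"
    unfolding eq
    by (intro continuous_open_preimage continuous_on_tjet C1_map_id open_Times open_rep_dom
        assms d open_UNIV continuous_on_id')
qed

lemma continuous_map_tvec:
  assumes "c \<in> A"
  shows "continuous_map (top_of_set (chart_img c \<times> UNIV)) (tangent_bundle A) (tvec A c)"
proof -
  have "openin (top_of_set (chart_img c \<times> UNIV)) {p \<in> chart_img c \<times> UNIV. tvec A c p \<in> U}"
    if "openin (tangent_bundle A) U" for U
    using that assms
    by (intro open_openin_trans open_Times open_chart_img) (auto simp: openin_tangent_bundle)
  then show ?thesis
    by (simp add: continuous_map_def)
qed

lemma compactin_tvec_image:
  assumes "c \<in> A" "compact K" "K \<subseteq> chart_img c \<times> UNIV"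
  shows "compactin (tangent_bundle A) (tvec A c ` K)"
  using image_compactin[OF _ continuous_map_tvec[OF assms(1)]] assms
  by (simp add: compactin_subtopology)

lemma continuous_map_Tmap:
  assumes "C1_map A f"
  shows "continuous_map (tangent_bundle A) (tangent_bundle A) (Tmap A f)"
proof -
  have "openin (tangent_bundle A) {q. Tmap A f q \<in> U}" if U: "openin (tangent_bundle A) U" for U
    unfolding openin_tangent_bundle
  proof
    fix c assume c: "c \<in> A"
    show "open {p \<in> chart_img c \<times> UNIV. tvec A c p \<in> {q. Tmap A f q \<in> U}}"
    proof (subst open_subopen, intro ballI)
      fix p assume p: "p \<in> {p \<in> chart_img c \<times> UNIV. tvec A c p \<in> {q. Tmap A f q \<in> U}}"
      define d where "d = chart_at A (f (param c (fst p)))"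
      have d: "d \<in> A" "f (param c (fst p)) \<in> chart_dom d"
        using chart_at by (auto simp: d_def)
      define V where "V = (rep_dom c d f \<times> UNIV) \<inter> tjet c d f -` {p \<in> chart_img d \<times> UNIV. tvec A d p \<in> U}"
      have "open V"
        unfolding V_def
        by (intro continuous_open_preimage continuous_on_tjet assms open_Times open_rep_dom
             C1_map_continuous c d open_UNIV) (use U d in \<open>auto simp: openin_tangent_bundle\<close>)
      moreover have "p \<in> V"
        using p d c Tmap_tvec[OF assms c d(1), of p]
        by (auto simp: V_def rep_dom_def tjet_def mem_Times_iff split_beta)
      moreover have "V \<subseteq> {p \<in> chart_img c \<times> UNIV. tvec A c p \<in> {q. Tmap A f q \<in> U}}"
        using Tmap_tvec[OF assms c d(1)] by (auto simp: V_def rep_dom_def)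
      ultimately show "\<exists>T. open T \<and> p \<in> T \<and> T \<subseteq> {p \<in> chart_img c \<times> UNIV. tvec A c p \<in> {q. Tmap A f q \<in> U}}"
        by blast
    qed
  qed
  then show ?thesis
    by (simp add: continuous_map_def)
qed

lemma finite_subatlas: "\<exists>A0\<subseteq>A. finite A0 \<and> (\<Union>c\<in>A0. chart_dom c) = UNIV"
proof -
  have "UNIV \<subseteq> (\<Union>c\<in>A. chart_dom c)"
    using smooth_atlas by (simp add: smooth_atlas_def)
  with compactE_image[OF compact_UNIV, of A chart_dom] open_chart_dom
  obtain A0 where "A0 \<subseteq> A" "finite A0" "UNIV \<subseteq> (\<Union>c\<in>A0. chart_dom c)"
    by metis
  then show ?thesis by blast
qed

end

section \<open>Compact-open topologies with a countable subbase\<close>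

text \<open>
  Second countability and local compactness in one datum: countably many open sets \<open>B\<close>, each inside a
  compact set \<open>K\<close>, such that the \<open>K\<close> are small enough to fit into any neighbourhood.
\<close>

definition compact_base :: "'a topology \<Rightarrow> ('a set \<times> 'a set) set \<Rightarrow> bool" where
  "compact_base X P \<longleftrightarrow> countable P \<and>
     (\<forall>(B, K)\<in>P. openin X B \<and> compactin X K \<and> B \<subseteq> K) \<and>
     (\<forall>U q. openin X U \<and> q \<in> U \<longrightarrow> (\<exists>(B, K)\<in>P. q \<in> B \<and> K \<subseteq> U))"

definition base_pairs :: "('a set \<times> 'a set) set \<Rightarrow> ('a set \<times> 'a set) set" where
  "base_pairs P = snd ` P \<times> fst ` P"

text \<open>
  A finite \<open>J\<close> stands for the basic open set of the compact-open topology that consists of the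
  maps sending \<open>K\<close> into \<open>W\<close> for each \<open>(K, W)\<close> in \<open>J\<close>.
\<close>

definition carries :: "('a \<Rightarrow> 'a) \<Rightarrow> ('a set \<times> 'a set) set \<Rightarrow> bool" where
  "carries f J \<longleftrightarrow> (\<forall>(K, W)\<in>J. f ` K \<subseteq> W)"

lemma carries_UN: "carries f (\<Union>i\<in>I. J i) \<longleftrightarrow> (\<forall>i\<in>I. carries f (J i))"
  by (auto simp: carries_def)

lemma compact_base_basic:
  assumes "compact_base X P" "(B, K) \<in> P"
  shows "openin X B" "compactin X K" "B \<subseteq> K"
  using assms by (auto simp: compact_base_def)

lemma compact_base_nbhd:
  assumes "compact_base X P" "openin X U" "q \<in> U"
  obtains B K where "(B, K) \<in> P" "q \<in> B" "B \<subseteq> K" "K \<subseteq> U"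
proof -
  obtain BK where "BK \<in> P" "case BK of (B, K) \<Rightarrow> q \<in> B \<and> K \<subseteq> U"
    using assms unfolding compact_base_def by blast
  then show thesis
    using that[of "fst BK" "snd BK"] compact_base_basic(3)[OF assms(1), of "fst BK" "snd BK"]
    by (auto simp: split_beta)
qed

lemma compactin_finite_cover:
  assumes "compactin X C" and "\<And>q. q \<in> C \<Longrightarrow> openin X (B q) \<and> q \<in> B q"
  obtains C0 where "C0 \<subseteq> C" "finite C0" "C \<subseteq> (\<Union>q\<in>C0. B q)"
proof -
  have "\<forall>U\<in>B ` C. openin X U" "C \<subseteq> \<Union>(B ` C)"
    using assms(2) by blast+
  then have "\<exists>\<F>. finite \<F> \<and> \<F> \<subseteq> B ` C \<and> C \<subseteq> \<Union>\<F>"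
    using assms(1) unfolding compactin_def by simp
  then obtain \<F> where "finite \<F>" "\<F> \<subseteq> B ` C" "C \<subseteq> \<Union>\<F>" by blast
  then show thesis using that by (metis finite_subset_image)
qed

text \<open>
  Around each point of \<open>C\<close> the map \<open>h\<close> sends a compact base set \<open>K\<close> into a base set \<open>W\<close> with
  \<open>K \<times> W\<close> inside \<open>\<Omega>\<close>; finitely many of these \<open>K\<close> cover \<open>C\<close>. A condition on the graph, instead of on
  the values alone, lets uniform closeness to a given map be of this form.
\<close>

lemma compact_open_graph_nbhd:
  assumes base: "compact_base X P" and C: "compactin X C"
    and \<Omega>: "openin (prod_topology X X) \<Omega>"
    and h: "continuous_map X X h" "\<And>q. q \<in> C \<Longrightarrow> (q, h q) \<in> \<Omega>"
  shows "\<exists>J \<subseteq> base_pairs P. finite J \<and> carries h J \<and>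
           (\<forall>k. carries k J \<longrightarrow> (\<forall>q\<in>C. (q, k q) \<in> \<Omega>))"
proof -
  have CX: "C \<subseteq> topspace X" using C by (simp add: compactin_def)
  have "\<exists>B K W. openin X B \<and> q \<in> B \<and> B \<subseteq> K \<and> (K, W) \<in> base_pairs P \<and> h ` K \<subseteq> W \<and>
      (\<forall>k. k ` K \<subseteq> W \<longrightarrow> (\<forall>q'\<in>B. (q', k q') \<in> \<Omega>))" if q: "q \<in> C" for q
  proof -
    have "(q, h q) \<in> \<Omega>" using h q by blast
    then obtain U V where UV: "openin X U" "openin X V" "q \<in> U" "h q \<in> V" "U \<times> V \<subseteq> \<Omega>"
      using \<Omega> unfolding openin_prod_topology_alt by meson
    obtain W K' where W: "(W, K') \<in> P" "h q \<in> W" "W \<subseteq> K'" "K' \<subseteq> V"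
      using compact_base_nbhd[OF base UV(2,4)] by blast
    have "openin X {x \<in> topspace X. h x \<in> W}"
      using openin_continuous_map_preimage[OF h(1)] compact_base_basic(1)[OF base W(1)] by blast
    then have "openin X (U \<inter> {x \<in> topspace X. h x \<in> W})" "q \<in> U \<inter> {x \<in> topspace X. h x \<in> W}"
      using UV q CX W by auto
    from compact_base_nbhd[OF base this] obtain B K
      where BK: "(B, K) \<in> P" "q \<in> B" "B \<subseteq> K" "K \<subseteq> U \<inter> {x \<in> topspace X. h x \<in> W}" .
    have "(K, W) \<in> base_pairs P"
      using BK(1) W(1) unfolding base_pairs_def by (force simp: image_iff)
    moreover have "\<forall>k. k ` K \<subseteq> W \<longrightarrow> (\<forall>q'\<in>B. (q', k q') \<in> \<Omega>)"
      using BK W UV by blast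
    moreover have "h ` K \<subseteq> W" using BK by blast
    ultimately show ?thesis
      using BK(2,3) compact_base_basic(1)[OF base BK(1)]
      by (intro exI[of _ B] exI[of _ K] exI[of _ W] conjI)
  qed
  then obtain B K W where BKW: "\<And>q. q \<in> C \<Longrightarrow> openin X (B q) \<and> q \<in> B q"
     "\<And>q. q \<in> C \<Longrightarrow> (K q, W q) \<in> base_pairs P" "\<And>q. q \<in> C \<Longrightarrow> h ` K q \<subseteq> W q"
     "\<And>q k. q \<in> C \<Longrightarrow> k ` K q \<subseteq> W q \<Longrightarrow> \<forall>q'\<in>B q. (q', k q') \<in> \<Omega>"
    by metis
  obtain C0 where C0: "C0 \<subseteq> C" "finite C0" "C \<subseteq> (\<Union>q\<in>C0. B q)"
    using compactin_finite_cover[OF C BKW(1)] by blast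
  define J where "J = (\<lambda>q. (K q, W q)) ` C0"
  have "\<forall>q\<in>C. (q, k q) \<in> \<Omega>" if "carries k J" for k
  proof
    fix q assume "q \<in> C"
    then obtain q0 where q0: "q0 \<in> C0" "q \<in> B q0" using C0(3) by blast
    then have "k ` K q0 \<subseteq> W q0" using that by (auto simp: J_def carries_def)
    then show "(q, k q) \<in> \<Omega>" using BKW(4)[of q0 k] q0 C0(1) by blast
  qed
  moreover have "J \<subseteq> base_pairs P" "finite J"
    using BKW(2) C0 by (auto simp: J_def)
  moreover have "carries h J"
    using BKW(3) C0(1) unfolding J_def carries_def by blast
  ultimately show ?thesis by (intro exI[of _ J]) simp
qed

text \<open>
  Local compactness is what makes composition continuous: around \<open>h q\<close> there is a compact set \<open>K1\<close>
  that \<open>f\<close> still sends into \<open>W\<close>, and whose interior \<open>B1\<close> constrains \<open>h\<close>.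
\<close>

lemma compact_open_comp_nbhd:
  assumes base: "compact_base X P" and C: "compactin X C" and W: "openin X W"
    and h: "continuous_map X X h" and f: "continuous_map X X f" "f ` h ` C \<subseteq> W"
  shows "\<exists>J1 \<subseteq> base_pairs P. \<exists>J2 \<subseteq> base_pairs P. finite J1 \<and> finite J2 \<and> carries f J1 \<and> carries h J2 \<and>
           (\<forall>f' h'. carries f' J1 \<longrightarrow> carries h' J2 \<longrightarrow> f' ` h' ` C \<subseteq> W)"
proof -
  have CX: "C \<subseteq> topspace X" using C by (simp add: compactin_def)
  have "\<exists>B. openin X B \<and> q \<in> B \<and> (\<exists>J1 \<subseteq> base_pairs P. \<exists>J2 \<subseteq> base_pairs P. finite J1 \<and> finite J2 \<and>
        carries f J1 \<and> carries h J2 \<and>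
           (\<forall>f' h'. carries f' J1 \<longrightarrow> carries h' J2 \<longrightarrow> f' ` h' ` B \<subseteq> W))" if q: "q \<in> C" for q
  proof -
    have hq: "h q \<in> topspace X" using q CX h by (auto simp: continuous_map_def)
    obtain W' K' where W': "(W', K') \<in> P" "f (h q) \<in> W'" "W' \<subseteq> K'" "K' \<subseteq> W"
      using compact_base_nbhd[OF base W, of "f (h q)"] f(2) q by blast
    have "openin X {x \<in> topspace X. f x \<in> W'}" "h q \<in> {x \<in> topspace X. f x \<in> W'}"
      using openin_continuous_map_preimage[OF f(1)] compact_base_basic(1)[OF base W'(1)] hq W' by auto
    from compact_base_nbhd[OF base this] obtain B1 K1
      where 1: "(B1, K1) \<in> P" "h q \<in> B1" "B1 \<subseteq> K1" "K1 \<subseteq> {x \<in> topspace X. f x \<in> W'}" .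
    have "openin X {x \<in> topspace X. h x \<in> B1}" "q \<in> {x \<in> topspace X. h x \<in> B1}"
      using openin_continuous_map_preimage[OF h(1)] compact_base_basic(1)[OF base 1(1)] q CX 1 by auto
    from compact_base_nbhd[OF base this] obtain B2 K2
      where 2: "(B2, K2) \<in> P" "q \<in> B2" "B2 \<subseteq> K2" "K2 \<subseteq> {x \<in> topspace X. h x \<in> B1}" .
    have "(K1, W') \<in> base_pairs P" "(K2, B1) \<in> base_pairs P"
      using 1(1) 2(1) W'(1) unfolding base_pairs_def by (force simp: image_iff)+
    moreover have "carries f {(K1, W')}" "carries h {(K2, B1)}"
      using 1(4) 2(4) by (auto simp: carries_def)
    moreover have "\<forall>f' h'. carries f' {(K1, W')} \<longrightarrow> carries h' {(K2, B1)} \<longrightarrow> f' ` h' ` B2 \<subseteq> W"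
    proof (intro allI impI)
      fix f' h' assume a: "carries f' {(K1, W')}" "carries h' {(K2, B1)}"
      have "h' ` B2 \<subseteq> K1" using a(2) 2(3) 1(3) by (auto simp: carries_def)
      then show "f' ` h' ` B2 \<subseteq> W" using a(1) W'(3,4) by (force simp: carries_def)
    qed
    ultimately show ?thesis
      using 2(2) compact_base_basic(1)[OF base 2(1)]
      by (intro exI[of _ B2] conjI exI[of _ "{(K1, W')}"] exI[of _ "{(K2, B1)}"]) auto
  qed
  then obtain B where B: "\<And>q. q \<in> C \<Longrightarrow> openin X (B q) \<and> q \<in> B q"
    and "\<And>q. q \<in> C \<Longrightarrow> \<exists>J1 \<subseteq> base_pairs P. \<exists>J2 \<subseteq> base_pairs P. finite J1 \<and> finite J2 \<and>
        carries f J1 \<and> carries h J2 \<and>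
           (\<forall>f' h'. carries f' J1 \<longrightarrow> carries h' J2 \<longrightarrow> f' ` h' ` B q \<subseteq> W)"
    by metis
  then obtain J1 J2 where J: "\<And>q. q \<in> C \<Longrightarrow> J1 q \<subseteq> base_pairs P \<and> J2 q \<subseteq> base_pairs P \<and>
        finite (J1 q) \<and> finite (J2 q) \<and> carries f (J1 q) \<and> carries h (J2 q)"
     "\<And>q f' h'. q \<in> C \<Longrightarrow> carries f' (J1 q) \<Longrightarrow> carries h' (J2 q) \<Longrightarrow> f' ` h' ` B q \<subseteq> W"
    by metis
  obtain C0 where C0: "C0 \<subseteq> C" "finite C0" "C \<subseteq> (\<Union>q\<in>C0. B q)"
    using compactin_finite_cover[OF C B] by blast
  have fin: "(\<Union>q\<in>C0. J1 q) \<subseteq> base_pairs P" "(\<Union>q\<in>C0. J2 q) \<subseteq> base_pairs P"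
    "finite (\<Union>q\<in>C0. J1 q)" "finite (\<Union>q\<in>C0. J2 q)"
    "carries f (\<Union>q\<in>C0. J1 q)" "carries h (\<Union>q\<in>C0. J2 q)"
    using J(1) C0 unfolding carries_UN by blast+
  have "f' ` h' ` C \<subseteq> W" if a: "carries f' (\<Union>q\<in>C0. J1 q)" "carries h' (\<Union>q\<in>C0. J2 q)" for f' h'
  proof -
    have "f' ` h' ` B q \<subseteq> W" if "q \<in> C0" for q
      using that a J(2)[of q f' h'] C0 unfolding carries_UN by blast
    then show ?thesis using C0(3) by blast
  qed
  with fin show ?thesis
    by (intro exI[of _ "\<Union>q\<in>C0. J1 q"] exI[of _ "\<Union>q\<in>C0. J2 q"] conjI allI impI)
qed

section \<open>The C^1 topology as a compact-open topology\<close>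

lemma norm_le_onorm:
  fixes L :: "'b::euclidean_space \<Rightarrow> 'c::real_normed_vector"
  shows "linear L \<Longrightarrow> norm (L u) \<le> onorm L * norm u"
  by (rule onorm) (simp add: linear_conv_bounded_linear)

text \<open>
  The operator norm is attained on the unit ball, so the strict inequality survives the supremum.
\<close>

lemma onorm_less_of_unit_ball:
  fixes L :: "'b::euclidean_space \<Rightarrow> 'c::euclidean_space"
  assumes "linear L" "\<And>u. norm u \<le> 1 \<Longrightarrow> norm (L u) < e"
  shows "onorm L < e"
proof -
  have "continuous_on (cball 0 1) (\<lambda>u. norm (L u))"
    by (intro continuous_on_norm linear_continuous_on linear_conv_bounded_linear[THEN iffD1] assms(1))
  then obtain u0 where u0: "u0 \<in> cball 0 1" "\<And>u. u \<in> cball 0 1 \<Longrightarrow> norm (L u) \<le> norm (L u0)"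
    using continuous_attains_sup[of "cball (0::'b) 1" "\<lambda>u. norm (L u)"] by auto
  have "norm (L x) \<le> norm (L u0) * norm x" for x
  proof (cases "x = 0")
    case True then show ?thesis using assms(1) by (simp add: linear_0)
  next
    case False
    then have "norm (L ((1 / norm x) *\<^sub>R x)) \<le> norm (L u0)"
      by (intro u0(2)) simp
    then show ?thesis
      using False assms(1) by (simp add: linear_scale field_simps)
  qed
  then have "onorm L \<le> norm (L u0)"
    by (intro onorm_bound) auto
  then show ?thesis using assms(2)[of u0] u0(1) by simp
qed

context compact_atlas
begin

definition chart_ball :: "('m \<times> 'b) set \<Rightarrow> ('m \<times> 'b) set \<Rightarrow> bool" where
  "chart_ball B K \<longleftrightarrow> (\<exists>c\<in>A. \<exists>p r. B = tvec A c ` ball p r \<and> K = tvec A c ` cball p r \<and>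
     cball p r \<subseteq> chart_img c \<times> UNIV)"

lemma chart_ball_basic:
  assumes "chart_ball B K"
  shows "openin (tangent_bundle A) B \<and> compactin (tangent_bundle A) K \<and> B \<subseteq> K"
proof -
  obtain c p r where c: "c \<in> A" "B = tvec A c ` ball p r" "K = tvec A c ` cball p r"
    "cball p r \<subseteq> chart_img c \<times> UNIV" using assms unfolding chart_ball_def by blast
  have "ball p r \<subseteq> chart_img c \<times> UNIV" using c(4) ball_subset_cball by blast
  then show ?thesis
    unfolding c(2,3) using openin_tvec_image[OF c(1) open_ball]
      compactin_tvec_image[OF c(1) compact_cball c(4)] image_mono[OF ball_subset_cball] by simp
qed

text \<open>
  Compactness of the manifold makes finitely many charts sufficient; in each chart, balls around a
  countable dense set with radii \<open>1 / (n + 1)\<close> form a base.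
\<close>

lemma tangent_bundle_base: "\<exists>P. compact_base (tangent_bundle A) P \<and> (\<forall>B K. (B, K) \<in> P \<longrightarrow> chart_ball B K)"
proof -
  obtain A0 where A0: "A0 \<subseteq> A" "finite A0" "(\<Union>c\<in>A0. chart_dom c) = UNIV"
    using finite_subatlas by blast
  obtain D :: "('b \<times> 'b) set" where D: "countable D" "\<And>X. open X \<Longrightarrow> X \<noteq> {} \<Longrightarrow> \<exists>d\<in>D. d \<in> X"
    using countable_dense_setE[where 'a = "'b \<times> 'b"] by metis
  define J where "J = {(c, p, r). c \<in> A0 \<and> p \<in> D \<and> r \<in> range (\<lambda>n::nat. 1 / real (Suc n)) \<and>
      cball p r \<subseteq> chart_img c \<times> UNIV}"
  define P where "P = (\<lambda>(c, p, r). (tvec A c ` ball p r, tvec A c ` cball p r)) ` J"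
  have "J \<subseteq> A0 \<times> D \<times> range (\<lambda>n::nat. 1 / real (Suc n))"
    by (auto simp: J_def)
  moreover have "countable (A0 \<times> D \<times> range (\<lambda>n::nat. 1 / real (Suc n)))"
    using A0 D by (intro countable_SIGMA) (auto intro: countable_finite)
  ultimately have c: "countable P"
    unfolding P_def using countable_subset by blast
  have b: "chart_ball B K" if "(B, K) \<in> P" for B K
    unfolding chart_ball_def using that A0(1) by (auto simp: P_def J_def)
  have n: "\<exists>(B, K)\<in>P. q \<in> B \<and> K \<subseteq> U" if U: "openin (tangent_bundle A) U" "q \<in> U" for U q
  proof -
    obtain c where c: "c \<in> A0" "fst q \<in> chart_dom c" using A0(3) by blast
    then have cA: "c \<in> A" using A0 by blast
    define V where "V = {p \<in> chart_img c \<times> UNIV. tvec A c p \<in> U}"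
    have V: "open V" using U cA by (simp add: V_def openin_tangent_bundle)
    define p0 where "p0 = tcovec A c q"
    have p0: "p0 \<in> V" "tvec A c p0 = q"
      using c cA U tcovec_in_img[OF cA, of q] by (auto simp: V_def p0_def)
    obtain e where e: "e > 0" "ball p0 e \<subseteq> V"
      using V p0(1) open_contains_ball by blast
    obtain n where n: "1 / real (Suc n) < e / 2"
      using nat_approx_posE[of "e / 2"] e(1) by auto
    define r where "r = 1 / real (Suc n)"
    have r: "r > 0" "r < e / 2" using n by (auto simp: r_def)
    obtain p where p: "p \<in> D" "p \<in> ball p0 r"
      using D(2)[of "ball p0 r"] r by auto
    have sub: "cball p r \<subseteq> V"
    proof
      fix x assume "x \<in> cball p r"
      then have "dist p x \<le> r" by simp
      moreover have "dist p0 p < r" using p(2) by simp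
      ultimately have "dist p0 x < e" using dist_triangle[of p0 x p] r by linarith
      then have "x \<in> ball p0 e" by simp
      then show "x \<in> V" using e by blast
    qed
    have "cball p r \<subseteq> chart_img c \<times> UNIV" using sub by (auto simp: V_def)
    moreover have "r \<in> range (\<lambda>n::nat. 1 / real (Suc n))" unfolding r_def by (rule rangeI)
    ultimately have "(c, p, r) \<in> J"
      using c(1) p(1) by (simp add: J_def)
    then have "(tvec A c ` ball p r, tvec A c ` cball p r) \<in> P"
      unfolding P_def by (rule rev_image_eqI) simp
    moreover have "q \<in> tvec A c ` ball p r"
    proof -
      have "p0 \<in> ball p r" using p(2) by (simp add: dist_commute)
      then have "tvec A c p0 \<in> tvec A c ` ball p r" by (rule imageI)
      then show ?thesis by (simp only: p0)
    qed
    moreover have "tvec A c ` cball p r \<subseteq> U"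
      using sub by (auto simp: V_def)
    ultimately show ?thesis
      by (intro bexI[of _ "(tvec A c ` ball p r, tvec A c ` cball p r)"]) simp_all
  qed
  have "compact_base (tangent_bundle A) P"
    unfolding compact_base_def
  proof (intro conjI c)
    show "\<forall>(B, K)\<in>P. openin (tangent_bundle A) B \<and> compactin (tangent_bundle A) K \<and> B \<subseteq> K"
      using b chart_ball_basic by blast
    show "\<forall>U q. openin (tangent_bundle A) U \<and> q \<in> U \<longrightarrow> (\<exists>(B, K)\<in>P. q \<in> B \<and> K \<subseteq> U)"
      using n by simp
  qed
  then show ?thesis using b by (intro exI[of _ P]) simp
qed


definition bundle_base :: "(('m \<times> 'b) set \<times> ('m \<times> 'b) set) set" where
  "bundle_base = (SOME P. compact_base (tangent_bundle A) P \<and> (\<forall>B K. (B, K) \<in> P \<longrightarrow> chart_ball B K))"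

lemma bundle_base: "compact_base (tangent_bundle A) bundle_base" "(B, K) \<in> bundle_base \<Longrightarrow> chart_ball B K"
  using someI_ex[OF tangent_bundle_base] unfolding bundle_base_def[symmetric] by auto

text \<open>
  The basic open sets of the compact-open topology of tangent maps, on diffeomorphisms.
\<close>

definition diffs_carrying :: "(('m \<times> 'b) set \<times> ('m \<times> 'b) set) set \<Rightarrow> ('m \<Rightarrow> 'm) set" where
  "diffs_carrying J = {f \<in> Diff1 A. carries (Tmap A f) J}"

lemma topspace_C1_topology [simp]: "topspace (C1_topology A) = Diff1 A"
proof -
  have "topspace (C1_topology A) \<subseteq> Diff1 A"
    by (auto simp: C1_topology_def topology_generated_by_topspace C1_nbhd_def)
  moreover have "Diff1 A \<subseteq> topspace (C1_topology A)"
  proof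
    fix f assume "f \<in> Diff1 A"
    obtain c where "c \<in> A" using chart_at by blast
    then have "openin (C1_topology A) (C1_nbhd A id c c {} 1)"
      unfolding C1_topology_def using id_in_Diff1
      by (intro topology_generated_by_Basis CollectI exI[of _ id] exI[of _ c] exI[of _ "{}"] exI[of _ 1]) simp
    moreover have "f \<in> C1_nbhd A id c c {} 1" using \<open>f \<in> Diff1 A\<close> by (simp add: C1_nbhd_def)
    ultimately show "f \<in> topspace (C1_topology A)"
      using openin_subset by blast
  qed
  ultimately show ?thesis by blast
qed

lemma openin_C1_nbhd:
  assumes "f \<in> Diff1 A" "c \<in> A" "d \<in> A" "compact K" "K \<subseteq> chart_dom c" "f ` K \<subseteq> chart_dom d" "e > 0"
  shows "openin (C1_topology A) (C1_nbhd A f c d K e)"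
  unfolding C1_topology_def by (rule topology_generated_by_Basis) (use assms in blast)

text \<open>
  The image of the compact set \<open>C\<close> keeps some distance \<open>e0\<close> from the complement of \<open>V\<close>. The fibre
  coordinates in \<open>C\<close> are bounded by some \<open>R\<close>, so a map whose values and derivatives
  differ by less than \<open>e0 / (1 + R)\<close> moves each vector of \<open>C\<close> by less than \<open>e0\<close>.
\<close>

lemma openin_C1_chart_carry:
  assumes c: "c \<in> A" and d: "d \<in> A" and C: "compact C" "C \<subseteq> chart_img c \<times> UNIV"
    and V: "open V" "V \<subseteq> chart_img d \<times> UNIV"
  shows "openin (C1_topology A) {f \<in> Diff1 A. Tmap A f ` tvec A c ` C \<subseteq> tvec A d ` V}"
proof (subst openin_subopen, intro ballI)
  fix h0 assume "h0 \<in> {f \<in> Diff1 A. Tmap A f ` tvec A c ` C \<subseteq> tvec A d ` V}"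
  then have h0: "h0 \<in> Diff1 A" "\<And>p. p \<in> C \<Longrightarrow> Tmap A h0 (tvec A c p) \<in> tvec A d ` V" by auto
  note h0C = Diff1_C1_map[OF h0(1)]
  have dom: "fst p \<in> rep_dom c d h0" "tjet c d h0 p \<in> V" if p: "p \<in> C" for p
  proof -
    obtain q where q: "q \<in> V" "Tmap A h0 (tvec A c p) = tvec A d q" using h0(2)[OF p] by blast
    have "fst (tvec A d q) \<in> chart_dom d" using q V tvec_in_dom[OF d] by blast
    then have "h0 (param c (fst p)) \<in> chart_dom d"
      unfolding q(2)[symmetric] by (simp add: Tmap_def tvec_def split_beta)
    then show r: "fst p \<in> rep_dom c d h0" using p C by (auto simp: rep_dom_def)
    have "tvec A d (tjet c d h0 p) = tvec A d q" using Tmap_tvec[OF h0C c d r] q by simp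
    moreover have "tjet c d h0 p \<in> chart_img d \<times> UNIV"
      using r by (auto simp: tjet_def rep_dom_def split_beta)
    ultimately have "tjet c d h0 p = q" using tcovec_tvec_self[OF d] q(1) V(2) by (metis subsetD)
    then show "tjet c d h0 p \<in> V" using q by simp
  qed
  have "compact (tjet c d h0 ` C)"
    using dom by (intro compact_continuous_image[OF continuous_on_subset[OF continuous_on_tjet[OF h0C c d]]] C)
       (auto simp: mem_Times_iff)
  then obtain e0 where e0: "e0 > 0" "(\<Union>x\<in>tjet c d h0 ` C. ball x e0) \<subseteq> V"
    using compact_subset_open_imp_ball_epsilon_subset[OF _ V(1)] dom(2) by blast
  have "bounded (snd ` C)" using C(1) by (intro compact_imp_bounded compact_continuous_image continuous_on_snd continuous_on_id)
  then obtain R where R: "R > 0" "\<And>p. p \<in> C \<Longrightarrow> norm (snd p) \<le> R" unfolding bounded_pos by blast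
  define K where "K = param c ` fst ` C"
  define e where "e = e0 / (1 + R)"
  have "e * (1 + R) = e0" using R by (simp add: e_def)
  then have e: "e > 0" "e + e * R = e0" using e0 R by (auto simp: e_def distrib_left)
  have K: "compact K" unfolding K_def
    using C by (intro compact_continuous_image continuous_on_fst continuous_on_id
        continuous_on_subset[OF continuous_param[OF c]]) auto
  have K2: "K \<subseteq> chart_dom c" "h0 ` K \<subseteq> chart_dom d"
    using C(2) dom(1) c by (force simp: K_def rep_dom_def)+
  have "h0 \<in> C1_nbhd A h0 c d K e"
    using h0 K2 e by (simp add: C1_nbhd_def onorm_zero)
  moreover have "C1_nbhd A h0 c d K e \<subseteq> {f \<in> Diff1 A. Tmap A f ` tvec A c ` C \<subseteq> tvec A d ` V}"
  proof
    fix h assume h: "h \<in> C1_nbhd A h0 c d K e"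
    then have hD: "h \<in> Diff1 A" by (simp add: C1_nbhd_def)
    note hC = Diff1_C1_map[OF hD]
    have "Tmap A h (tvec A c p) \<in> tvec A d ` V" if p: "p \<in> C" for p
    proof -
      define z u where "z = fst p" and "u = snd p"
      have pzu: "p = (z, u)" by (simp add: z_def u_def)
      have z: "z \<in> chart_img c" "param c z \<in> K" using p C by (auto simp: z_def K_def)
      have n: "norm (coord d (h (param c z)) - coord d (h0 (param c z))) < e"
        "onorm (\<lambda>u. jac c d h z u - jac c d h0 z u) < e" "h (param c z) \<in> chart_dom d"
        using h z(2) coord_param[OF c z(1)] by (auto simp: C1_nbhd_def jac_def)
      have r: "z \<in> rep_dom c d h" using z n by (simp add: rep_dom_def)
      have r0: "z \<in> rep_dom c d h0" using dom(1)[OF p] by (simp add: z_def)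
      have "linear (\<lambda>u. jac c d h z u - jac c d h0 z u)"
        by (intro linear_compose_sub linear_jac[OF hC c d r] linear_jac[OF h0C c d r0])
      then have "norm (jac c d h z u - jac c d h0 z u) \<le> onorm (\<lambda>u. jac c d h z u - jac c d h0 z u) * norm u"
        by (rule norm_le_onorm)
      also have "\<dots> \<le> e * R"
        using n(2) R(2)[OF p] e(1) by (intro mult_mono) (auto simp: u_def)
      finally have "norm (tjet c d h p - tjet c d h0 p) < e + e * R"
        using n(1) norm_Pair_le[of "coord d (h (param c z)) - coord d (h0 (param c z))" "jac c d h z u - jac c d h0 z u"]
        unfolding pzu by (simp add: tjet_def)
      then have "tjet c d h p \<in> ball (tjet c d h0 p) e0"
        unfolding e(2) by (simp add: dist_norm norm_minus_commute)
      then have "tjet c d h p \<in> V" using e0(2) p by blast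
      then show ?thesis
        using Tmap_tvec[OF hC c d, of p] r by (simp add: z_def)
    qed
    with hD show "h \<in> {f \<in> Diff1 A. Tmap A f ` tvec A c ` C \<subseteq> tvec A d ` V}" by auto
  qed
  ultimately show "\<exists>T. openin (C1_topology A) T \<and> h0 \<in> T \<and>
      T \<subseteq> {f \<in> Diff1 A. Tmap A f ` tvec A c ` C \<subseteq> tvec A d ` V}"
    using openin_C1_nbhd[OF h0(1) c d K K2 e(1)] by (intro exI[of _ "C1_nbhd A h0 c d K e"]) simp
qed

lemma openin_diffs_carrying:
  assumes "J \<subseteq> base_pairs bundle_base" "finite J"
  shows "openin (C1_topology A) (diffs_carrying J)"
proof -
  have one: "openin (C1_topology A) {f \<in> Diff1 A. Tmap A f ` K \<subseteq> W}" if KW: "(K, W) \<in> base_pairs bundle_base" for K W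
  proof -
    obtain B K' where "(B, K) \<in> bundle_base" "(W, K') \<in> bundle_base"
      using KW by (force simp: base_pairs_def)
    then obtain c p r d p' r' where cd: "c \<in> A" "K = tvec A c ` cball p r" "cball p r \<subseteq> chart_img c \<times> UNIV"
      "d \<in> A" "W = tvec A d ` ball p' r'" "cball p' r' \<subseteq> chart_img d \<times> UNIV"
      using bundle_base(2) unfolding chart_ball_def by metis
    have "ball p' r' \<subseteq> chart_img d \<times> UNIV" using cd(6) ball_subset_cball by blast
    from openin_C1_chart_carry[OF cd(1,4) compact_cball cd(3) open_ball this]
    show ?thesis by (simp add: cd)
  qed
  have eq: "diffs_carrying J = Diff1 A \<inter> (\<Inter>(K, W)\<in>J. {f \<in> Diff1 A. Tmap A f ` K \<subseteq> W})"
    unfolding diffs_carrying_def carries_def by blast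
  show ?thesis
  proof (cases "J = {}")
    case True
    then have "diffs_carrying J = Diff1 A" using eq by simp
    then show ?thesis using openin_topspace[of "C1_topology A"] by simp
  next
    case False
    have "openin (C1_topology A) (\<Inter>(K, W)\<in>J. {f \<in> Diff1 A. Tmap A f ` K \<subseteq> W})"
      using assms False one by (intro openin_INT2) auto
    then show ?thesis
      unfolding eq using openin_topspace[of "C1_topology A"] by (simp add: openin_Int)
  qed
qed

text \<open>
  Being \<open>e\<close>-close on \<open>K\<close> in value and derivative is an open condition on the graph of the tangent map
  over the compact set of vectors of coordinate length at most 1 above \<open>K\<close>: a bound on an
  operator norm is a bound on all such vectors.
\<close>

lemma C1_nbhd_contains_diffs_carrying:
  assumes f: "f \<in> Diff1 A" and c: "c \<in> A" and d: "d \<in> A" and K: "compact K" "K \<subseteq> chart_dom c"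
    and fK: "f ` K \<subseteq> chart_dom d" and e: "e > 0" and h0: "h0 \<in> C1_nbhd A f c d K e"
  shows "\<exists>J \<subseteq> base_pairs bundle_base. finite J \<and> h0 \<in> diffs_carrying J \<and> diffs_carrying J \<subseteq> C1_nbhd A f c d K e"
proof -
  note fC = Diff1_C1_map[OF f]
  define \<Omega>' where "\<Omega>' = {(p, q). fst p \<in> rep_dom c d f \<and> fst q \<in> chart_img d \<and>
     norm (fst q - fst (tjet c d f p)) < e \<and> norm (snd q - snd (tjet c d f p)) < e}"
  define \<Omega> where "\<Omega> = (\<lambda>(p, q). (tvec A c p, tvec A d q)) ` \<Omega>'"
  define C' where "C' = coord c ` K \<times> (cball 0 1 :: 'b set)"
  have C'img: "C' \<subseteq> chart_img c \<times> UNIV" using K by (auto simp: C'_def)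
  have "open \<Omega>'"
  proof -
    define S where "S = (rep_dom c d f \<times> (UNIV :: 'b set)) \<times> (chart_img d \<times> (UNIV :: 'b set))"
    have S: "open S" unfolding S_def
      by (intro open_Times open_rep_dom c d C1_map_continuous fC open_UNIV open_chart_img)
    have t: "continuous_on S (\<lambda>pq. tjet c d f (fst pq))"
      by (rule continuous_on_compose2[OF continuous_on_tjet[OF fC c d]])
         (auto simp: S_def intro!: continuous_intros)
    have "open (S \<inter> (\<lambda>pq. norm (fst (snd pq) - fst (tjet c d f (fst pq)))) -` {..<e})"
      "open (S \<inter> (\<lambda>pq. norm (snd (snd pq) - snd (tjet c d f (fst pq)))) -` {..<e})"
      by (intro continuous_open_preimage S open_lessThan continuous_intros t)+
    then have "open ((S \<inter> (\<lambda>pq. norm (fst (snd pq) - fst (tjet c d f (fst pq)))) -` {..<e}) \<inter>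
      (S \<inter> (\<lambda>pq. norm (snd (snd pq) - snd (tjet c d f (fst pq)))) -` {..<e}))"
      by (rule open_Int)
    moreover have "\<dots> = \<Omega>'" by (auto simp: S_def \<Omega>'_def)
    ultimately show ?thesis by simp
  qed
  have \<Omega>'img: "p \<in> chart_img c \<times> UNIV" "q \<in> chart_img d \<times> UNIV" if "(p, q) \<in> \<Omega>'" for p q
    using that by (auto simp: \<Omega>'_def rep_dom_def mem_Times_iff)
  have \<Omega>: "openin (prod_topology (tangent_bundle A) (tangent_bundle A)) \<Omega>"
    unfolding openin_prod_topology_alt
  proof (intro allI impI)
    fix x y assume "(x, y) \<in> \<Omega>"
    then obtain p q where pq: "(p, q) \<in> \<Omega>'" "x = tvec A c p" "y = tvec A d q" by (auto simp: \<Omega>_def)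
    obtain U V where UV: "open U" "open V" "p \<in> U" "q \<in> V" "U \<times> V \<subseteq> \<Omega>'"
      using open_prod_elim[OF \<open>open \<Omega>'\<close> pq(1)] by (metis mem_Sigma_iff)
    have "U \<subseteq> chart_img c \<times> UNIV" "V \<subseteq> chart_img d \<times> UNIV"
      using UV \<Omega>'img by blast+
    then have "openin (tangent_bundle A) (tvec A c ` U)" "openin (tangent_bundle A) (tvec A d ` V)"
      using openin_tvec_image c d UV by auto
    moreover have "tvec A c ` U \<times> tvec A d ` V \<subseteq> \<Omega>" using UV(5) unfolding \<Omega>_def by force
    ultimately show "\<exists>U V. openin (tangent_bundle A) U \<and> openin (tangent_bundle A) V \<and>
        x \<in> U \<and> y \<in> V \<and> U \<times> V \<subseteq> \<Omega>"
      using pq UV by blast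
  qed
  have C: "compactin (tangent_bundle A) (tvec A c ` C')"
  proof (rule compactin_tvec_image[OF c _ C'img])
    show "compact C'" unfolding C'_def
      by (intro compact_Times compact_continuous_image continuous_on_subset[OF continuous_coord[OF c]] K compact_cball)
  qed
  have iff: "(\<forall>q\<in>tvec A c ` C'. (q, Tmap A h q) \<in> \<Omega>) \<longleftrightarrow> h \<in> C1_nbhd A f c d K e" if h: "h \<in> Diff1 A" for h
  proof -
    note hC = Diff1_C1_map[OF h]
    have rf: "coord c x \<in> rep_dom c d f" if "x \<in> K" for x
    proof -
      have "x \<in> chart_dom c" "f x \<in> chart_dom d" using that K fK by blast+
      then show ?thesis using c by (simp add: rep_dom_def)
    qed
    show ?thesis
    proof
      assume L: "\<forall>q\<in>tvec A c ` C'. (q, Tmap A h q) \<in> \<Omega>"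
      have *: "coord c x \<in> rep_dom c d h \<and> norm (coord d (h x) - coord d (f x)) < e \<and>
         norm (jac c d h (coord c x) u - jac c d f (coord c x) u) < e" if x: "x \<in> K" and u: "norm u \<le> 1" for x u
      proof -
        define p where "p = (coord c x, u)"
        have p: "p \<in> C'" using x u by (simp add: p_def C'_def)
        then have p2: "p \<in> chart_img c \<times> UNIV" using C'img by blast
        have "(tvec A c p, Tmap A h (tvec A c p)) \<in> \<Omega>" using L p by blast
        then obtain p' q where pq: "(p', q) \<in> \<Omega>'" "tvec A c p = tvec A c p'" "Tmap A h (tvec A c p) = tvec A d q"
          unfolding \<Omega>_def by auto
        have "p' = p" using pq(2) tcovec_tvec_self[OF c] p2 \<Omega>'img(1)[OF pq(1)] by metis
        have "fst (tvec A d q) \<in> chart_dom d" using tvec_in_dom[OF d \<Omega>'img(2)[OF pq(1)]] .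
        then have hx: "h (param c (coord c x)) \<in> chart_dom d"
          unfolding pq(3)[symmetric] by (simp add: Tmap_def tvec_def split_beta p_def)
        have r: "coord c x \<in> rep_dom c d h" using hx x K by (auto simp: rep_dom_def)
        have "tvec A d (tjet c d h p) = tvec A d q"
          using Tmap_tvec[OF hC c d, of p] r pq(3) by (simp add: p_def)
        moreover have "tjet c d h p \<in> chart_img d \<times> UNIV" using hx by (auto simp: tjet_def p_def)
        ultimately have "tjet c d h p = q" using tcovec_tvec_self[OF d] \<Omega>'img(2)[OF pq(1)] by metis
        then show ?thesis using pq(1) r x K c unfolding \<open>p' = p\<close>
          by (auto simp: \<Omega>'_def tjet_def p_def)
      qed
      have **: "onorm (\<lambda>u. jac c d h (coord c x) u - jac c d f (coord c x) u) < e" if x: "x \<in> K" for x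
      proof (rule onorm_less_of_unit_ball)
        show "linear (\<lambda>u. jac c d h (coord c x) u - jac c d f (coord c x) u)"
          using *[OF x, of 0] rf[OF x] by (intro linear_compose_sub linear_jac hC fC c d) auto
      qed (use * x in auto)
      have "h x \<in> chart_dom d" if "x \<in> K" for x
      proof -
        have "x \<in> chart_dom c" "h (param c (coord c x)) \<in> chart_dom d"
          using *[OF that, of 0] that K by (auto simp: rep_dom_def)
        then show ?thesis using c by simp
      qed
      then show "h \<in> C1_nbhd A f c d K e"
        using ** *[of _ 0] h by (auto simp: C1_nbhd_def jac_def)
    next
      assume R: "h \<in> C1_nbhd A f c d K e"
      show "\<forall>q\<in>tvec A c ` C'. (q, Tmap A h q) \<in> \<Omega>"
      proof
        fix q assume "q \<in> tvec A c ` C'"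
        then obtain x u where xu: "q = tvec A c (coord c x, u)" "x \<in> K" "norm u \<le> 1" by (auto simp: C'_def)
        define p where "p = (coord c x, u)"
        have n: "norm (coord d (h x) - coord d (f x)) < e" "h x \<in> chart_dom d"
           "onorm (\<lambda>u. jac c d h (coord c x) u - jac c d f (coord c x) u) < e"
          using R xu(2) by (auto simp: C1_nbhd_def jac_def)
        have r: "coord c x \<in> rep_dom c d h" using n xu(2) K c by (auto simp: rep_dom_def)
        have lin: "linear (\<lambda>u. jac c d h (coord c x) u - jac c d f (coord c x) u)"
          by (intro linear_compose_sub linear_jac hC fC c d r rf xu)
        then have "norm (jac c d h (coord c x) u - jac c d f (coord c x) u) \<le>
            onorm (\<lambda>u. jac c d h (coord c x) u - jac c d f (coord c x) u) * norm u"
          by (rule norm_le_onorm)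
        also have "\<dots> \<le> onorm (\<lambda>u. jac c d h (coord c x) u - jac c d f (coord c x) u) * 1"
          using lin by (intro mult_left_mono xu onorm_pos_le) (simp add: linear_conv_bounded_linear)
        finally have n2: "norm (jac c d h (coord c x) u - jac c d f (coord c x) u) < e" using n(3) by simp
        have "(p, tjet c d h p) \<in> \<Omega>'"
          using rf[OF xu(2)] n n2 xu(2) K c by (auto simp: \<Omega>'_def tjet_def p_def)
        moreover have "Tmap A h q = tvec A d (tjet c d h p)"
          using Tmap_tvec[OF hC c d, of p] r by (simp add: xu p_def)
        ultimately show "(q, Tmap A h q) \<in> \<Omega>"
          unfolding \<Omega>_def by (force simp: xu p_def)
      qed
    qed
  qed
  have h0D: "h0 \<in> Diff1 A" using h0 by (simp add: C1_nbhd_def)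
  have "\<forall>q\<in>tvec A c ` C'. (q, Tmap A h0 q) \<in> \<Omega>" using iff[OF h0D] h0 by simp
  then obtain J where J: "J \<subseteq> base_pairs bundle_base" "finite J" "carries (Tmap A h0) J"
     "\<And>k. carries k J \<longrightarrow> (\<forall>q\<in>tvec A c ` C'. (q, k q) \<in> \<Omega>)"
    using compact_open_graph_nbhd[OF bundle_base(1) C \<Omega> continuous_map_Tmap[OF Diff1_C1_map[OF h0D]]]
    by metis
  have "diffs_carrying J \<subseteq> C1_nbhd A f c d K e"
  proof
    fix h assume h: "h \<in> diffs_carrying J"
    then have "\<forall>q\<in>tvec A c ` C'. (q, Tmap A h q) \<in> \<Omega>" using J(4) by (auto simp: diffs_carrying_def)
    then show "h \<in> C1_nbhd A f c d K e" using iff h by (simp add: diffs_carrying_def)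
  qed
  moreover have "h0 \<in> diffs_carrying J" using h0D J by (simp add: diffs_carrying_def)
  ultimately show ?thesis using J(1,2) by (intro exI[of _ J]) simp
qed

lemma diffs_carrying_Un: "diffs_carrying (J \<union> J') = diffs_carrying J \<inter> diffs_carrying J'"
  unfolding diffs_carrying_def carries_def by blast

text \<open>
  There are only countably many finite sets \<open>J\<close> of base pairs, so this is second countability of the
  \<open>C^1\<close> topology.
\<close>

lemma C1_open_contains_diffs_carrying:
  assumes "openin (C1_topology A) U" "h \<in> U"
  shows "\<exists>J \<subseteq> base_pairs bundle_base. finite J \<and> h \<in> diffs_carrying J \<and> diffs_carrying J \<subseteq> U"
  using assms(1)[unfolded C1_topology_def openin_topology_generated_by_iff] assms(2)
proof (induction arbitrary: h rule: generate_topology_on.induct)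
  case Empty
  then show ?case by simp
next
  case (Int a b)
  have "h \<in> a" "h \<in> b" using Int.prems by auto
  from Int.IH(1)[OF this(1)] Int.IH(2)[OF this(2)]
  obtain J J' where "J \<subseteq> base_pairs bundle_base" "finite J" "h \<in> diffs_carrying J" "diffs_carrying J \<subseteq> a"
    "J' \<subseteq> base_pairs bundle_base" "finite J'" "h \<in> diffs_carrying J'" "diffs_carrying J' \<subseteq> b"
    by (elim exE conjE)
  then show ?case
    by (intro exI[of _ "J \<union> J'"]) (auto simp: diffs_carrying_Un)
next
  case (UN K)
  then obtain k where k: "k \<in> K" "h \<in> k" by blast
  with UN.IH obtain J where "J \<subseteq> base_pairs bundle_base" "finite J" "h \<in> diffs_carrying J" "diffs_carrying J \<subseteq> k"
    by meson
  then show ?case using k by (intro exI[of _ J]) auto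
next
  case (Basis s)
  then show ?case using C1_nbhd_contains_diffs_carrying by auto
qed

lemma openin_C1_carry:
  assumes "compactin (tangent_bundle A) C" "openin (tangent_bundle A) U"
  shows "openin (C1_topology A) {f \<in> Diff1 A. Tmap A f ` C \<subseteq> U}"
proof (subst openin_subopen, intro ballI)
  fix h assume h: "h \<in> {f \<in> Diff1 A. Tmap A f ` C \<subseteq> U}"
  have "openin (prod_topology (tangent_bundle A) (tangent_bundle A)) (UNIV \<times> U)"
    using assms(2) openin_topspace[of "tangent_bundle A"] by (simp add: openin_prod_Times_iff)
  moreover have "C1_map A h" "\<And>q. q \<in> C \<Longrightarrow> (q, Tmap A h q) \<in> UNIV \<times> U"
    using h by (auto simp only: Diff1_C1_map)
  ultimately obtain J where J: "J \<subseteq> base_pairs bundle_base" "finite J" "carries (Tmap A h) J"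
     "\<And>k. carries k J \<longrightarrow> (\<forall>q\<in>C. (q, k q) \<in> UNIV \<times> U)"
    using compact_open_graph_nbhd[OF bundle_base(1) assms(1) _ continuous_map_Tmap[of h]] by metis
  then show "\<exists>T. openin (C1_topology A) T \<and> h \<in> T \<and> T \<subseteq> {f \<in> Diff1 A. Tmap A f ` C \<subseteq> U}"
    using openin_diffs_carrying[OF J(1,2)] h J(3,4)
    by (intro exI[of _ "diffs_carrying J"]) (auto simp: diffs_carrying_def)
qed

lemma opens_subset_Pow: "{U. openin (C1_topology A) U} \<subseteq> Pow (Diff1 A)"
  using openin_subset[of "C1_topology A"] by auto

lemma space_diff1_borel [simp]: "space (diff1_borel A) = Diff1 A"
  unfolding diff1_borel_def by (rule space_measure_of[OF opens_subset_Pow])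

lemma open_in_sets: "openin (C1_topology A) U \<Longrightarrow> U \<in> sets (diff1_borel A)"
  using opens_subset_Pow unfolding diff1_borel_def by (simp add: sets_measure_of sigma_sets.Basic)

lemma closed_in_sets:
  assumes "closedin (C1_topology A) U" shows "U \<in> sets (diff1_borel A)"
proof -
  have "Diff1 A - (Diff1 A - U) \<in> sets (diff1_borel A)"
    using assms open_in_sets sets.compl_sets[of "Diff1 A - U" "diff1_borel A"] by (simp add: closedin_def)
  moreover have "Diff1 A - (Diff1 A - U) = U" using closedin_subset[OF assms] by auto
  ultimately show ?thesis by simp
qed

lemma countable_finite_pairs: "countable {J. J \<subseteq> base_pairs bundle_base \<and> finite J}"
proof -
  have "countable (base_pairs bundle_base)"
    using bundle_base(1) unfolding compact_base_def base_pairs_def by (intro countable_SIGMA) auto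
  from countable_Collect_finite_subset[OF this] show ?thesis by (simp add: conj_commute)
qed

lemma comp_diffs_carrying_nbhd:
  assumes f: "f \<in> Diff1 A" and h: "h \<in> Diff1 A" and J: "J \<subseteq> base_pairs bundle_base" "finite J"
    and fh: "f \<circ> h \<in> diffs_carrying J"
  obtains J1 J2 where "J1 \<subseteq> base_pairs bundle_base" "finite J1" "J2 \<subseteq> base_pairs bundle_base" "finite J2"
    "f \<in> diffs_carrying J1" "h \<in> diffs_carrying J2" "\<And>f' h'. f' \<in> diffs_carrying J1 \<Longrightarrow> h' \<in> diffs_carrying J2 \<Longrightarrow> f' \<circ> h' \<in> diffs_carrying J"
proof -
  note fC = Diff1_C1_map[OF f] and hC = Diff1_C1_map[OF h]
  have "\<exists>J1 J2. J1 \<subseteq> base_pairs bundle_base \<and> J2 \<subseteq> base_pairs bundle_base \<and> finite J1 \<and> finite J2 \<and>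
      carries (Tmap A f) J1 \<and> carries (Tmap A h) J2 \<and>
      (\<forall>f' h'. carries f' J1 \<longrightarrow> carries h' J2 \<longrightarrow> f' ` h' ` fst j \<subseteq> snd j)" if j: "j \<in> J" for j
  proof -
    obtain K W where KW: "j = (K, W)" by force
    then obtain B K' where BK: "(B, K) \<in> bundle_base" "(W, K') \<in> bundle_base"
      using J j by (force simp: base_pairs_def)
    have "Tmap A f ` Tmap A h ` K \<subseteq> W"
      using fh j KW Tmap_comp[OF fC hC] by (fastforce simp: diffs_carrying_def carries_def)
    from compact_open_comp_nbhd[OF bundle_base(1) compact_base_basic(2)[OF bundle_base(1) BK(1)]
        compact_base_basic(1)[OF bundle_base(1) BK(2)] continuous_map_Tmap[OF hC] continuous_map_Tmap[OF fC] this]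
    obtain J1 J2 where "J1 \<subseteq> base_pairs bundle_base" "J2 \<subseteq> base_pairs bundle_base" "finite J1" "finite J2"
       "carries (Tmap A f) J1" "carries (Tmap A h) J2"
       "\<forall>f' h'. carries f' J1 \<longrightarrow> carries h' J2 \<longrightarrow> f' ` h' ` K \<subseteq> W" by auto
    then show ?thesis unfolding KW by (intro exI[of _ J1] exI[of _ J2]) simp
  qed
  then obtain J1 J2 where J12: "\<And>j. j \<in> J \<Longrightarrow> J1 j \<subseteq> base_pairs bundle_base \<and> J2 j \<subseteq> base_pairs bundle_base \<and>
      finite (J1 j) \<and> finite (J2 j) \<and> carries (Tmap A f) (J1 j) \<and> carries (Tmap A h) (J2 j) \<and>
      (\<forall>f' h'. carries f' (J1 j) \<longrightarrow> carries h' (J2 j) \<longrightarrow> f' ` h' ` fst j \<subseteq> snd j)"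
    by metis
  show thesis
  proof (rule that[of "\<Union>j\<in>J. J1 j" "\<Union>j\<in>J. J2 j"])
    fix f' h' assume f': "f' \<in> diffs_carrying (\<Union>j\<in>J. J1 j)" and h': "h' \<in> diffs_carrying (\<Union>j\<in>J. J2 j)"
    then have D: "f' \<in> Diff1 A" "h' \<in> Diff1 A" by (auto simp: diffs_carrying_def)
    have "Tmap A f' ` Tmap A h' ` fst j \<subseteq> snd j" if "j \<in> J" for j
      using J12[OF that] f' h' that unfolding diffs_carrying_def carries_UN by blast
    then have "carries (Tmap A (f' \<circ> h')) J"
      unfolding carries_def using Tmap_comp[OF Diff1_C1_map[OF D(1)] Diff1_C1_map[OF D(2)]]
      by (fastforce simp: image_image)
    then show "f' \<circ> h' \<in> diffs_carrying J"
      using comp_in_Diff1[OF D] by (simp add: diffs_carrying_def)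
  next
    show "f \<in> diffs_carrying (\<Union>j\<in>J. J1 j)" "h \<in> diffs_carrying (\<Union>j\<in>J. J2 j)"
      using J12 f h unfolding diffs_carrying_def carries_UN by blast+
  qed (use J12 J(2) in blast)+
qed

text \<open>
  By continuity of composition the preimage of an open set is a union of rectangles of basic open
  sets. Second countability makes the union countable, so the preimage belongs to the product
  sigma-algebra and not only to the Borel sets of the product.
\<close>

lemma comp_measurable [measurable]:
  "(\<lambda>(f, h). f \<circ> h) \<in> diff1_borel A \<Otimes>\<^sub>M diff1_borel A \<rightarrow>\<^sub>M diff1_borel A"
proof -
  let ?N = "diff1_borel A"
  have "(\<lambda>(f, h). f \<circ> h) \<in> ?N \<Otimes>\<^sub>M ?N \<rightarrow>\<^sub>M sigma (Diff1 A) {U. openin (C1_topology A) U}"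
  proof (rule measurable_measure_of[OF opens_subset_Pow])
    show "(\<lambda>(f, h). f \<circ> h) \<in> space (?N \<Otimes>\<^sub>M ?N) \<rightarrow> Diff1 A"
      by (auto simp: space_pair_measure comp_in_Diff1)
  next
    fix U assume "U \<in> {U. openin (C1_topology A) U}"
    then have U: "openin (C1_topology A) U" by simp
    define Js where "Js = {J. J \<subseteq> base_pairs bundle_base \<and> finite J}"
    define S where "S = {(J1, J2) \<in> Js \<times> Js. \<forall>f\<in>diffs_carrying J1. \<forall>h\<in>diffs_carrying J2. f \<circ> h \<in> U}"
    have "countable S"
      using countable_SIGMA[OF countable_finite_pairs countable_finite_pairs]
      by (rule countable_subset[rotated]) (auto simp: S_def Js_def)
    have "(\<lambda>(f, h). f \<circ> h) -` U \<inter> space (?N \<Otimes>\<^sub>M ?N) = (\<Union>(J1, J2)\<in>S. diffs_carrying J1 \<times> diffs_carrying J2)"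
    proof (intro equalityI subsetI)
      fix fh assume "fh \<in> (\<lambda>(f, h). f \<circ> h) -` U \<inter> space (?N \<Otimes>\<^sub>M ?N)"
      then obtain f h where fh: "fh = (f, h)" "f \<in> Diff1 A" "h \<in> Diff1 A" "f \<circ> h \<in> U"
        by (auto simp: space_pair_measure)
      obtain J where J: "J \<subseteq> base_pairs bundle_base" "finite J" "f \<circ> h \<in> diffs_carrying J" "diffs_carrying J \<subseteq> U"
        using C1_open_contains_diffs_carrying[OF U fh(4)] by blast
      obtain J1 J2 where J12: "J1 \<subseteq> base_pairs bundle_base" "finite J1" "J2 \<subseteq> base_pairs bundle_base" "finite J2"
        "f \<in> diffs_carrying J1" "h \<in> diffs_carrying J2" "\<And>f' h'. f' \<in> diffs_carrying J1 \<Longrightarrow> h' \<in> diffs_carrying J2 \<Longrightarrow> f' \<circ> h' \<in> diffs_carrying J"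
        using comp_diffs_carrying_nbhd[OF fh(2,3) J(1-3)] by metis
      have "(J1, J2) \<in> S" using J12 J(4) unfolding S_def Js_def by blast
      then show "fh \<in> (\<Union>(J1, J2)\<in>S. diffs_carrying J1 \<times> diffs_carrying J2)"
        using J12 fh(1) by blast
    qed (auto simp: S_def space_pair_measure diffs_carrying_def)
    moreover have "(\<Union>(J1, J2)\<in>S. diffs_carrying J1 \<times> diffs_carrying J2) \<in> sets (?N \<Otimes>\<^sub>M ?N)"
      using openin_diffs_carrying open_in_sets
      by (intro sets.countable_UN' \<open>countable S\<close>) (auto simp: S_def Js_def)
    ultimately show "(\<lambda>(f, h). f \<circ> h) -` U \<inter> space (?N \<Otimes>\<^sub>M ?N) \<in> sets (?N \<Otimes>\<^sub>M ?N)" by simp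
  qed
  then show ?thesis by (simp add: diff1_borel_def)
qed

text \<open>
  The complement of the support is covered by the null sets among countably many basic open sets.
\<close>

lemma AE_measure_support:
  assumes "sets \<nu> = sets (diff1_borel A)"
  shows "AE f in \<nu>. f \<in> measure_support (C1_topology A) \<nu>"
proof -
  define S where "S = {J. (J \<subseteq> base_pairs bundle_base \<and> finite J) \<and> emeasure \<nu> (diffs_carrying J) = 0}"
  have "countable S"
    using countable_finite_pairs by (rule countable_subset[rotated]) (auto simp: S_def)
  have "(\<Union>J\<in>S. diffs_carrying J) \<in> null_sets \<nu>"
    using openin_diffs_carrying open_in_sets assms
    by (intro null_sets_UN' \<open>countable S\<close>) (auto simp: S_def null_sets_def)
  moreover have "{f \<in> space \<nu>. f \<notin> measure_support (C1_topology A) \<nu>} \<subseteq> (\<Union>J\<in>S. diffs_carrying J)"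
  proof
    fix f assume f: "f \<in> {f \<in> space \<nu>. f \<notin> measure_support (C1_topology A) \<nu>}"
    have "space \<nu> = Diff1 A" using sets_eq_imp_space_eq[OF assms] by simp
    then obtain U where U: "openin (C1_topology A) U" "f \<in> U" "emeasure \<nu> U = 0"
      using f by (auto simp: measure_support_def zero_less_iff_neq_zero)
    obtain J where J: "J \<subseteq> base_pairs bundle_base" "finite J" "f \<in> diffs_carrying J" "diffs_carrying J \<subseteq> U"
      using C1_open_contains_diffs_carrying[OF U(1,2)] by blast
    have "emeasure \<nu> (diffs_carrying J) \<le> emeasure \<nu> U"
      using J(4) U(1) open_in_sets assms by (intro emeasure_mono) auto
    then show "f \<in> (\<Union>J\<in>S. diffs_carrying J)" using J U by (auto simp: S_def)
  qed
  ultimately show ?thesis by (rule AE_I')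
qed

end

section \<open>Riemannian norms and the distortion of diffeomorphisms\<close>

lemma has_real_derivative_pos_part_power2:
  "((\<lambda>s::real. (max 0 s)\<^sup>2) has_real_derivative 2 * max 0 s) (at s)"
proof (cases s "0::real" rule: linorder_cases)
  case less
  have "((\<lambda>s::real. 0) has_real_derivative 2 * max 0 s) (at s)" using less by simp
  then show ?thesis
    by (rule has_field_derivative_transform_within_open[of _ _ _ "{..<0}"]) (use less in auto)
next
  case greater
  have "((\<lambda>s::real. s\<^sup>2) has_real_derivative 2 * max 0 s) (at s)"
    using greater by (auto intro!: derivative_eq_intros)
  then show ?thesis
    by (rule has_field_derivative_transform_within_open[of _ _ _ "{0<..}"]) (use greater in auto)
next
  case equal
  have "((\<lambda>h. (max 0 h)\<^sup>2 / h) \<longlongrightarrow> 0) (at (0::real))"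
  proof (rule tendsto_norm_zero_cancel, rule tendsto_sandwich[of "\<lambda>_. 0" _ _ "\<lambda>h. \<bar>h\<bar>"])
    show "\<forall>\<^sub>F h in at 0. norm ((max 0 h)\<^sup>2 / h) \<le> \<bar>h :: real\<bar>"
      by (intro always_eventually allI) (auto simp: max_def power2_eq_square divide_simps)
    show "((\<lambda>h::real. \<bar>h\<bar>) \<longlongrightarrow> 0) (at 0)" by (rule tendsto_rabs_zero) (rule tendsto_ident_at)
  qed auto
  then show ?thesis using equal by (simp add: has_field_derivative_iff)
qed

locale riemannian_atlas = compact_atlas A for A :: "('m::t2_space, 'b::euclidean_space) chart set" +
  fixes g :: "'m \<Rightarrow> 'b \<Rightarrow> 'b \<Rightarrow> real"
  assumes riemannian_metric: "riemannian_metric A g"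
begin

definition tangent_norm :: "'m \<times> 'b \<Rightarrow> real" where
  "tangent_norm q = tnorm g (fst q) (snd q)"

definition nonzero_tangents :: "('m \<times> 'b) set" where
  "nonzero_tangents = {q. snd q \<noteq> 0}"

definition log_norm :: "'m \<times> 'b \<Rightarrow> real" where
  "log_norm q = ln (tangent_norm q)"

lemma bilinear_metric: "bilinear (g x)"
  and metric_pos: "u \<noteq> 0 \<Longrightarrow> g x u u > 0"
  using riemannian_metric by (auto simp: riemannian_metric_def)

lemma tangent_norm_nonneg: "tangent_norm q \<ge> 0"
proof -
  have "g (fst q) (snd q) (snd q) \<ge> 0"
    using metric_pos[of "snd q" "fst q"] bilinear_lzero[OF bilinear_metric]
    by (cases "snd q = 0") auto
  then show ?thesis by (simp add: tangent_norm_def tnorm_def)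
qed

lemma tangent_norm_pos: "tangent_norm q > 0 \<longleftrightarrow> snd q \<noteq> 0"
  using metric_pos[of "snd q" "fst q"] bilinear_lzero[OF bilinear_metric, of "fst q" 0]
  by (cases "snd q = 0") (auto simp: tangent_norm_def tnorm_def)

lemma tangent_norm_scale: "tangent_norm (x, a *\<^sub>R v) = \<bar>a\<bar> * tangent_norm (x, v)"
proof -
  have "g x (a *\<^sub>R v) (a *\<^sub>R v) = a\<^sup>2 * g x v v"
    using bilinear_lmul[OF bilinear_metric] bilinear_rmul[OF bilinear_metric]
    by (simp add: power2_eq_square)
  then show ?thesis by (simp add: tangent_norm_def tnorm_def real_sqrt_mult)
qed

text \<open>
  Smoothness of the metric is given for fixed coordinate vectors only; expanding both arguments in
  the basis makes the norm jointly continuous.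
\<close>

lemma continuous_on_tangent_norm_tvec:
  assumes c: "c \<in> A"
  shows "continuous_on (chart_img c \<times> UNIV) (\<lambda>p. tangent_norm (tvec A c p))"
proof -
  define G where "G = (\<lambda>z u w. g (param c z) (from_chart A c (param c z) u) (from_chart A c (param c z) w))"
  have cont: "continuous_on (chart_img c) (\<lambda>z. G z u w)" for u w
  proof -
    have "smooth_on (\<lambda>z. G z u w) (chart_img c)"
      using riemannian_metric c by (auto simp: riemannian_metric_def G_def)
    then have "Ck_on 0 (\<lambda>z. G z u w) (chart_img c)" unfolding smooth_on_def by blast
    then show ?thesis by simp
  qed
  have fc: "from_chart A c (param c z) = jac c (chart_at A (param c z)) id z" if "z \<in> chart_img c" for z
    using coord_param[OF c that] by (simp add: from_chart_def jac_def)
  have bil: "bilinear (G z)" if z: "z \<in> chart_img c" for z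
  proof -
    have "z \<in> rep_dom c (chart_at A (param c z)) id" using z chart_at by (auto simp: rep_dom_def)
    then have l: "linear (from_chart A c (param c z))"
      using linear_jac[OF C1_map_id c chart_at(1)] fc[OF z] by simp
    note b = bilinear_metric[of "param c z", unfolded bilinear_def]
    show ?thesis
      unfolding bilinear_def G_def
    proof (intro conjI allI)
      fix u show "linear (\<lambda>w. g (param c z) (from_chart A c (param c z) u) (from_chart A c (param c z) w))"
        using linear_compose[OF l, of "g (param c z) (from_chart A c (param c z) u)"] b by (simp add: o_def)
    next
      fix w show "linear (\<lambda>u. g (param c z) (from_chart A c (param c z) u) (from_chart A c (param c z) w))"
        using linear_compose[OF l, of "\<lambda>v. g (param c z) v (from_chart A c (param c z) w)"] b by (simp add: o_def)
    qed
  qed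
  have expand: "G z u u = (\<Sum>i\<in>Basis. \<Sum>j\<in>Basis. (u \<bullet> i) * (u \<bullet> j) * G z i j)" if z: "z \<in> chart_img c" for z u
  proof -
    have "G z u u = G z (\<Sum>i\<in>Basis. (u \<bullet> i) *\<^sub>R i) (\<Sum>j\<in>Basis. (u \<bullet> j) *\<^sub>R j)"
      by (simp add: euclidean_representation)
    also have "\<dots> = (\<Sum>(i, j)\<in>Basis \<times> Basis. G z ((u \<bullet> i) *\<^sub>R i) ((u \<bullet> j) *\<^sub>R j))"
      by (rule bilinear_sum[OF bil[OF z]])
    also have "\<dots> = (\<Sum>(i, j)\<in>Basis \<times> Basis. (u \<bullet> i) * (u \<bullet> j) * G z i j)"
      using bilinear_lmul[OF bil[OF z]] bilinear_rmul[OF bil[OF z]] by (intro sum.cong) auto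
    finally show ?thesis by (simp add: sum.cartesian_product)
  qed
  have 1: "continuous_on (chart_img c \<times> UNIV) (\<lambda>p::'b\<times>'b. G (fst p) u w)" for u w
    by (rule continuous_on_compose2[OF cont[of u w]]) (auto intro!: continuous_intros)
  have "continuous_on (chart_img c \<times> UNIV)
      (\<lambda>p::'b\<times>'b. sqrt (\<Sum>i\<in>Basis. \<Sum>j\<in>Basis. (snd p \<bullet> i) * (snd p \<bullet> j) * G (fst p) i j))"
    by (intro continuous_intros 1)
  then show ?thesis
  proof (rule continuous_on_eq)
    fix p :: "'b \<times> 'b" assume "p \<in> chart_img c \<times> UNIV"
    then have z: "fst p \<in> chart_img c" by auto
    show "sqrt (\<Sum>i\<in>Basis. \<Sum>j\<in>Basis. (snd p \<bullet> i) * (snd p \<bullet> j) * G (fst p) i j) =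
        tangent_norm (tvec A c p)"
      unfolding expand[OF z, symmetric]
      by (simp add: tangent_norm_def tnorm_def tvec_def G_def fc[OF z] split_beta)
  qed
qed

lemma continuous_map_tangent_norm: "continuous_map (tangent_bundle A) euclideanreal tangent_norm"
proof -
  have "openin (tangent_bundle A) {q. tangent_norm q \<in> U}" if "open U" for U
    unfolding openin_tangent_bundle
  proof
    fix c assume c: "c \<in> A"
    have "open ((chart_img c \<times> UNIV) \<inter> (\<lambda>p. tangent_norm (tvec A c p)) -` U)"
      by (intro continuous_open_preimage continuous_on_tangent_norm_tvec c open_Times open_chart_img open_UNIV that)
    moreover have "(chart_img c \<times> UNIV) \<inter> (\<lambda>p. tangent_norm (tvec A c p)) -` U =
        {p \<in> chart_img c \<times> UNIV. tvec A c p \<in> {q. tangent_norm q \<in> U}}" by auto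
    ultimately show "open {p \<in> chart_img c \<times> UNIV. tvec A c p \<in> {q. tangent_norm q \<in> U}}" by simp
  qed
  then show ?thesis by (simp add: continuous_map_def)
qed

lemma openin_tangent_norm_vimage: "open U \<Longrightarrow> openin (tangent_bundle A) {q. tangent_norm q \<in> U}"
  using openin_continuous_map_preimage[OF continuous_map_tangent_norm, of U] by simp

lemma finite_ball_cover:
  obtains I where "finite I" "\<forall>(c, z, r)\<in>I. c \<in> A \<and> cball z r \<subseteq> chart_img c"
    "\<forall>x. \<exists>(c, z, r)\<in>I. x \<in> param c ` cball z r"
proof -
  define z where "z x = coord (chart_at A x) x" for x
  have "\<exists>r. r > 0 \<and> cball (z x) r \<subseteq> chart_img (chart_at A x)" for x
  proof -
    have "z x \<in> chart_img (chart_at A x)" using chart_at(2)[of x] by (simp add: z_def)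
    then show ?thesis using open_chart_img[OF chart_at(1)[of x]] open_contains_cball by blast
  qed
  then obtain r where zr: "\<And>x. r x > 0" "\<And>x. cball (z x) (r x) \<subseteq> chart_img (chart_at A x)"
    by metis
  define B where "B x = param (chart_at A x) ` ball (z x) (r x)" for x
  have "open (B x)" for x
  proof -
    define c where "c = chart_at A x"
    have c: "c \<in> A" using chart_at by (simp add: c_def)
    have sub: "ball (z x) (r x) \<subseteq> chart_img c" using zr(2) ball_subset_cball c_def by blast
    have "B x = chart_dom c \<inter> coord c -` ball (z x) (r x)"
      unfolding B_def c_def[symmetric]
    proof (intro equalityI subsetI)
      fix y assume "y \<in> param c ` ball (z x) (r x)"
      then show "y \<in> chart_dom c \<inter> coord c -` ball (z x) (r x)"
        using sub c by (smt (verit, best) IntI coord_param imageE param_in_dom subsetD vimageI)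
    next
      fix y assume "y \<in> chart_dom c \<inter> coord c -` ball (z x) (r x)"
      then have "param c (coord c y) = y" "coord c y \<in> ball (z x) (r x)" using c by auto
      then show "y \<in> param c ` ball (z x) (r x)" by (metis imageI)
    qed
    then show ?thesis
      using continuous_open_preimage[OF continuous_coord[OF c] open_chart_dom[OF c] open_ball] by simp
  qed
  moreover have "x \<in> B x" for x
  proof -
    have "param (chart_at A x) (z x) = x" using chart_at by (simp add: z_def)
    moreover have "z x \<in> ball (z x) (r x)" using zr(1) by simp
    ultimately show ?thesis unfolding B_def by (metis imageI)
  qed
  ultimately obtain X where X: "finite X" "UNIV \<subseteq> (\<Union>x\<in>X. B x)"
    using compactE_image[OF compact_UNIV, of UNIV B] by (metis UNIV_I UN_iff subsetI)
  show thesis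
  proof (rule that[of "(\<lambda>x. (chart_at A x, z x, r x)) ` X"])
    show "\<forall>y. \<exists>(c, z, r)\<in>(\<lambda>x. (chart_at A x, z x, r x)) ` X. y \<in> param c ` cball z r"
    proof
      fix y
      obtain x where "x \<in> X" "y \<in> B x" using X(2) by blast
      have "y \<in> param (chart_at A x) ` cball (z x) (r x)"
        using \<open>y \<in> B x\<close> unfolding B_def by (rule subsetD[OF image_mono[OF ball_subset_cball]])
      then show "\<exists>(c, z, r)\<in>(\<lambda>x. (chart_at A x, z x, r x)) ` X. y \<in> param c ` cball z r"
        using \<open>x \<in> X\<close> by auto
    qed
    show "\<forall>(c, z, r)\<in>(\<lambda>x. (chart_at A x, z x, r x)) ` X. c \<in> A \<and> cball z r \<subseteq> chart_img c"
      using zr(2) chart_at(1) by auto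
  qed (use X in auto)
qed

lemma tvec_scale:
  assumes "c \<in> A" "z \<in> chart_img c"
  shows "tvec A c (z, a *\<^sub>R u) = (fst (tvec A c (z, u)), a *\<^sub>R snd (tvec A c (z, u)))"
proof -
  have "z \<in> rep_dom c (chart_at A (param c z)) id" using assms chart_at by (auto simp: rep_dom_def)
  from linear_jac[OF C1_map_id assms(1) chart_at(1) this]
  show ?thesis by (simp add: tvec_def linear_scale)
qed

lemma tvec_nonzero:
  assumes "c \<in> A" "z \<in> chart_img c" "u \<noteq> 0"
  shows "snd (tvec A c (z, u)) \<noteq> 0"
proof
  assume "snd (tvec A c (z, u)) = 0"
  then have "tvec A c (z, 0 *\<^sub>R u) = tvec A c (z, u)"
    unfolding tvec_scale[OF assms(1,2)] by (simp add: prod_eq_iff)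
  then have "(z, 0 *\<^sub>R u) = (z, u)"
    using tcovec_tvec_self[OF assms(1), of "(z, 0 *\<^sub>R u)"] tcovec_tvec_self[OF assms(1), of "(z, u)"] assms
    by simp
  then show False using assms by simp
qed

lemma tangent_norm_chart_bounds:
  assumes c: "c \<in> A" and K: "compact K" "K \<subseteq> chart_img c"
  obtains m M where "m > 0" "M > 0"
    "\<And>z u. z \<in> K \<Longrightarrow> m * norm u \<le> tangent_norm (tvec A c (z, u)) \<and> tangent_norm (tvec A c (z, u)) \<le> M * norm u"
proof -
  define C where "C = insert 1 ((\<lambda>p. tangent_norm (tvec A c p)) ` (K \<times> sphere 0 1))"
  have "compact C"
    unfolding C_def
    by (intro compact_insert compact_continuous_image compact_Times K compact_sphere
         continuous_on_subset[OF continuous_on_tangent_norm_tvec[OF c]]) (use K in auto)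
  moreover have "C \<noteq> {}" by (simp add: C_def)
  ultimately obtain m M where m: "m \<in> C" "\<And>t. t \<in> C \<Longrightarrow> m \<le> t" and M: "M \<in> C" "\<And>t. t \<in> C \<Longrightarrow> t \<le> M"
    using compact_attains_inf[of C] compact_attains_sup[of C] by metis
  have pos: "t > 0" if t: "t \<in> C" for t
  proof (cases "t = 1")
    case False
    then obtain z u where zu: "z \<in> K" "norm u = 1" "t = tangent_norm (tvec A c (z, u))"
      using t by (auto simp: C_def)
    then have "u \<noteq> 0" by auto
    then show ?thesis unfolding zu(3) tangent_norm_pos using tvec_nonzero[OF c] zu K by blast
  qed simp
  have "m * norm u \<le> tangent_norm (tvec A c (z, u)) \<and> tangent_norm (tvec A c (z, u)) \<le> M * norm u"
    if z: "z \<in> K" for z u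
  proof (cases "u = 0")
    case True
    have "snd (tvec A c (z, 0 *\<^sub>R u)) = 0"
      by (subst tvec_scale[OF c]) (use z K in auto)
    then have "\<not> tangent_norm (tvec A c (z, u)) > 0" unfolding tangent_norm_pos using True by simp
    then show ?thesis using True tangent_norm_nonneg[of "tvec A c (z, u)"] by simp
  next
    case False
    define w where "w = (1 / norm u) *\<^sub>R u"
    have w: "norm w = 1" "u = norm u *\<^sub>R w" using False by (auto simp: w_def)
    have "tangent_norm (tvec A c (z, norm u *\<^sub>R w)) = norm u * tangent_norm (tvec A c (z, w))"
      using z K tvec_scale[OF c, of z "norm u" w] tangent_norm_scale by (simp add: subset_iff)
    then have eq: "tangent_norm (tvec A c (z, u)) = norm u * tangent_norm (tvec A c (z, w))"
      using w(2) by simp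
    have "tangent_norm (tvec A c (z, w)) \<in> C" using z w by (auto simp: C_def)
    then have "m \<le> tangent_norm (tvec A c (z, w))" "tangent_norm (tvec A c (z, w)) \<le> M" using m M by auto
    then show ?thesis unfolding eq mult.commute[of "norm u"] by (intro conjI mult_right_mono) auto
  qed
  then show thesis using that pos m(1) M(1) by blast
qed

text \<open>
  Over a compact ball of a chart, the Riemannian norm dominates a multiple of the coordinate norm,
  so the unit vectors lie in the image of a compact set; finitely many such balls suffice.
\<close>

lemma compactin_unit_tangents: "compactin (tangent_bundle A) {q. tangent_norm q = 1}"
proof -
  obtain I where I: "finite I" "\<forall>(c, z, r)\<in>I. c \<in> A \<and> cball z r \<subseteq> chart_img c"
    "\<forall>x. \<exists>(c, z, r)\<in>I. x \<in> param c ` cball z r" by (rule finite_ball_cover)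
  have ex: "\<exists>C. compactin (tangent_bundle A) C \<and>
      {q. tangent_norm q = 1 \<and> fst q \<in> param (fst i) ` cball (fst (snd i)) (snd (snd i))} \<subseteq> C" if i: "i \<in> I" for i
  proof -
    obtain c z r where czr: "i = (c, z, r)" by (cases i)
    have c: "c \<in> A" "cball z r \<subseteq> chart_img c" using I(2) i czr by auto
    obtain m M where m: "m > 0" "\<And>y u. y \<in> cball z r \<Longrightarrow> m * norm u \<le> tangent_norm (tvec A c (y, u))"
      using tangent_norm_chart_bounds[OF c(1) compact_cball c(2)] by metis
    have "compactin (tangent_bundle A) (tvec A c ` (cball z r \<times> cball 0 (1 / m)))"
      using c by (intro compactin_tvec_image compact_Times compact_cball) auto
    moreover have "q \<in> tvec A c ` (cball z r \<times> cball 0 (1 / m))"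
      if q: "tangent_norm q = 1" "fst q \<in> param c ` cball z r" for q
    proof -
      obtain y where y: "y \<in> cball z r" "fst q = param c y" using q by blast
      then have yi: "y \<in> chart_img c" using c by blast
      have fq: "fst q \<in> chart_dom c" using y yi c by simp
      define u where "u = snd (tcovec A c q)"
      have "fst (tcovec A c q) = y" using y yi c by (simp add: tcovec_def split_beta)
      then have t: "tcovec A c q = (y, u)" by (simp add: u_def prod_eq_iff)
      have tq: "tvec A c (y, u) = q" using tvec_tcovec[OF c(1) fq] t by simp
      have "m * norm u \<le> 1" using m(2)[OF y(1), of u] q(1) tq by simp
      then have "u \<in> cball 0 (1 / m)" using m(1) by (simp add: field_simps)
      then show ?thesis using y(1) tq by (metis SigmaI imageI)
    qed
    ultimately show ?thesis unfolding czr
      by (intro exI[of _ "tvec A c ` (cball z r \<times> cball 0 (1 / m))"]) auto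
  qed
  obtain C where "\<forall>i\<in>I. compactin (tangent_bundle A) (C i) \<and>
      {q. tangent_norm q = 1 \<and> fst q \<in> param (fst i) ` cball (fst (snd i)) (snd (snd i))} \<subseteq> C i"
    using bchoice[OF ballI[OF ex]] by (rule exE)
  then have C: "\<And>i. i \<in> I \<Longrightarrow> compactin (tangent_bundle A) (C i)"
     "\<And>i. i \<in> I \<Longrightarrow> {q. tangent_norm q = 1 \<and> fst q \<in> param (fst i) ` cball (fst (snd i)) (snd (snd i))} \<subseteq> C i"
    by simp_all
  have cU: "compactin (tangent_bundle A) (\<Union>i\<in>I. C i)"
    using C(1) I(1) by (intro compactin_Union) auto
  have sub: "{q. tangent_norm q = 1} \<subseteq> (\<Union>i\<in>I. C i)"
  proof
    fix q assume "q \<in> {q. tangent_norm q = 1}"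
    moreover obtain i where "i \<in> I" "fst q \<in> param (fst i) ` cball (fst (snd i)) (snd (snd i))"
      using I(3)[rule_format, of "fst q"] by (auto simp: split_beta)
    ultimately show "q \<in> (\<Union>i\<in>I. C i)" using C(2) by blast
  qed
  have "closedin (tangent_bundle A) {q \<in> topspace (tangent_bundle A). tangent_norm q \<in> {1}}"
    by (rule closedin_continuous_map_preimage[OF continuous_map_tangent_norm]) simp
  then have cl: "closedin (tangent_bundle A) {q. tangent_norm q = 1}" by simp
  show ?thesis by (rule closed_compactin[OF cU sub cl])
qed

lemma C1_norm_eq: "C1_norm A g f = (SUP q\<in>{q. tangent_norm q = 1}. tangent_norm (Tmap A f q))"
proof -
  have "{tnorm g (f x) (tangent_map A f x v) |x v. tnorm g x v = 1} =
      (\<lambda>q. tangent_norm (Tmap A f q)) ` {q. tangent_norm q = 1}"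
    by (force simp: tangent_norm_def Tmap_def image_iff)
  then show ?thesis by (simp add: C1_norm_def)
qed

lemma bdd_above_unit_image:
  assumes "C1_map A f"
  shows "bdd_above ((\<lambda>q. tangent_norm (Tmap A f q)) ` {q. tangent_norm q = 1})"
proof -
  have "continuous_map (tangent_bundle A) euclideanreal (tangent_norm \<circ> Tmap A f)"
    by (rule continuous_map_compose[OF continuous_map_Tmap[OF assms] continuous_map_tangent_norm])
  from image_compactin[OF compactin_unit_tangents this]
  have "compact ((\<lambda>q. tangent_norm (Tmap A f q)) ` {q. tangent_norm q = 1})"
    by (simp add: o_def image_image)
  then show ?thesis by (intro bounded_imp_bdd_above compact_imp_bounded)
qed

lemma Tmap_scale:
  assumes "C1_map A f"
  shows "Tmap A f (x, a *\<^sub>R v) = (fst (Tmap A f (x, v)), a *\<^sub>R snd (Tmap A f (x, v)))"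
  using linear_tangent_map[OF assms, of x] by (simp add: Tmap_def linear_scale)

lemma normalized_tangent:
  assumes "snd q \<noteq> 0" "C1_map A f"
  defines "q1 \<equiv> (fst q, (1 / tangent_norm q) *\<^sub>R snd q)"
  shows "tangent_norm q1 = 1" "tangent_norm (Tmap A f q) = tangent_norm q * tangent_norm (Tmap A f q1)"
proof -
  have pos: "tangent_norm q > 0" using assms tangent_norm_pos by blast
  then show "tangent_norm q1 = 1"
    using tangent_norm_scale[of "fst q" "1 / tangent_norm q" "snd q"] by (simp add: q1_def)
  have "tangent_norm (Tmap A f q1) = (1 / tangent_norm q) * tangent_norm (Tmap A f q)"
    using pos Tmap_scale[OF assms(2), of "fst q" "1 / tangent_norm q" "snd q"]
      tangent_norm_scale[of "fst (Tmap A f q)" "1 / tangent_norm q" "snd (Tmap A f q)"]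
    by (simp add: q1_def)
  then show "tangent_norm (Tmap A f q) = tangent_norm q * tangent_norm (Tmap A f q1)"
    using pos by simp
qed

lemma Tmap_zero: "C1_map A f \<Longrightarrow> snd q = 0 \<Longrightarrow> snd (Tmap A f q) = 0"
  using linear_tangent_map[of f "fst q"] by (simp add: Tmap_def linear_0 split_beta)

lemma tangent_norm_Tmap_le:
  assumes "C1_map A f"
  shows "tangent_norm (Tmap A f q) \<le> C1_norm A g f * tangent_norm q"
proof (cases "snd q = 0")
  case True
  then have "tangent_norm (Tmap A f q) = 0" "tangent_norm q = 0"
    using Tmap_zero[OF assms True] tangent_norm_pos tangent_norm_nonneg by (metis order.order_iff_strict)+
  then show ?thesis by simp
next
  case False
  note n = normalized_tangent[OF False assms]
  have "tangent_norm (Tmap A f (fst q, (1 / tangent_norm q) *\<^sub>R snd q)) \<le> C1_norm A g f"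
    unfolding C1_norm_eq using n(1) by (intro cSUP_upper bdd_above_unit_image assms) simp
  then show ?thesis
    unfolding n(2) using tangent_norm_nonneg by (metis mult.commute mult_left_mono)
qed

lemma Tmap_nonzero:
  assumes "f \<in> Diff1 A" "q \<in> nonzero_tangents"
  shows "Tmap A f q \<in> nonzero_tangents"
proof -
  have "Tmap A (inv f \<circ> f) q = Tmap A (inv f) (Tmap A f q)"
    by (rule Tmap_comp[OF Diff1_C1_map[OF inv_in_Diff1[OF assms(1)]] Diff1_C1_map[OF assms(1)]])
  moreover have "inv f \<circ> f = id"
    using Diff1_bij[OF assms(1)] by (simp add: bij_is_inj)
  ultimately have "Tmap A (inv f) (Tmap A f q) = q" by simp
  then show ?thesis
    using Tmap_zero[OF Diff1_C1_map[OF inv_in_Diff1[OF assms(1)]], of "Tmap A f q"] assms(2)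
    by (auto simp: nonzero_tangents_def)
qed

lemma nonzero_tangents_nonempty: "\<exists>q. tangent_norm q = 1" "nonzero_tangents \<noteq> {}"
proof -
  obtain b :: 'b where "b \<in> Basis" using nonempty_Basis by blast
  then have "snd (undefined :: 'm, b) \<noteq> 0" using nonzero_Basis by auto
  then show "\<exists>q. tangent_norm q = 1" "nonzero_tangents \<noteq> {}"
    using normalized_tangent(1)[OF _ C1_map_id] unfolding nonzero_tangents_def by blast+
qed

lemma C1_norm_nonneg: "C1_map A f \<Longrightarrow> 0 \<le> C1_norm A g f"
proof -
  assume f: "C1_map A f"
  obtain q where "tangent_norm q = 1" using nonzero_tangents_nonempty by blast
  then show ?thesis using tangent_norm_Tmap_le[OF f, of q] tangent_norm_nonneg[of "Tmap A f q"] by simp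
qed

lemma tangent_norm_funpow_le:
  assumes "f \<in> Diff1 A"
  shows "tangent_norm (Tmap A (f ^^ n) q) \<le> C1_norm A g f ^ n * tangent_norm q"
proof (induction n)
  case (Suc n)
  have "tangent_norm (Tmap A (f ^^ Suc n) q) = tangent_norm (Tmap A f (Tmap A (f ^^ n) q))"
    unfolding funpow.simps
    using Tmap_comp[OF Diff1_C1_map[OF assms] Diff1_C1_map[OF funpow_in_Diff1[OF assms, of n]]] by metis
  also have "\<dots> \<le> C1_norm A g f * tangent_norm (Tmap A (f ^^ n) q)"
    by (rule tangent_norm_Tmap_le[OF Diff1_C1_map[OF assms]])
  also have "\<dots> \<le> C1_norm A g f * (C1_norm A g f ^ n * tangent_norm q)"
    by (intro mult_left_mono Suc C1_norm_nonneg Diff1_C1_map assms)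
  finally show ?case by (simp only: power_Suc mult.assoc)
qed (simp only: funpow.simps power_0 Tmap_id mult_1 order_refl)

text \<open>
  A single \<open>C^1\<close> function \<open>F\<close> on the manifold with infinitely many values, namely the square of
  the positive part of \<open>r\<^sup>2 - |y - z1|\<^sup>2\<close> in a chart. Its gradient is bounded, so the derivative
  of \<open>F \<circ> f\<close> is bounded by the Riemannian length of the transported vector, with a constant that
  does not depend on \<open>f\<close>.
\<close>

lemma bump_function:
  obtains F :: "'m \<Rightarrow> real" and K where "K \<ge> 0" "infinite (range F)"
    "\<And>f c z. f \<in> Diff1 A \<Longrightarrow> c \<in> A \<Longrightarrow> z \<in> chart_img c \<Longrightarrow>
       \<exists>D. ((\<lambda>z. F (f (param c z))) has_derivative D) (at z) \<and>
           (\<forall>u. \<bar>D u\<bar> \<le> K * tangent_norm (Tmap A f (tvec A c (z, u))))"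
proof -
  define d where "d = chart_at A undefined"
  define z1 where "z1 = coord d undefined"
  have d: "d \<in> A" "z1 \<in> chart_img d" using chart_at by (auto simp: d_def z1_def)
  obtain r where r: "r > 0" "cball z1 r \<subseteq> chart_img d"
    using open_contains_cball open_chart_img[OF d(1)] d(2) by blast
  obtain m M where m: "m > 0"
    "\<And>y w. y \<in> cball z1 r \<Longrightarrow> m * norm w \<le> tangent_norm (tvec A d (y, w)) \<and> tangent_norm (tvec A d (y, w)) \<le> M * norm w"
    using tangent_norm_chart_bounds[OF d(1) compact_cball r(2)] by metis
  define s where "s y = r\<^sup>2 - (y - z1) \<bullet> (y - z1)" for y
  define \<phi> where "\<phi> y = (max 0 (s y))\<^sup>2" for y
  define D\<phi> where "D\<phi> y w = - 2 * ((y - z1) \<bullet> w) * (2 * max 0 (s y))" for y w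
  have s_out: "s y < 0" if "y \<notin> cball z1 r" for y
  proof -
    have "r < norm (y - z1)" using that by (simp add: dist_norm norm_minus_commute)
    then have "r\<^sup>2 < (norm (y - z1))\<^sup>2" using r(1) by (intro power_strict_mono) auto
    then show ?thesis by (simp add: s_def power2_norm_eq_inner)
  qed
  have D\<phi>: "(\<phi> has_derivative D\<phi> y) (at y)" for y
  proof -
    have "(s has_derivative (\<lambda>w. - 2 * ((y - z1) \<bullet> w))) (at y)"
      unfolding s_def by (auto intro!: derivative_eq_intros simp: inner_commute algebra_simps)
    from DERIV_compose_FDERIV[OF has_real_derivative_pos_part_power2 this]
    show ?thesis by (simp add: \<phi>_def[abs_def] D\<phi>_def[abs_def])
  qed
  define K where "K = 4 * r ^ 3 / m"
  have D\<phi>_bound: "\<bar>D\<phi> y w\<bar> \<le> K * tangent_norm (tvec A d (y, w))" for y w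
  proof (cases "y \<in> cball z1 r")
    case True
    then have n: "norm (y - z1) \<le> r" by (simp add: dist_norm norm_minus_commute)
    have "s y \<le> r\<^sup>2" by (simp add: s_def)
    then have mx: "max 0 (s y) \<le> r\<^sup>2" by simp
    have "\<bar>(y - z1) \<bullet> w\<bar> \<le> norm (y - z1) * norm w" by (rule Cauchy_Schwarz_ineq2)
    also have "\<dots> \<le> r * norm w" using n by (rule mult_right_mono) simp
    finally have cs: "\<bar>(y - z1) \<bullet> w\<bar> \<le> r * norm w" .
    have "\<bar>D\<phi> y w\<bar> = 4 * (\<bar>(y - z1) \<bullet> w\<bar> * max 0 (s y))" by (simp add: D\<phi>_def abs_mult)
    also have "\<dots> \<le> 4 * ((r * norm w) * r\<^sup>2)"
      using cs mx r(1) by (intro mult_left_mono mult_mono) auto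
    also have "\<dots> = K * (m * norm w)" using m(1) by (simp add: K_def power2_eq_square power3_eq_cube)
    also have "\<dots> \<le> K * tangent_norm (tvec A d (y, w))"
      using m True r(1) by (intro mult_left_mono) (auto simp: K_def)
    finally show ?thesis .
  next
    case False
    then have "D\<phi> y w = 0" using s_out[OF False] by (simp add: D\<phi>_def)
    then show ?thesis using m(1) r(1) tangent_norm_nonneg by (simp add: K_def)
  qed
  define F where "F x = (if x \<in> chart_dom d then \<phi> (coord d x) else 0)" for x
  define B where "B = param d ` cball z1 r"
  have "compact B" unfolding B_def
    by (intro compact_continuous_image continuous_on_subset[OF continuous_param[OF d(1)] r(2)] compact_cball)
  then have oB: "open (- B)" using compact_imp_closed by blast
  have F_out: "F x = 0" if "x \<notin> B" for x
  proof (cases "x \<in> chart_dom d")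
    case True
    then have "param d (coord d x) = x" using d by simp
    then have "coord d x \<notin> cball z1 r" using that unfolding B_def by (metis imageI)
    then show ?thesis using s_out[of "coord d x"] by (simp add: F_def \<phi>_def)
  qed (simp add: F_def)
  have inf: "infinite (range F)"
  proof -
    obtain b :: 'b where b: "b \<in> Basis" using nonempty_Basis by blast
    have v: "F (param d (z1 + t *\<^sub>R b)) = (r\<^sup>2 - t\<^sup>2)\<^sup>2" if t: "t \<in> {0..r}" for t
    proof -
      have "z1 + t *\<^sub>R b \<in> cball z1 r" using t b by (simp add: dist_norm)
      then have i: "z1 + t *\<^sub>R b \<in> chart_img d" using r by blast
      have "s (z1 + t *\<^sub>R b) = r\<^sup>2 - t\<^sup>2" using b by (simp add: s_def power2_eq_square)
      moreover have "t\<^sup>2 \<le> r\<^sup>2" using t by (intro power_mono) auto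
      ultimately show ?thesis
        unfolding F_def using i coord_param[OF d(1) i] param_in_dom[OF d(1) i] by (simp add: \<phi>_def)
    qed
    have "inj_on (\<lambda>t. (r\<^sup>2 - t\<^sup>2)\<^sup>2) {0..r}"
    proof (rule inj_onI)
      fix t t' assume t: "t \<in> {0..r}" "t' \<in> {0..r}" and "(r\<^sup>2 - t\<^sup>2)\<^sup>2 = (r\<^sup>2 - t'\<^sup>2)\<^sup>2"
      moreover have "t\<^sup>2 \<le> r\<^sup>2" "t'\<^sup>2 \<le> r\<^sup>2" using t by (auto intro: power_mono)
      ultimately have "r\<^sup>2 - t\<^sup>2 = r\<^sup>2 - t'\<^sup>2" by (subst (asm) power2_eq_iff_nonneg) auto
      then have "t\<^sup>2 = t'\<^sup>2" by simp
      then show "t = t'" using t by (subst (asm) power2_eq_iff_nonneg) auto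
    qed
    then have "infinite ((\<lambda>t. (r\<^sup>2 - t\<^sup>2)\<^sup>2) ` {0..r})"
      using r(1) by (simp add: finite_image_iff infinite_Icc)
    moreover have "(\<lambda>t. (r\<^sup>2 - t\<^sup>2)\<^sup>2) ` {0..r} \<subseteq> range F"
      using v by (auto simp flip: v)
    ultimately show ?thesis using finite_subset by blast
  qed
  have der: "\<exists>D. ((\<lambda>z. F (f (param c z))) has_derivative D) (at z) \<and>
           (\<forall>u. \<bar>D u\<bar> \<le> K * tangent_norm (Tmap A f (tvec A c (z, u))))"
    if f: "f \<in> Diff1 A" and c: "c \<in> A" and z: "z \<in> chart_img c" for f c z
  proof (cases "f (param c z) \<in> chart_dom d")
    case True
    note fC = Diff1_C1_map[OF f]
    have r: "z \<in> rep_dom c d f" using True z by (simp add: rep_dom_def)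
    have "((\<lambda>z. \<phi> (local_rep c d f z)) has_derivative (\<lambda>u. D\<phi> (local_rep c d f z) (jac c d f z u))) (at z)"
      using diff_chain_at[OF jac_has_derivative[OF fC c d(1) r] D\<phi>] by (simp add: o_def)
    then have "((\<lambda>z. F (f (param c z))) has_derivative (\<lambda>u. D\<phi> (local_rep c d f z) (jac c d f z u))) (at z)"
    proof (rule has_derivative_transform_within_open[OF _ open_rep_dom[OF c d(1) C1_map_continuous[OF fC]] r])
      show "\<phi> (local_rep c d f y) = F (f (param c y))" if "y \<in> rep_dom c d f" for y
        using that by (simp add: F_def local_rep_def rep_dom_def)
    qed
    moreover have "\<bar>D\<phi> (local_rep c d f z) (jac c d f z u)\<bar> \<le> K * tangent_norm (Tmap A f (tvec A c (z, u)))" for u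
      using D\<phi>_bound[of "local_rep c d f z" "jac c d f z u"] Tmap_tvec[OF fC c d(1), of "(z, u)"] r
      by (simp add: tjet_def local_rep_def)
    ultimately show ?thesis by blast
  next
    case False
    have "f (param c z) \<notin> B" using False r(2) d(1) by (auto simp: B_def)
    have "continuous_on (chart_img c) (\<lambda>z. f (param c z))"
      using continuous_on_compose2[OF C1_map_continuous[OF Diff1_C1_map[OF f]] continuous_param[OF c]] by simp
    from continuous_open_preimage[OF this open_chart_img[OF c] oB]
    have o: "open (chart_img c \<inter> (\<lambda>z. f (param c z)) -` (- B))" .
    have "((\<lambda>z. 0) has_derivative (\<lambda>u. 0)) (at z)" by simp
    then have "((\<lambda>z. F (f (param c z))) has_derivative (\<lambda>u. 0)) (at z)"
      by (rule has_derivative_transform_within_open[OF _ o])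
         (use z \<open>f (param c z) \<notin> B\<close> F_out in auto)
    moreover have "K \<ge> 0" using m(1) r(1) by (simp add: K_def)
    ultimately show ?thesis using tangent_norm_nonneg by (intro exI[of _ "\<lambda>u. 0"]) simp
  qed
  show thesis
    by (rule that[of K F, OF _ inf der]) (use m(1) r(1) in \<open>simp_all add: K_def\<close>)
qed

text \<open>
  If \<open>f\<close> contracted all tangent vectors by a factor \<open>\<theta> < 1\<close>, the oscillation of \<open>F \<circ> f^n\<close> on each of
  finitely many balls covering the manifold would be \<open>O(\<theta>^n)\<close>. Since \<open>f^n\<close> is onto, \<open>F\<close> would take
  its values in that many arbitrarily short intervals, but it has infinitely many values.
\<close>

lemma C1_norm_ge_1:
  assumes f: "f \<in> Diff1 A"
  shows "C1_norm A g f \<ge> 1"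
proof (rule ccontr)
  define \<theta> where "\<theta> = C1_norm A g f"
  assume "\<not> C1_norm A g f \<ge> 1"
  then have \<theta>: "0 \<le> \<theta>" "\<theta> < 1" using C1_norm_nonneg[OF Diff1_C1_map[OF f]] by (auto simp: \<theta>_def)
  obtain F :: "'m \<Rightarrow> real" and K where F: "K \<ge> 0" "infinite (range F)"
    "\<And>f c z. f \<in> Diff1 A \<Longrightarrow> c \<in> A \<Longrightarrow> z \<in> chart_img c \<Longrightarrow>
       \<exists>D. ((\<lambda>z. F (f (param c z))) has_derivative D) (at z) \<and>
           (\<forall>u. \<bar>D u\<bar> \<le> K * tangent_norm (Tmap A f (tvec A c (z, u))))"
    using bump_function by metis
  obtain I where I: "finite I" "\<forall>(c, z, r)\<in>I. c \<in> A \<and> cball z r \<subseteq> chart_img c"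
    "\<forall>x. \<exists>(c, z, r)\<in>I. x \<in> param c ` cball z r" by (rule finite_ball_cover)
  define cell where "cell i = param (fst i) ` cball (fst (snd i)) (snd (snd i))" for i :: "('m, 'b) chart \<times> 'b \<times> real"
  have "\<exists>C. \<forall>n. \<forall>x\<in>cell i. \<forall>y\<in>cell i. \<bar>F ((f ^^ n) x) - F ((f ^^ n) y)\<bar> \<le> C * \<theta> ^ n" if i: "i \<in> I" for i
  proof -
    obtain c z r where czr: "i = (c, z, r)" by (cases i)
    have c: "c \<in> A" "cball z r \<subseteq> chart_img c" using I(2) i czr by auto
    obtain m M where M: "M > 0" "\<And>y u. y \<in> cball z r \<Longrightarrow> tangent_norm (tvec A c (y, u)) \<le> M * norm u"
      using tangent_norm_chart_bounds[OF c(1) compact_cball c(2)] by metis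
    have "\<bar>F ((f ^^ n) (param c y)) - F ((f ^^ n) (param c y'))\<bar> \<le> (K * M * (2 * r)) * \<theta> ^ n"
      if y: "y \<in> cball z r" "y' \<in> cball z r" for n y y'
    proof -
      have ex: "\<exists>D. ((\<lambda>z. F ((f ^^ n) (param c z))) has_derivative D) (at x within cball z r) \<and>
          onorm D \<le> K * M * \<theta> ^ n" if x: "x \<in> cball z r" for x
      proof -
        obtain D where D: "((\<lambda>z. F ((f ^^ n) (param c z))) has_derivative D) (at x)"
          "\<And>u. \<bar>D u\<bar> \<le> K * tangent_norm (Tmap A (f ^^ n) (tvec A c (x, u)))"
          using F(3)[OF funpow_in_Diff1[OF f, of n] c(1) subsetD[OF c(2) x]] by metis
        have "norm (D u) \<le> (K * M * \<theta> ^ n) * norm u" for u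
        proof -
          have "norm (D u) \<le> K * tangent_norm (Tmap A (f ^^ n) (tvec A c (x, u)))" using D(2) by simp
          also have "\<dots> \<le> K * (\<theta> ^ n * tangent_norm (tvec A c (x, u)))"
            unfolding \<theta>_def by (intro mult_left_mono tangent_norm_funpow_le f F)
          also have "\<dots> \<le> K * (\<theta> ^ n * (M * norm u))"
            using \<theta> by (intro mult_left_mono M x F) auto
          finally show ?thesis by (simp add: algebra_simps)
        qed
        then have "onorm D \<le> K * M * \<theta> ^ n"
          using F(1) M(1) \<theta>(1) by (intro onorm_bound) auto
        then show ?thesis using has_derivative_at_withinI[OF D(1)] by (intro exI[of _ D] conjI)
      qed
      obtain D where D: "\<And>x. x \<in> cball z r \<Longrightarrow> ((\<lambda>z. F ((f ^^ n) (param c z))) has_derivative D x) (at x within cball z r)"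
          "\<And>x. x \<in> cball z r \<Longrightarrow> onorm (D x) \<le> K * M * \<theta> ^ n"
        using ex by metis
      have "norm (F ((f ^^ n) (param c y)) - F ((f ^^ n) (param c y'))) \<le> K * M * \<theta> ^ n * norm (y - y')"
        by (rule differentiable_bound[OF convex_cball D y])
      also have "\<dots> \<le> K * M * \<theta> ^ n * (2 * r)"
      proof (rule mult_left_mono)
        have "dist y y' \<le> dist z y + dist z y'" by (rule dist_triangle3)
        then show "norm (y - y') \<le> 2 * r" using y by (simp add: dist_norm)
      qed (use F(1) M(1) \<theta>(1) in auto)
      finally show ?thesis by (simp add: algebra_simps)
    qed
    then have "\<forall>n. \<forall>x\<in>cell i. \<forall>y\<in>cell i. \<bar>F ((f ^^ n) x) - F ((f ^^ n) y)\<bar> \<le> (K * M * (2 * r)) * \<theta> ^ n"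
      by (auto simp: cell_def czr)
    then show ?thesis by blast
  qed
  then obtain C where C: "\<And>i n x y. i \<in> I \<Longrightarrow> x \<in> cell i \<Longrightarrow> y \<in> cell i \<Longrightarrow>
      \<bar>F ((f ^^ n) x) - F ((f ^^ n) y)\<bar> \<le> C i * \<theta> ^ n" by metis
  obtain V where V: "finite V" "card V = Suc (card I)" "V \<subseteq> range F"
    using infinite_arbitrarily_large[OF F(2)] by blast
  have "\<forall>\<^sub>F n in sequentially. \<forall>p\<in>I \<times> {(s, t) \<in> V \<times> V. s \<noteq> t}. C (fst p) * \<theta> ^ n < \<bar>fst (snd p) - snd (snd p)\<bar>"
  proof (rule eventually_ball_finite)
    have "finite {(s, t) \<in> V \<times> V. s \<noteq> t}"
      using V(1) by (rule_tac finite_subset[of _ "V \<times> V"]) auto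
    then show "finite (I \<times> {(s, t) \<in> V \<times> V. s \<noteq> t})" using I(1) by blast
    show "\<forall>p\<in>I \<times> {(s, t) \<in> V \<times> V. s \<noteq> t}. \<forall>\<^sub>F n in sequentially. C (fst p) * \<theta> ^ n < \<bar>fst (snd p) - snd (snd p)\<bar>"
    proof
      fix p assume "p \<in> I \<times> {(s, t) \<in> V \<times> V. s \<noteq> t}"
      then have pos: "0 < \<bar>fst (snd p) - snd (snd p)\<bar>" by auto
      have "(\<lambda>n. C (fst p) * \<theta> ^ n) \<longlonglongrightarrow> C (fst p) * 0"
        using \<theta> by (intro tendsto_mult tendsto_const LIMSEQ_realpow_zero)
      from order_tendstoD(2)[OF this] pos
      show "\<forall>\<^sub>F n in sequentially. C (fst p) * \<theta> ^ n < \<bar>fst (snd p) - snd (snd p)\<bar>" by simp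
    qed
  qed
  then obtain n where n: "\<And>i s t. i \<in> I \<Longrightarrow> s \<in> V \<Longrightarrow> t \<in> V \<Longrightarrow> s \<noteq> t \<Longrightarrow> C i * \<theta> ^ n < \<bar>s - t\<bar>"
    unfolding eventually_sequentially by fastforce
  have "\<exists>i\<in>I. \<exists>x\<in>cell i. F ((f ^^ n) x) = t" if t: "t \<in> V" for t
  proof -
    obtain y where y: "t = F y" using t V(3) by blast
    obtain x where x: "y = (f ^^ n) x"
      using Diff1_bij[OF funpow_in_Diff1[OF f, of n]] by (metis bij_pointE)
    obtain i where "i \<in> I" "x \<in> cell i"
      using I(3)[rule_format, of x] by (auto simp: cell_def split_beta)
    then show ?thesis using x y by blast
  qed
  then obtain i x where ix: "\<And>t. t \<in> V \<Longrightarrow> i t \<in> I \<and> x t \<in> cell (i t) \<and> F ((f ^^ n) (x t)) = t" by metis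
  have "inj_on i V"
  proof (rule inj_onI, rule ccontr)
    fix s t assume st: "s \<in> V" "t \<in> V" "i s = i t" "s \<noteq> t"
    have "\<bar>s - t\<bar> \<le> C (i s) * \<theta> ^ n"
      using C[of "i s" "x s" "x t" n] ix[OF st(1)] ix[OF st(2)] st(3) by simp
    then show False using n[of "i s" s t] ix[OF st(1)] st by simp
  qed
  moreover have "i ` V \<subseteq> I" using ix by blast
  ultimately have "card V \<le> card I" using I(1) by (rule card_inj_on_le)
  then show False using V(2) by simp
qed

lemma log_norm_Tmap_bound:
  assumes f: "f \<in> Diff1 A" and q: "q \<in> nonzero_tangents"
  shows "\<bar>log_norm (Tmap A f q) - log_norm q\<bar> \<le> ln (C1_norm A g f) + ln (C1_norm A g (inv f))"
proof -
  have *: "log_norm (Tmap A h r) - log_norm r \<le> ln (C1_norm A g h)" if h: "h \<in> Diff1 A" and r: "r \<in> nonzero_tangents" for h r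
  proof -
    have pos: "tangent_norm r > 0" "tangent_norm (Tmap A h r) > 0"
      using r Tmap_nonzero[OF h r] by (auto simp: nonzero_tangents_def tangent_norm_pos)
    then have "ln (tangent_norm (Tmap A h r)) \<le> ln (C1_norm A g h * tangent_norm r)"
      using tangent_norm_Tmap_le[OF Diff1_C1_map[OF h], of r] C1_norm_ge_1[OF h] by simp
    also have "\<dots> = ln (C1_norm A g h) + ln (tangent_norm r)"
      using C1_norm_ge_1[OF h] pos by (intro ln_mult_pos) auto
    finally show ?thesis by (simp add: log_norm_def)
  qed
  have "inv f \<circ> f = id" using Diff1_bij[OF f] by (simp add: bij_is_inj)
  then have inv: "Tmap A (inv f) (Tmap A f q) = q"
    using Tmap_comp[OF Diff1_C1_map[OF inv_in_Diff1[OF f]] Diff1_C1_map[OF f], of q] by simp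
  have "ln (C1_norm A g f) \<ge> 0" "ln (C1_norm A g (inv f)) \<ge> 0"
    using C1_norm_ge_1[OF f] C1_norm_ge_1[OF inv_in_Diff1[OF f]] by auto
  then show ?thesis
    using *[OF f q] *[OF inv_in_Diff1[OF f] Tmap_nonzero[OF f q]] unfolding inv by linarith
qed

text \<open>
  A supremum of continuous functions of \<open>f\<close>, hence lower semicontinuous and measurable; it is
  subadditive under composition and controls the change of the log norm both ways.
\<close>

definition log_distortion :: "('m \<Rightarrow> 'm) \<Rightarrow> real" where
  "log_distortion f = (SUP q\<in>nonzero_tangents. \<bar>log_norm (Tmap A f q) - log_norm q\<bar>)"

lemma bdd_above_log_distortion:
  "f \<in> Diff1 A \<Longrightarrow> bdd_above ((\<lambda>q. \<bar>log_norm (Tmap A f q) - log_norm q\<bar>) ` nonzero_tangents)"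
  using log_norm_Tmap_bound by (auto intro!: bdd_aboveI2)

lemma log_distortion_upper:
  "f \<in> Diff1 A \<Longrightarrow> q \<in> nonzero_tangents \<Longrightarrow> \<bar>log_norm (Tmap A f q) - log_norm q\<bar> \<le> log_distortion f"
  unfolding log_distortion_def by (rule cSUP_upper[OF _ bdd_above_log_distortion])

lemma log_distortion_le:
  "f \<in> Diff1 A \<Longrightarrow> log_distortion f \<le> ln (C1_norm A g f) + ln (C1_norm A g (inv f))"
  unfolding log_distortion_def by (rule cSUP_least[OF nonzero_tangents_nonempty(2) log_norm_Tmap_bound])

lemma log_distortion_nonneg:
  assumes "f \<in> Diff1 A" shows "0 \<le> log_distortion f"
proof -
  obtain q where "q \<in> nonzero_tangents" using nonzero_tangents_nonempty by blast
  from log_distortion_upper[OF assms this] show ?thesis by linarith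
qed

lemma log_distortion_comp:
  assumes f: "f \<in> Diff1 A" and h: "h \<in> Diff1 A"
  shows "log_distortion (f \<circ> h) \<le> log_distortion f + log_distortion h"
  unfolding log_distortion_def[of "f \<circ> h"]
proof (rule cSUP_least[OF nonzero_tangents_nonempty(2)])
  fix q assume q: "q \<in> nonzero_tangents"
  show "\<bar>log_norm (Tmap A (f \<circ> h) q) - log_norm q\<bar> \<le> log_distortion f + log_distortion h"
    using log_distortion_upper[OF h q] log_distortion_upper[OF f Tmap_nonzero[OF h q]]
      Tmap_comp[OF Diff1_C1_map[OF f] Diff1_C1_map[OF h], of q] by simp
qed

lemma openin_evaluation:
  assumes "openin (tangent_bundle A) U"
  shows "openin (C1_topology A) {f \<in> Diff1 A. Tmap A f q \<in> U}"
  using openin_C1_carry[OF _ assms, of "{q}"] by simp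

lemma measurable_log_norm_Tmap [measurable]:
  "(\<lambda>f. log_norm (Tmap A f q)) \<in> borel_measurable (diff1_borel A)"
proof -
  have "(\<lambda>f. tangent_norm (Tmap A f q)) \<in> borel_measurable (diff1_borel A)"
    unfolding borel_measurable_iff_greater
  proof
    fix a
    \<comment> \<open>Evaluation at a vector is continuous, and so is the norm on the bundle.\<close>
    have "openin (C1_topology A) {f \<in> Diff1 A. Tmap A f q \<in> {q. tangent_norm q \<in> {a<..}}}"
      by (intro openin_evaluation openin_tangent_norm_vimage open_greaterThan)
    from open_in_sets[OF this] show "{f \<in> space (diff1_borel A). a < tangent_norm (Tmap A f q)} \<in> sets (diff1_borel A)"
      by simp
  qed
  then show ?thesis unfolding log_norm_def by measurable
qed

lemma measurable_log_distortion [measurable]: "log_distortion \<in> borel_measurable (diff1_borel A)"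
  unfolding borel_measurable_iff_greater
proof
  fix a
  define U where "U q = {q'. tangent_norm q' \<in> {0<..} \<inter> (\<lambda>t. \<bar>ln t - log_norm q\<bar>) -` {a<..}}" for q
  have U: "openin (tangent_bundle A) (U q)" for q
    unfolding U_def
    by (intro openin_tangent_norm_vimage continuous_open_preimage open_greaterThan continuous_intros) auto
  have "{f \<in> Diff1 A. a < log_distortion f} = (\<Union>q\<in>nonzero_tangents. {f \<in> Diff1 A. Tmap A f q \<in> U q})"
  proof (intro equalityI subsetI)
    fix f assume "f \<in> {f \<in> Diff1 A. a < log_distortion f}"
    then have f: "f \<in> Diff1 A" "a < log_distortion f" by auto
    then obtain q where q: "q \<in> nonzero_tangents" "a < \<bar>log_norm (Tmap A f q) - log_norm q\<bar>"
      unfolding log_distortion_def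
      using less_cSUP_iff[OF nonzero_tangents_nonempty(2) bdd_above_log_distortion[OF f(1)]] by blast
    have "Tmap A f q \<in> U q"
      using q Tmap_nonzero[OF f(1) q(1)] by (simp add: U_def log_norm_def nonzero_tangents_def tangent_norm_pos)
    then show "f \<in> (\<Union>q\<in>nonzero_tangents. {f \<in> Diff1 A. Tmap A f q \<in> U q})" using f q by blast
  next
    fix f assume "f \<in> (\<Union>q\<in>nonzero_tangents. {f \<in> Diff1 A. Tmap A f q \<in> U q})"
    then obtain q where q: "q \<in> nonzero_tangents" "f \<in> Diff1 A" "Tmap A f q \<in> U q" by blast
    then have "a < \<bar>log_norm (Tmap A f q) - log_norm q\<bar>" by (simp add: U_def log_norm_def)
    then show "f \<in> {f \<in> Diff1 A. a < log_distortion f}"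
      using log_distortion_upper[OF q(2,1)] q(2) by simp
  qed
  moreover have "openin (C1_topology A) (\<Union>q\<in>nonzero_tangents. {f \<in> Diff1 A. Tmap A f q \<in> U q})"
    using openin_evaluation[OF U] by (intro openin_Union) auto
  ultimately show "{f \<in> space (diff1_borel A). a < log_distortion f} \<in> sets (diff1_borel A)"
    using open_in_sets by simp
qed

text \<open>
  The distortion is at most the quantity in the moment condition, and \<open>x \<le> 1 + x^p\<close> for \<open>x \<ge> 0\<close>.
\<close>

lemma integrable_log_distortion:
  assumes "prob_space \<nu>" and sets: "sets \<nu> = sets (diff1_borel A)" and p: "p > 1"
    and fin: "(\<integral>\<^sup>+ f. ennreal ((ln (C1_norm A g f) + ln (C1_norm A g (inv f))) powr p) \<partial>\<nu>) < \<infinity>"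
  shows "integrable \<nu> log_distortion"
proof (rule integrableI_bounded)
  interpret prob_space \<nu> by fact
  have meas: "log_distortion \<in> borel_measurable \<nu>"
    using measurable_log_distortion measurable_cong_sets[OF sets refl] by blast
  then show "log_distortion \<in> borel_measurable \<nu>" .
  have sp: "space \<nu> = Diff1 A" using sets_eq_imp_space_eq[OF sets] by simp
  have "(\<integral>\<^sup>+ f. norm (log_distortion f) \<partial>\<nu>) \<le> (\<integral>\<^sup>+ f. 1 + ennreal (log_distortion f powr p) \<partial>\<nu>)"
  proof (rule nn_integral_mono)
    fix f assume "f \<in> space \<nu>"
    then have L: "log_distortion f \<ge> 0" using sp log_distortion_nonneg by simp
    have "log_distortion f \<le> 1 + log_distortion f powr p"
    proof (cases "log_distortion f \<le> 1")
      case False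
      then have "log_distortion f powr 1 \<le> log_distortion f powr p" using p by (intro powr_mono) auto
      then show ?thesis using False by simp
    qed (simp add: add_increasing2)
    then have "ennreal (log_distortion f) \<le> ennreal (1 + log_distortion f powr p)" by (rule ennreal_leI)
    then show "ennreal (norm (log_distortion f)) \<le> 1 + ennreal (log_distortion f powr p)"
      using L by (subst (asm) ennreal_plus) auto
  qed
  also have "\<dots> = 1 + (\<integral>\<^sup>+ f. ennreal (log_distortion f powr p) \<partial>\<nu>)"
    using meas by (subst nn_integral_add) (auto simp: emeasure_space_1)
  also have "\<dots> \<le> 1 + (\<integral>\<^sup>+ f. ennreal ((ln (C1_norm A g f) + ln (C1_norm A g (inv f))) powr p) \<partial>\<nu>)"
    using p sp log_distortion_le log_distortion_nonneg
    by (intro add_left_mono nn_integral_mono ennreal_leI powr_mono2) auto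
  also have "\<dots> < \<infinity>" using fin by (simp add: ennreal_add_eq_top less_top)
  finally show "(\<integral>\<^sup>+ f. norm (log_distortion f) \<partial>\<nu>) < \<infinity>" .
qed

end

section \<open>Convolution powers and Lyapunov functions\<close>

context riemannian_atlas
begin

abbreviation \<D> :: "('m \<Rightarrow> 'm) measure" where
  "\<D> \<equiv> diff1_borel A"

text \<open>
  The measures to which the theory of expansion applies; \<open>\<nu>\<close>, its convolution powers and its
  hitting measures are of this kind.
\<close>

definition log_integrable :: "('m \<Rightarrow> 'm) measure \<Rightarrow> bool" where
  "log_integrable m \<longleftrightarrow> prob_space m \<and> sets m = sets \<D> \<and> integrable m log_distortion"

lemma log_integrableD:
  assumes "log_integrable m"
  shows "prob_space m" "sets m = sets \<D>" "integrable m log_distortion" "space m = Diff1 A"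
  using assms sets_eq_imp_space_eq[of m \<D>] by (auto simp: log_integrable_def)

lemma comp_measurable_sets:
  assumes "sets m = sets \<D>" "sets m' = sets \<D>"
  shows "(\<lambda>(f, h). f \<circ> h) \<in> m \<Otimes>\<^sub>M m' \<rightarrow>\<^sub>M \<D>" "(\<lambda>(f, h). h \<circ> f) \<in> m \<Otimes>\<^sub>M m' \<rightarrow>\<^sub>M \<D>"
proof -
  show "(\<lambda>(f, h). f \<circ> h) \<in> m \<Otimes>\<^sub>M m' \<rightarrow>\<^sub>M \<D>"
    using comp_measurable measurable_cong_sets[OF sets_pair_measure_cong[OF assms] refl] by blast
  have "(\<lambda>(f, h). f \<circ> h) \<in> m' \<Otimes>\<^sub>M m \<rightarrow>\<^sub>M \<D>"
    using comp_measurable measurable_cong_sets[OF sets_pair_measure_cong[OF assms(2,1)] refl] by blast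
  from measurable_compose[OF measurable_pair_swap' this]
  show "(\<lambda>(f, h). h \<circ> f) \<in> m \<Otimes>\<^sub>M m' \<rightarrow>\<^sub>M \<D>" by (simp add: split_beta')
qed

lemma comp_left_measurable: "f \<in> Diff1 A \<Longrightarrow> (\<lambda>h. f \<circ> h) \<in> \<D> \<rightarrow>\<^sub>M \<D>"
  using measurable_compose[OF measurable_Pair1'[of f \<D> \<D>] comp_measurable] by simp

lemma comp_right_measurable: "f \<in> Diff1 A \<Longrightarrow> (\<lambda>h. h \<circ> f) \<in> \<D> \<rightarrow>\<^sub>M \<D>"
  using measurable_compose[OF measurable_Pair2'[of f \<D> \<D>] comp_measurable] by simp

lemma measurable_\<D>: "sets m = sets \<D> \<Longrightarrow> F \<in> borel_measurable \<D> \<Longrightarrow> F \<in> borel_measurable m"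
  using measurable_cong_sets by blast

lemma sets_conv_power [simp]: "sets (conv_power A m n) = sets \<D>"
  by (cases n) auto

lemma space_conv_power [simp]: "space (conv_power A m n) = Diff1 A"
  using sets_eq_imp_space_eq[OF sets_conv_power] by simp

lemma prob_space_conv_power:
  assumes "prob_space m" "sets m = sets \<D>"
  shows "prob_space (conv_power A m n)"
proof (induction n)
  case 0
  show ?case using prob_space_return[of id \<D>] id_in_Diff1 by simp
next
  case (Suc n)
  interpret P1: prob_space m by fact
  interpret P2: prob_space "conv_power A m n" by fact
  interpret pair_prob_space m "conv_power A m n" ..
  have "prob_space (m \<Otimes>\<^sub>M conv_power A m n)" by (rule P.prob_space_axioms)
  from prob_space.prob_space_distr[OF this comp_measurable_sets(1)[OF assms(2) sets_conv_power]]
  show ?case by simp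
qed

lemma nn_integral_conv_power_Suc:
  assumes "prob_space m" "sets m = sets \<D>" and F: "F \<in> borel_measurable \<D>"
  shows "(\<integral>\<^sup>+ k. F k \<partial>conv_power A m (Suc n)) = (\<integral>\<^sup>+ f. \<integral>\<^sup>+ h. F (f \<circ> h) \<partial>conv_power A m n \<partial>m)"
proof -
  interpret P1: prob_space m by fact
  interpret P2: prob_space "conv_power A m n" by (rule prob_space_conv_power) fact+
  note c = comp_measurable_sets(1)[OF assms(2) sets_conv_power]
  have "(\<integral>\<^sup>+ k. F k \<partial>conv_power A m (Suc n)) = (\<integral>\<^sup>+ p. F (fst p \<circ> snd p) \<partial>(m \<Otimes>\<^sub>M conv_power A m n))"
    using F c by (simp add: nn_integral_distr split_beta')
  also have "\<dots> = (\<integral>\<^sup>+ f. \<integral>\<^sup>+ h. F (f \<circ> h) \<partial>conv_power A m n \<partial>m)"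
    using P2.nn_integral_fst[of "\<lambda>p. F (fst p \<circ> snd p)" m] measurable_compose[OF c F]
    by (simp add: split_beta')
  finally show ?thesis .
qed

lemma conv_power_1:
  assumes "prob_space m" "sets m = sets \<D>"
  shows "conv_power A m 1 = m"
proof (rule measure_eqI)
  show "sets (conv_power A m 1) = sets m" using assms by simp
  fix X assume "X \<in> sets (conv_power A m 1)"
  then have X: "X \<in> sets \<D>" by simp
  have "emeasure (conv_power A m 1) X = (\<integral>\<^sup>+ k. indicator X k \<partial>conv_power A m (Suc 0))"
    using X by (simp only: One_nat_def sets_conv_power nn_integral_indicator)
  also have "\<dots> = (\<integral>\<^sup>+ f. \<integral>\<^sup>+ h. indicator X (f \<circ> h) \<partial>conv_power A m 0 \<partial>m)"
    using assms X by (intro nn_integral_conv_power_Suc) auto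
  also have "\<dots> = (\<integral>\<^sup>+ f. indicator X f \<partial>m)"
  proof (rule nn_integral_cong)
    fix f assume "f \<in> space m"
    then have f: "f \<in> Diff1 A" using sets_eq_imp_space_eq[OF assms(2)] by simp
    have "(\<lambda>h. indicator X (f \<circ> h) :: ennreal) \<in> borel_measurable \<D>"
      using measurable_compose[OF comp_left_measurable[OF f] borel_measurable_indicator[OF X]] .
    then show "(\<integral>\<^sup>+ h. indicator X (f \<circ> h) \<partial>conv_power A m 0) = (indicator X f :: ennreal)"
      using id_in_Diff1 by (simp add: nn_integral_return)
  qed
  also have "\<dots> = emeasure m X" using X assms by simp
  finally show "emeasure (conv_power A m 1) X = emeasure m X" .
qed

text \<open>
  Convolution powers add the new factor on the left, as the last step of the walk. Associativity and
  Fubini move it to the right, where it is the first step.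
\<close>

lemma nn_integral_conv_power_Suc_right:
  assumes "prob_space m" "sets m = sets \<D>" and F: "F \<in> borel_measurable \<D>"
  shows "(\<integral>\<^sup>+ k. F k \<partial>conv_power A m (Suc n)) = (\<integral>\<^sup>+ f. \<integral>\<^sup>+ h. F (h \<circ> f) \<partial>conv_power A m n \<partial>m)"
  using F
proof (induction n arbitrary: F)
  case 0
  have "(\<integral>\<^sup>+ h. F (h \<circ> f) \<partial>conv_power A m 0) = F f" if f: "f \<in> space m" for f
  proof -
    have f: "f \<in> Diff1 A" using that sets_eq_imp_space_eq[OF assms(2)] by simp
    have "(\<lambda>h. F (h \<circ> f)) \<in> borel_measurable \<D>"
      by (rule measurable_compose[OF comp_right_measurable[OF f] 0])
    then show ?thesis
      unfolding conv_power.simps by (subst nn_integral_return) (simp_all add: id_in_Diff1)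
  qed
  then have eq: "(\<integral>\<^sup>+ f. \<integral>\<^sup>+ h. F (h \<circ> f) \<partial>conv_power A m 0 \<partial>m) = (\<integral>\<^sup>+ f. F f \<partial>m)"
    by (rule nn_integral_cong)
  show ?case unfolding eq conv_power_1[OF assms(1,2), unfolded One_nat_def] ..
next
  case (Suc n)
  let ?c = "conv_power A m n" and ?c' = "conv_power A m (Suc n)"
  interpret P1: prob_space m by fact
  interpret P2: prob_space ?c by (rule prob_space_conv_power) fact+
  interpret P3: prob_space ?c' by (rule prob_space_conv_power) fact+
  interpret PP: pair_sigma_finite m m ..
  have sp: "space m = Diff1 A" using sets_eq_imp_space_eq[OF assms(2)] by simp
  have Fl: "(\<lambda>k. F (f \<circ> k)) \<in> borel_measurable \<D>" if "f \<in> Diff1 A" for f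
    by (rule measurable_compose[OF comp_left_measurable[OF that] Suc.prems])
  have Fr: "(\<lambda>k. F (k \<circ> f)) \<in> borel_measurable \<D>" if "f \<in> Diff1 A" for f
    by (rule measurable_compose[OF comp_right_measurable[OF that] Suc.prems])
  have "(\<integral>\<^sup>+ k. F k \<partial>conv_power A m (Suc (Suc n))) = (\<integral>\<^sup>+ f. \<integral>\<^sup>+ k. F (f \<circ> k) \<partial>?c' \<partial>m)"
    by (rule nn_integral_conv_power_Suc[OF assms(1,2) Suc.prems])
  also have "\<dots> = (\<integral>\<^sup>+ f. \<integral>\<^sup>+ f'. \<integral>\<^sup>+ h. F (f \<circ> (h \<circ> f')) \<partial>?c \<partial>m \<partial>m)"
    using sp by (intro nn_integral_cong Suc.IH Fl) auto
  also have "\<dots> = (\<integral>\<^sup>+ f'. \<integral>\<^sup>+ f. \<integral>\<^sup>+ h. F (f \<circ> (h \<circ> f')) \<partial>?c \<partial>m \<partial>m)"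
  proof (rule PP.Fubini')
    have c1: "(\<lambda>p. snd p \<circ> fst (fst p)) \<in> (m \<Otimes>\<^sub>M m) \<Otimes>\<^sub>M ?c \<rightarrow>\<^sub>M \<D>"
      using measurable_compose[OF measurable_Pair[OF measurable_compose[OF measurable_fst measurable_fst] measurable_snd]
          comp_measurable_sets(2)[OF assms(2) sets_conv_power]] by simp
    then have c2: "(\<lambda>p. snd p \<circ> fst (fst p)) \<in> (m \<Otimes>\<^sub>M m) \<Otimes>\<^sub>M ?c \<rightarrow>\<^sub>M m"
      using measurable_cong_sets[OF refl assms(2)] by blast
    have "(\<lambda>p. snd (fst p) \<circ> (snd p \<circ> fst (fst p))) \<in> (m \<Otimes>\<^sub>M m) \<Otimes>\<^sub>M ?c \<rightarrow>\<^sub>M \<D>"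
      using measurable_compose[OF measurable_Pair[OF measurable_compose[OF measurable_fst measurable_snd] c2]
          comp_measurable_sets(1)[OF assms(2) assms(2)]] by simp
    from measurable_compose[OF this Suc.prems]
    have "(\<lambda>(p, h). F (snd p \<circ> (h \<circ> fst p))) \<in> borel_measurable ((m \<Otimes>\<^sub>M m) \<Otimes>\<^sub>M ?c)"
      by (simp add: split_beta' comp_def)
    from P2.borel_measurable_nn_integral[OF this]
    show "(\<lambda>(f', f). \<integral>\<^sup>+ h. F (f \<circ> (h \<circ> f')) \<partial>?c) \<in> borel_measurable (m \<Otimes>\<^sub>M m)"
      by (simp add: split_beta')
  qed
  also have "\<dots> = (\<integral>\<^sup>+ f'. \<integral>\<^sup>+ k. F (k \<circ> f') \<partial>?c' \<partial>m)"
  proof (rule nn_integral_cong)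
    fix f' assume "f' \<in> space m"
    then have "f' \<in> Diff1 A" using sp by simp
    from nn_integral_conv_power_Suc[OF assms(1,2) Fr[OF this]]
    show "(\<integral>\<^sup>+ f. \<integral>\<^sup>+ h. F (f \<circ> (h \<circ> f')) \<partial>?c \<partial>m) = (\<integral>\<^sup>+ k. F (k \<circ> f') \<partial>?c')"
      by (simp only: comp_assoc)
  qed
  finally show ?case .
qed

lemma conv_power_Suc_right:
  assumes "prob_space m" "sets m = sets \<D>"
  shows "conv_power A m (Suc n) = distr (m \<Otimes>\<^sub>M conv_power A m n) \<D> (\<lambda>(f, h). h \<circ> f)"
proof (rule measure_eqI)
  fix X assume "X \<in> sets (conv_power A m (Suc n))"
  then have X: "X \<in> sets \<D>" by simp
  interpret P2: prob_space "conv_power A m n" by (rule prob_space_conv_power) fact+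
  note c = comp_measurable_sets(2)[OF assms(2) sets_conv_power[of m n]]
  have I: "indicator X \<in> borel_measurable \<D>" using X by simp
  have "emeasure (conv_power A m (Suc n)) X = (\<integral>\<^sup>+ k. indicator X k \<partial>conv_power A m (Suc n))"
    using X by (simp only: sets_conv_power nn_integral_indicator)
  also have "\<dots> = (\<integral>\<^sup>+ f. \<integral>\<^sup>+ h. indicator X (h \<circ> f) \<partial>conv_power A m n \<partial>m)"
    using assms X by (intro nn_integral_conv_power_Suc_right) auto
  also have "\<dots> = (\<integral>\<^sup>+ p. indicator X (snd p \<circ> fst p) \<partial>(m \<Otimes>\<^sub>M conv_power A m n))"
    using P2.nn_integral_fst[of "\<lambda>p. indicator X (snd p \<circ> fst p)" m] measurable_compose[OF c I]
    by (simp add: split_beta')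
  also have "\<dots> = (\<integral>\<^sup>+ k. indicator X k \<partial>distr (m \<Otimes>\<^sub>M conv_power A m n) \<D> (\<lambda>(f, h). h \<circ> f))"
    by (subst nn_integral_distr[OF c]) (use I in \<open>simp_all add: split_beta'\<close>)
  also have "\<dots> = emeasure (distr (m \<Otimes>\<^sub>M conv_power A m n) \<D> (\<lambda>(f, h). h \<circ> f)) X"
    using X by simp
  finally show "emeasure (conv_power A m (Suc n)) X = emeasure (distr (m \<Otimes>\<^sub>M conv_power A m n) \<D> (\<lambda>(f, h). h \<circ> f)) X" .
qed simp

lemma log_integrable_conv_power:
  assumes "log_integrable m"
  shows "log_integrable (conv_power A m n)"
proof (induction n)
  case 0
  have "integrable (return \<D> id) log_distortion"
    using id_in_Diff1
    by (intro integrableI_bounded) (simp_all add: nn_integral_return measurable_log_distortion)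
  then show ?case
    using prob_space_conv_power[OF log_integrableD(1,2)[OF assms], of 0] by (simp add: log_integrable_def)
next
  case (Suc n)
  note m = log_integrableD[OF assms] and c = log_integrableD[OF Suc]
  interpret P1: prob_space m by (rule m(1))
  interpret P2: prob_space "conv_power A m n" by (rule c(1))
  have L1: "(\<integral>\<^sup>+ f. ennreal (log_distortion f) \<partial>m) < \<infinity>" "(\<integral>\<^sup>+ f. ennreal (log_distortion f) \<partial>conv_power A m n) < \<infinity>"
  proof -
    have "(\<integral>\<^sup>+ f. ennreal (log_distortion f) \<partial>m) = (\<integral>\<^sup>+ f. ennreal (norm (log_distortion f)) \<partial>m)"
      "(\<integral>\<^sup>+ f. ennreal (log_distortion f) \<partial>conv_power A m n) = (\<integral>\<^sup>+ f. ennreal (norm (log_distortion f)) \<partial>conv_power A m n)"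
      using m(4) log_distortion_nonneg by (auto intro!: nn_integral_cong)
    then show "(\<integral>\<^sup>+ f. ennreal (log_distortion f) \<partial>m) < \<infinity>"
      "(\<integral>\<^sup>+ f. ennreal (log_distortion f) \<partial>conv_power A m n) < \<infinity>"
      using m(3) c(3) by (simp_all only: integrable_iff_bounded)
  qed
  have "(\<integral>\<^sup>+ k. ennreal (log_distortion k) \<partial>conv_power A m (Suc n)) =
     (\<integral>\<^sup>+ f. \<integral>\<^sup>+ h. ennreal (log_distortion (f \<circ> h)) \<partial>conv_power A m n \<partial>m)"
    by (intro nn_integral_conv_power_Suc m) simp
  also have "\<dots> \<le> (\<integral>\<^sup>+ f. \<integral>\<^sup>+ h. ennreal (log_distortion f) + ennreal (log_distortion h) \<partial>conv_power A m n \<partial>m)"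
    using m(4) log_distortion_comp log_distortion_nonneg
    by (intro nn_integral_mono) (simp add: ennreal_plus[symmetric] del: ennreal_plus)
  also have "\<dots> = (\<integral>\<^sup>+ f. ennreal (log_distortion f) + (\<integral>\<^sup>+ h. ennreal (log_distortion h) \<partial>conv_power A m n) \<partial>m)"
    by (intro nn_integral_cong, subst nn_integral_add)
       (auto simp: P2.emeasure_space_1[unfolded space_conv_power] measurable_\<D>[OF sets_conv_power] measurable_log_distortion)
  also have "\<dots> = (\<integral>\<^sup>+ f. ennreal (log_distortion f) \<partial>m) + (\<integral>\<^sup>+ h. ennreal (log_distortion h) \<partial>conv_power A m n)"
    by (subst nn_integral_add)
       (auto simp: P1.emeasure_space_1 measurable_\<D>[OF m(2)] measurable_log_distortion)
  also have "\<dots> < \<infinity>" using L1 by simp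
  finally have fin: "(\<integral>\<^sup>+ k. ennreal (log_distortion k) \<partial>conv_power A m (Suc n)) < \<infinity>" .
  have "(\<integral>\<^sup>+ k. ennreal (norm (log_distortion k)) \<partial>conv_power A m (Suc n)) =
      (\<integral>\<^sup>+ k. ennreal (log_distortion k) \<partial>conv_power A m (Suc n))"
    using log_distortion_nonneg by (intro nn_integral_cong) (simp del: conv_power.simps)
  then have "integrable (conv_power A m (Suc n)) log_distortion"
    using fin measurable_\<D>[OF sets_conv_power measurable_log_distortion] by (intro integrableI_bounded) simp_all
  then show ?case
    using prob_space_conv_power[OF m(1,2), of "Suc n"] by (simp add: log_integrable_def del: conv_power.simps)
qed

lemma integrable_dominated:
  assumes m: "log_integrable m" and F: "F \<in> borel_measurable \<D>"
    and b: "\<And>f. f \<in> Diff1 A \<Longrightarrow> \<bar>F f\<bar> \<le> b + log_distortion f"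
  shows "integrable m F"
proof -
  note m' = log_integrableD[OF m]
  interpret prob_space m by (rule m')
  have "integrable m (\<lambda>f. b + log_distortion f)" using m'(3) by simp
  then show ?thesis
  proof (rule Bochner_Integration.integrable_bound)
    show "AE f in m. norm (F f) \<le> norm (b + log_distortion f)"
      using b m'(4) by (intro AE_I2) fastforce
  qed (rule measurable_\<D>[OF m'(2) F])
qed

lemma
  assumes m: "log_integrable m" and F: "F \<in> borel_measurable \<D>"
    and b: "\<And>f. f \<in> Diff1 A \<Longrightarrow> \<bar>F f\<bar> \<le> b + log_distortion f"
  shows integral_conv_power_Suc:
      "(\<integral>k. F k \<partial>conv_power A m (Suc n)) = (\<integral>h. \<integral>f. F (f \<circ> h) \<partial>m \<partial>conv_power A m n)"
    and integrable_conv_power_Suc: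
      "integrable (conv_power A m n) (\<lambda>h. \<integral>f. F (f \<circ> h) \<partial>m)"
    and integral_conv_power_Suc_right:
      "(\<integral>k. F k \<partial>conv_power A m (Suc n)) = (\<integral>f. \<integral>h. F (h \<circ> f) \<partial>conv_power A m n \<partial>m)"
    and integrable_conv_power_Suc_right:
      "integrable m (\<lambda>f. \<integral>h. F (h \<circ> f) \<partial>conv_power A m n)"
proof -
  note m' = log_integrableD[OF m]
  interpret P1: prob_space m by (rule m')
  interpret P2: prob_space "conv_power A m n" by (rule prob_space_conv_power[OF m'(1,2)])
  interpret PP: pair_sigma_finite m "conv_power A m n" ..
  have int: "integrable (conv_power A m (Suc n)) F"
    by (rule integrable_dominated[OF log_integrable_conv_power[OF m] F b])
  note c = comp_measurable_sets[OF m'(2) sets_conv_power[of m n]]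
  have i1: "integrable (m \<Otimes>\<^sub>M conv_power A m n) (\<lambda>(f, h). F (f \<circ> h))"
    using int integrable_distr_eq[OF c(1) F] by (simp add: split_beta')
  have i2: "integrable (m \<Otimes>\<^sub>M conv_power A m n) (\<lambda>(f, h). F (h \<circ> f))"
    using int integrable_distr_eq[OF c(2) F] unfolding conv_power_Suc_right[OF m'(1,2)] by (simp add: split_beta')
  show "(\<integral>k. F k \<partial>conv_power A m (Suc n)) = (\<integral>h. \<integral>f. F (f \<circ> h) \<partial>m \<partial>conv_power A m n)"
    using PP.integral_snd[OF i1] integral_distr[OF c(1) F] by (simp add: split_beta')
  show "integrable (conv_power A m n) (\<lambda>h. \<integral>f. F (f \<circ> h) \<partial>m)"
    by (rule PP.integrable_snd[OF i1])
  show "(\<integral>k. F k \<partial>conv_power A m (Suc n)) = (\<integral>f. \<integral>h. F (h \<circ> f) \<partial>conv_power A m n \<partial>m)"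
    unfolding conv_power_Suc_right[OF m'(1,2)]
    using PP.integral_fst[OF i2] integral_distr[OF c(2) F] by (simp add: split_beta')
  show "integrable m (\<lambda>f. \<integral>h. F (h \<circ> f) \<partial>conv_power A m n)"
    by (rule PP.integrable_fst[OF i2])
qed

lemma AE_conv_power:
  assumes m: "prob_space m" "sets m = sets \<D>" and G: "G \<in> sets \<D>" "\<And>f h. f \<in> G \<Longrightarrow> h \<in> G \<Longrightarrow> f \<circ> h \<in> G"
    and AE: "AE f in m. f \<in> G" and n: "n \<ge> 1"
  shows "AE f in conv_power A m n. f \<in> G"
  using n
proof (induction n rule: dec_induct)
  case base
  show ?case unfolding conv_power_1[OF m] by (rule AE)
next
  case (step n)
  interpret P1: prob_space m by (rule m(1))
  interpret P2: prob_space "conv_power A m n" by (rule prob_space_conv_power[OF m])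
  interpret PP: pair_sigma_finite m "conv_power A m n" ..
  have AE: "AE p in m \<Otimes>\<^sub>M conv_power A m n. fst p \<circ> snd p \<in> G"
  proof (rule PP.AE_pair_measure)
    have "(\<lambda>p. fst p \<circ> snd p) \<in> m \<Otimes>\<^sub>M conv_power A m n \<rightarrow>\<^sub>M \<D>"
      using comp_measurable_sets(1)[OF m(2) sets_conv_power[of m n]] by (simp add: split_beta')
    from measurable_sets[OF this G(1)]
    show "{p \<in> space (m \<Otimes>\<^sub>M conv_power A m n). fst p \<circ> snd p \<in> G} \<in> sets (m \<Otimes>\<^sub>M conv_power A m n)"
      by (simp add: vimage_def Int_def conj_commute)
    show "AE f in m. AE h in conv_power A m n. fst (f, h) \<circ> snd (f, h) \<in> G"
      using AE
    proof eventually_elim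
      fix f assume f: "f \<in> G"
      show "AE h in conv_power A m n. fst (f, h) \<circ> snd (f, h) \<in> G"
        using step.IH by eventually_elim (simp add: G f)
    qed
  qed
  have eq: "{f \<in> space \<D>. f \<in> G} = G" using sets.sets_into_space[OF G(1)] by blast
  show ?case
    unfolding conv_power.simps
    by (subst AE_distr_iff[OF comp_measurable_sets(1)[OF m(2) sets_conv_power[of m n]]])
       (use AE G(1) eq in \<open>simp_all add: split_beta'\<close>)
qed

text \<open>
  The state space is abstract because the lemma serves both for tangent vectors and for pairs of a
  tangent vector and a point of a finite set. On the latter only the semigroup \<open>G\<close> acts, whence
  the restriction of the action laws to \<open>G\<close>, and \<open>n \<ge> 1\<close>: the identity may lie outside \<open>G\<close>.
\<close>

lemma drift_iterate:
  fixes T :: "('m \<Rightarrow> 'm) \<Rightarrow> 's \<Rightarrow> 's" and W :: "'s \<Rightarrow> real"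
  assumes m: "log_integrable m" and G: "G \<in> sets \<D>" "\<And>f h. f \<in> G \<Longrightarrow> h \<in> G \<Longrightarrow> f \<circ> h \<in> G" "AE f in m. f \<in> G"
    and T: "\<And>f s. f \<in> G \<Longrightarrow> s \<in> \<Sigma> \<Longrightarrow> T f s \<in> \<Sigma>"
      "\<And>f h s. f \<in> G \<Longrightarrow> h \<in> G \<Longrightarrow> s \<in> \<Sigma> \<Longrightarrow> T (f \<circ> h) s = T f (T h s)"
    and W: "\<And>s. s \<in> \<Sigma> \<Longrightarrow> (\<lambda>f. W (T f s)) \<in> borel_measurable \<D>"
    and b: "\<And>f s. f \<in> Diff1 A \<Longrightarrow> s \<in> \<Sigma> \<Longrightarrow> \<bar>W (T f s)\<bar> \<le> b s + log_distortion f"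
    and drift: "\<And>s. s \<in> \<Sigma> \<Longrightarrow> W s + \<epsilon> \<le> (\<integral>f. W (T f s) \<partial>m)"
    and n: "n \<ge> 1" and s: "s \<in> \<Sigma>"
  shows "W s + real n * \<epsilon> \<le> (\<integral>f. W (T f s) \<partial>conv_power A m n)"
  using n
proof (induction n rule: dec_induct)
  case base
  show ?case using drift[OF s] conv_power_1[OF log_integrableD(1,2)[OF m]] by simp
next
  case (step n)
  note m' = log_integrableD[OF m]
  interpret P2: prob_space "conv_power A m n" by (rule prob_space_conv_power[OF m'(1,2)])
  have iW: "integrable (conv_power A m n) (\<lambda>h. W (T h s))"
    by (rule integrable_dominated[OF log_integrable_conv_power[OF m] W[OF s] b[OF _ s]])
  have "W s + real (Suc n) * \<epsilon> \<le> (\<integral>h. W (T h s) \<partial>conv_power A m n) + \<epsilon>"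
    using step.IH by (simp add: algebra_simps)
  also have "\<dots> = (\<integral>h. W (T h s) + \<epsilon> \<partial>conv_power A m n)"
    using iW by (simp add: P2.prob_space[unfolded space_conv_power])
  also have "\<dots> \<le> (\<integral>h. \<integral>f. W (T (f \<circ> h) s) \<partial>m \<partial>conv_power A m n)"
  proof (rule integral_mono_AE)
    show "integrable (conv_power A m n) (\<lambda>h. \<integral>f. W (T (f \<circ> h) s) \<partial>m)"
      by (rule integrable_conv_power_Suc[OF m W[OF s] b[OF _ s]])
    show "integrable (conv_power A m n) (\<lambda>h. W (T h s) + \<epsilon>)" using iW by simp
    have AE: "AE h in conv_power A m n. h \<in> G"
      by (rule AE_conv_power[OF m'(1,2) G(1) _ G(3) step.hyps(1)]) (rule G(2))
    have G_sub: "G \<subseteq> Diff1 A" using sets.sets_into_space[OF G(1)] by simp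
    show "AE h in conv_power A m n. W (T h s) + \<epsilon> \<le> (\<integral>f. W (T (f \<circ> h) s) \<partial>m)"
      using AE
    proof eventually_elim
      fix h assume h: "h \<in> G"
      have "h \<in> Diff1 A" using h G_sub by blast
      from measurable_\<D>[OF m'(2) measurable_compose[OF comp_right_measurable[OF this] W[OF s]]]
      have 1: "(\<lambda>f. W (T (f \<circ> h) s)) \<in> borel_measurable m" .
      have 2: "(\<lambda>f. W (T f (T h s))) \<in> borel_measurable m"
        by (rule measurable_\<D>[OF m'(2) W[OF T(1)[OF h s]]])
      have "AE f in m. W (T (f \<circ> h) s) = W (T f (T h s))"
        using G(3) by eventually_elim (simp add: T(2) h s)
      from integral_cong_AE[OF 1 2 this]
      have "(\<integral>f. W (T (f \<circ> h) s) \<partial>m) = (\<integral>f. W (T f (T h s)) \<partial>m)" .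
      then show "W (T h s) + \<epsilon> \<le> (\<integral>f. W (T (f \<circ> h) s) \<partial>m)"
        using drift[OF T(1)[OF h s]] by simp
    qed
  qed
  also have "\<dots> = (\<integral>f. W (T f s) \<partial>conv_power A m (Suc n))"
    by (rule integral_conv_power_Suc[OF m W[OF s] b[OF _ s], symmetric])
  finally show ?case .
qed

text \<open>
  Uniform expansion in terms of the log norm of arbitrary nonzero vectors, which unlike unit vectors
  are permuted by the tangent maps.
\<close>

definition expanding :: "('m \<Rightarrow> 'm) measure \<Rightarrow> bool" where
  "expanding m \<longleftrightarrow> (\<exists>c>0. \<exists>n\<ge>1. \<forall>q\<in>nonzero_tangents.
     log_norm q + c \<le> (\<integral>f. log_norm (Tmap A f q) \<partial>conv_power A m n))"

lemma log_norm_Tmap_abs: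
  "f \<in> Diff1 A \<Longrightarrow> q \<in> nonzero_tangents \<Longrightarrow> \<bar>log_norm (Tmap A f q)\<bar> \<le> \<bar>log_norm q\<bar> + log_distortion f"
  using log_distortion_upper[of f q] by linarith

lemma integrable_log_norm_Tmap:
  assumes "log_integrable m" "q \<in> nonzero_tangents"
  shows "integrable m (\<lambda>f. log_norm (Tmap A f q))"
  by (rule integrable_dominated[OF assms(1) measurable_log_norm_Tmap log_norm_Tmap_abs[OF _ assms(2)]])

lemma uniformly_expanding_iff:
  assumes m: "log_integrable m"
  shows "uniformly_expanding A g m \<longleftrightarrow> expanding m"
proof -
  have eq: "ln (tnorm g (f x) (tangent_map A f x v)) = log_norm (Tmap A f (x, v))" for f x v
    by (simp add: log_norm_def tangent_norm_def Tmap_def)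
  have "(\<forall>x v. tnorm g x v = 1 \<longrightarrow> (\<integral>f. ln (tnorm g (f x) (tangent_map A f x v)) \<partial>conv_power A m n) \<ge> c) \<longleftrightarrow>
    (\<forall>q\<in>nonzero_tangents. log_norm q + c \<le> (\<integral>f. log_norm (Tmap A f q) \<partial>conv_power A m n))" for c n
  proof (intro iffI ballI allI impI)
    fix x v assume R: "\<forall>q\<in>nonzero_tangents. log_norm q + c \<le> (\<integral>f. log_norm (Tmap A f q) \<partial>conv_power A m n)"
      and u: "tnorm g x v = 1"
    have "tangent_norm (x, v) = 1" using u by (simp add: tangent_norm_def)
    then have "(x, v) \<in> nonzero_tangents" "log_norm (x, v) = 0"
      using tangent_norm_pos[of "(x, v)"] by (auto simp: nonzero_tangents_def log_norm_def)
    then show "(\<integral>f. ln (tnorm g (f x) (tangent_map A f x v)) \<partial>conv_power A m n) \<ge> c"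
      unfolding eq using R by fastforce
  next
    fix q assume L: "\<forall>x v. tnorm g x v = 1 \<longrightarrow> (\<integral>f. ln (tnorm g (f x) (tangent_map A f x v)) \<partial>conv_power A m n) \<ge> c"
      and q: "q \<in> nonzero_tangents"
    interpret prob_space "conv_power A m n" by (rule prob_space_conv_power[OF log_integrableD(1,2)[OF m]])
    have q0: "snd q \<noteq> 0" using q by (simp add: nonzero_tangents_def)
    define q1 where "q1 = (fst q, (1 / tangent_norm q) *\<^sub>R snd q)"
    have u: "tangent_norm q1 = 1"
      using normalized_tangent(1)[OF q0 C1_map_id] by (simp add: q1_def)
    have q1: "q1 \<in> nonzero_tangents" using u tangent_norm_pos[of q1] by (simp add: nonzero_tangents_def)
    have "log_norm (Tmap A f q) = log_norm q + log_norm (Tmap A f q1)" if f: "f \<in> Diff1 A" for f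
    proof -
      have "tangent_norm q > 0" "tangent_norm (Tmap A f q1) > 0"
        using q0 Tmap_nonzero[OF f q1] tangent_norm_pos by (auto simp: nonzero_tangents_def)
      then show ?thesis
        using normalized_tangent(2)[OF q0 Diff1_C1_map[OF f]] by (simp add: log_norm_def q1_def ln_mult_pos)
    qed
    then have "(\<integral>f. log_norm (Tmap A f q) \<partial>conv_power A m n) =
        (\<integral>f. log_norm q + log_norm (Tmap A f q1) \<partial>conv_power A m n)"
      by (intro Bochner_Integration.integral_cong) auto
    also have "\<dots> = log_norm q + (\<integral>f. log_norm (Tmap A f q1) \<partial>conv_power A m n)"
      using integrable_log_norm_Tmap[OF log_integrable_conv_power[OF m] q1] by (simp add: prob_space[unfolded space_conv_power])
    finally have "(\<integral>f. log_norm (Tmap A f q) \<partial>conv_power A m n) =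
        log_norm q + (\<integral>f. log_norm (Tmap A f q1) \<partial>conv_power A m n)" .
    moreover have "(\<integral>f. log_norm (Tmap A f q1) \<partial>conv_power A m n) \<ge> c"
      using L[rule_format, of "fst q1" "snd q1"] u unfolding eq by (simp add: tangent_norm_def)
    ultimately show "log_norm q + c \<le> (\<integral>f. log_norm (Tmap A f q) \<partial>conv_power A m n)" by linarith
  qed
  then show ?thesis
    by (simp add: uniformly_expanding_def expanding_def)
qed

text \<open>
  Bounded errors are absorbed by taking \<open>n\<close> large.
\<close>

lemma expanding_of_linear_growth:
  assumes m: "log_integrable m" and \<epsilon>: "\<epsilon> > 0"
    and F: "\<And>q. q \<in> nonzero_tangents \<Longrightarrow> F q \<in> borel_measurable \<D>"
    and B: "\<And>q. q \<in> nonzero_tangents \<Longrightarrow> \<bar>c q - log_norm q\<bar> \<le> B"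
      "\<And>q f. q \<in> nonzero_tangents \<Longrightarrow> f \<in> Diff1 A \<Longrightarrow> \<bar>F q f - log_norm (Tmap A f q)\<bar> \<le> B"
    and growth: "\<And>q n. q \<in> nonzero_tangents \<Longrightarrow> n \<ge> 1 \<Longrightarrow> c q + real n * \<epsilon> \<le> (\<integral>f. F q f \<partial>conv_power A m n)"
  shows "expanding m"
proof -
  obtain n :: nat where n: "(2 * B + 1) / \<epsilon> < real n" using reals_Archimedean2 by blast
  have "2 * B + 1 < real n * \<epsilon>" using n \<epsilon> by (simp add: pos_divide_less_eq)
  also have "\<dots> \<le> real (Suc n) * \<epsilon>" using \<epsilon> by simp
  finally have n': "2 * B + 1 < real (Suc n) * \<epsilon>" .
  let ?c = "conv_power A m (Suc n)"
  interpret prob_space ?c by (rule prob_space_conv_power[OF log_integrableD(1,2)[OF m]])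
  have "log_norm q + 1 \<le> (\<integral>f. log_norm (Tmap A f q) \<partial>?c)" if q: "q \<in> nonzero_tangents" for q
  proof -
    have iF: "integrable ?c (F q)"
      by (rule integrable_dominated[OF log_integrable_conv_power[OF m] F[OF q], of "B + \<bar>log_norm q\<bar>"])
         (use B(2)[OF q] log_norm_Tmap_abs[OF _ q] in \<open>fastforce simp: abs_le_iff\<close>)
    note iL = integrable_log_norm_Tmap[OF log_integrable_conv_power[OF m, of "Suc n"] q]
    have "(\<integral>f. F q f \<partial>?c) \<le> (\<integral>f. log_norm (Tmap A f q) + B \<partial>?c)"
    proof (rule integral_mono[OF iF])
      show "integrable ?c (\<lambda>f. log_norm (Tmap A f q) + B)" using iL by (simp del: conv_power.simps)
      fix f assume "f \<in> space ?c"
      then have "f \<in> Diff1 A" by (simp only: space_conv_power)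
      from B(2)[OF q this] show "F q f \<le> log_norm (Tmap A f q) + B" by linarith
    qed
    also have "\<dots> = (\<integral>f. log_norm (Tmap A f q) \<partial>?c) + B" using iL by (simp add: prob_space[unfolded space_conv_power] del: conv_power.simps)
    finally have "c q + real (Suc n) * \<epsilon> \<le> (\<integral>f. log_norm (Tmap A f q) \<partial>?c) + B"
      using growth[OF q, of "Suc n"] by linarith
    then show ?thesis using n' B(1)[OF q] by linarith
  qed
  then show ?thesis unfolding expanding_def by (intro exI[of _ 1] conjI exI[of _ "Suc n"]) auto
qed

definition lyapunov :: "('m \<Rightarrow> 'm) measure \<Rightarrow> ('m \<times> 'b \<Rightarrow> real) \<Rightarrow> bool" where
  "lyapunov m w \<longleftrightarrow>
     (\<exists>B. \<forall>q\<in>nonzero_tangents. \<bar>w q - log_norm q\<bar> \<le> B) \<and>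
     (\<forall>q\<in>nonzero_tangents. (\<lambda>f. w (Tmap A f q)) \<in> borel_measurable \<D>) \<and>
     (\<exists>\<epsilon>>0. \<forall>q\<in>nonzero_tangents. w q + \<epsilon> \<le> (\<integral>f. w (Tmap A f q) \<partial>m))"

lemma lyapunov_imp_expanding:
  assumes m: "log_integrable m" and w: "lyapunov m w"
  shows "expanding m"
proof -
  obtain B \<epsilon> where B: "\<And>q. q \<in> nonzero_tangents \<Longrightarrow> \<bar>w q - log_norm q\<bar> \<le> B"
    and wm: "\<And>q. q \<in> nonzero_tangents \<Longrightarrow> (\<lambda>f. w (Tmap A f q)) \<in> borel_measurable \<D>"
    and \<epsilon>: "\<epsilon> > 0" "\<And>q. q \<in> nonzero_tangents \<Longrightarrow> w q + \<epsilon> \<le> (\<integral>f. w (Tmap A f q) \<partial>m)"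
    using w unfolding lyapunov_def by blast
  have bd: "\<bar>w (Tmap A f q)\<bar> \<le> (B + \<bar>log_norm q\<bar>) + log_distortion f" if "f \<in> Diff1 A" "q \<in> nonzero_tangents" for f q
    using B[OF Tmap_nonzero[OF that]] log_norm_Tmap_abs[OF that] by linarith
  have D: "Diff1 A \<in> sets \<D>" using sets.top[of \<D>] by simp
  have AE: "AE f in m. f \<in> Diff1 A" using log_integrableD(4)[OF m] by (intro AE_I2) simp
  show ?thesis
  proof (rule expanding_of_linear_growth[OF m \<epsilon>(1) wm B])
    show "\<bar>w (Tmap A f q) - log_norm (Tmap A f q)\<bar> \<le> B" if "q \<in> nonzero_tangents" "f \<in> Diff1 A" for q f
      by (rule B[OF Tmap_nonzero[OF that(2,1)]])
    show "w q + real n * \<epsilon> \<le> (\<integral>f. w (Tmap A f q) \<partial>conv_power A m n)"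
      if "q \<in> nonzero_tangents" "n \<ge> 1" for q n
      by (rule drift_iterate[OF m D comp_in_Diff1 AE Tmap_nonzero Tmap_comp[OF Diff1_C1_map Diff1_C1_map] wm bd \<epsilon>(2) that(2,1)])
  qed
qed

text \<open>
  With \<open>a j q\<close> the expected log norm after \<open>j\<close> steps from \<open>q\<close>, one further first step turns \<open>a j\<close> into
  \<open>a (j + 1)\<close>. The mean of \<open>a 0, \<dots>, a (n - 1)\<close> thus increases by \<open>(a n - a 0) / n\<close>, and \<open>a 0\<close> is
  the log norm itself.
\<close>

lemma expanding_imp_lyapunov:
  assumes m: "log_integrable m" and e: "expanding m"
  shows "\<exists>w. lyapunov m w"
proof -
  note m' = log_integrableD[OF m]
  interpret P1: prob_space m by (rule m'(1))
  obtain c n where c: "c > 0" and n: "n \<ge> 1"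
    and cn: "\<And>q. q \<in> nonzero_tangents \<Longrightarrow> log_norm q + c \<le> (\<integral>f. log_norm (Tmap A f q) \<partial>conv_power A m n)"
    using e unfolding expanding_def by blast
  define a where "a j q = (\<integral>f. log_norm (Tmap A f q) \<partial>conv_power A m j)" for j q
  define w where "w q = (\<Sum>j<n. a j q) / real n" for q
  have a0: "a 0 q = log_norm q" if "q \<in> nonzero_tangents" for q
    using integral_return[OF _ measurable_log_norm_Tmap[of q], of id] id_in_Diff1 by (simp add: a_def)
  have aB: "\<bar>a j q - log_norm q\<bar> \<le> (\<integral>f. log_distortion f \<partial>conv_power A m j)" if q: "q \<in> nonzero_tangents" for j q
  proof -
    note cj = log_integrable_conv_power[OF m, of j]
    interpret prob_space "conv_power A m j" by (rule log_integrableD[OF cj])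
    note i = integrable_log_norm_Tmap[OF cj q]
    have "\<bar>a j q - log_norm q\<bar> = \<bar>\<integral>f. log_norm (Tmap A f q) - log_norm q \<partial>conv_power A m j\<bar>"
      using i by (simp add: a_def prob_space[unfolded space_conv_power])
    also have "\<dots> \<le> (\<integral>f. \<bar>log_norm (Tmap A f q) - log_norm q\<bar> \<partial>conv_power A m j)"
      by (rule integral_abs_bound)
    also have "\<dots> \<le> (\<integral>f. log_distortion f \<partial>conv_power A m j)"
      using i log_integrableD(3)[OF cj] log_distortion_upper[OF _ q] by (intro integral_mono) auto
    finally show ?thesis .
  qed
  have a_eq: "a j (Tmap A f q) = (\<integral>h. log_norm (Tmap A (h \<circ> f) q) \<partial>conv_power A m j)" if f: "f \<in> Diff1 A" for j f q
    unfolding a_def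
    by (rule Bochner_Integration.integral_cong) (simp_all add: Tmap_comp[OF Diff1_C1_map Diff1_C1_map[OF f]])
  have a_meas: "(\<lambda>f. a j (Tmap A f q)) \<in> borel_measurable \<D>" if q: "q \<in> nonzero_tangents" for j q
  proof -
    interpret P2: prob_space "conv_power A m j" by (rule prob_space_conv_power[OF m'(1,2)])
    have "(\<lambda>(f, h). log_norm (Tmap A (h \<circ> f) q)) \<in> borel_measurable (\<D> \<Otimes>\<^sub>M conv_power A m j)"
      using measurable_compose[OF comp_measurable_sets(2)[OF refl sets_conv_power] measurable_log_norm_Tmap]
      by (simp add: split_beta')
    from P2.borel_measurable_lebesgue_integral[OF this] show ?thesis
      by (rule measurable_cong[THEN iffD1, rotated]) (simp add: a_eq)
  qed
  have a_int: "(\<integral>f. a j (Tmap A f q) \<partial>m) = a (Suc j) q \<and> integrable m (\<lambda>f. a j (Tmap A f q))"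
    if q: "q \<in> nonzero_tangents" for j q
  proof
    have "(\<integral>f. a j (Tmap A f q) \<partial>m) = (\<integral>f. \<integral>h. log_norm (Tmap A (h \<circ> f) q) \<partial>conv_power A m j \<partial>m)"
      using m'(4) by (intro Bochner_Integration.integral_cong) (auto simp: a_eq)
    also have "\<dots> = a (Suc j) q"
      unfolding a_def
      by (rule integral_conv_power_Suc_right[OF m measurable_log_norm_Tmap log_norm_Tmap_abs[OF _ q], symmetric])
    finally show "(\<integral>f. a j (Tmap A f q) \<partial>m) = a (Suc j) q" .
    show "integrable m (\<lambda>f. a j (Tmap A f q))"
    proof (rule integrable_dominated[OF m a_meas[OF q]])
      fix f assume f: "f \<in> Diff1 A"
      show "\<bar>a j (Tmap A f q)\<bar> \<le> ((\<integral>f. log_distortion f \<partial>conv_power A m j) + \<bar>log_norm q\<bar>) + log_distortion f"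
        using aB[OF Tmap_nonzero[OF f q], of j] log_norm_Tmap_abs[OF f q] by linarith
    qed
  qed
  have "\<bar>w q - log_norm q\<bar> \<le> (\<Sum>j<n. \<integral>f. log_distortion f \<partial>conv_power A m j) / real n" if q: "q \<in> nonzero_tangents" for q
  proof -
    have "w q - log_norm q = (\<Sum>j<n. a j q - log_norm q) / real n"
      using n by (simp add: w_def sum_subtractf field_simps)
    also have "\<bar>\<dots>\<bar> \<le> (\<Sum>j<n. \<bar>a j q - log_norm q\<bar>) / real n"
      by (simp add: divide_right_mono sum_abs)
    also have "\<dots> \<le> (\<Sum>j<n. \<integral>f. log_distortion f \<partial>conv_power A m j) / real n"
      using aB[OF q] by (intro divide_right_mono sum_mono) auto
    finally show ?thesis .
  qed
  moreover have "(\<lambda>f. w (Tmap A f q)) \<in> borel_measurable \<D>" if "q \<in> nonzero_tangents" for q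
    unfolding w_def using a_meas[OF that] by (intro borel_measurable_divide borel_measurable_sum) auto
  moreover have "w q + c / real n \<le> (\<integral>f. w (Tmap A f q) \<partial>m)" if q: "q \<in> nonzero_tangents" for q
  proof -
    have "(\<integral>f. w (Tmap A f q) \<partial>m) = (\<Sum>j<n. a (Suc j) q) / real n"
      using a_int[OF q] by (simp add: w_def Bochner_Integration.integral_sum)
    also have "\<dots> = w q + (\<Sum>j<n. a (Suc j) q - a j q) / real n"
      by (simp add: w_def sum_subtractf diff_divide_distrib)
    also have "(\<Sum>j<n. a (Suc j) q - a j q) = a n q - log_norm q"
      using sum_lessThan_telescope[of "\<lambda>j. a j q" n] a0[OF q] by simp
    finally show ?thesis using cn[OF q] n by (simp add: a_def divide_right_mono)
  qed
  moreover have "c / real n > 0" using c n by simp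
  ultimately have "lyapunov m w" unfolding lyapunov_def by blast
  then show ?thesis by blast
qed

end

section \<open>First returns of a random walk acting on a finite set\<close>

lemma walk_case_nat: "walk (case_nat f \<omega>) (Suc n) = walk \<omega> n \<circ> f"
proof (induction n)
  case (Suc n)
  have "walk (case_nat f \<omega>) (Suc (Suc n)) = case_nat f \<omega> (Suc n) \<circ> walk (case_nat f \<omega>) (Suc n)"
    by (rule walk.simps(2))
  also have "\<dots> = \<omega> n \<circ> (walk \<omega> n \<circ> f)" by (simp only: Suc.IH nat.case)
  also have "\<dots> = walk \<omega> (Suc n) \<circ> f" by (simp only: walk.simps comp_assoc)
  finally show ?case .
qed simp

locale hitting_walk = riemannian_atlas A g
  for A :: "('m::t2_space, 'b::euclidean_space) chart set" and g +
  fixes \<nu> :: "('m \<Rightarrow> 'm) measure" and G :: "('m \<Rightarrow> 'm) set"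
    and F :: "'x::countable set" and act :: "('m \<Rightarrow> 'm) \<Rightarrow> 'x \<Rightarrow> 'x" and x0 :: 'x and t :: "'x \<Rightarrow> ennreal"
  assumes \<nu>: "log_integrable \<nu>"
    and G_sets: "G \<in> sets \<D>"
    and G_comp: "\<And>f h. f \<in> G \<Longrightarrow> h \<in> G \<Longrightarrow> f \<circ> h \<in> G"
    and AE_G: "AE f in \<nu>. f \<in> G"
    and finite_F: "finite F" and x0: "x0 \<in> F"
    and act_in: "\<And>f y. f \<in> Diff1 A \<Longrightarrow> y \<in> F \<Longrightarrow> act f y \<in> F"
    and act_comp: "\<And>f h y. f \<in> G \<Longrightarrow> h \<in> G \<Longrightarrow> y \<in> F \<Longrightarrow> act (f \<circ> h) y = act f (act h y)"
    and act_measurable: "\<And>y. (\<lambda>f. act f y) \<in> \<D> \<rightarrow>\<^sub>M count_space UNIV"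
    and t_finite: "\<And>y. y \<in> F \<Longrightarrow> t y < \<infinity>"
    and t_super: "\<And>y. y \<in> F \<Longrightarrow> 1 + (\<integral>\<^sup>+ f. (if act f y = x0 then 0 else t (act f y)) \<partial>\<nu>) \<le> t y"
begin

lemmas sets_\<nu> = log_integrableD(2)[OF \<nu>] and space_\<nu> = log_integrableD(4)[OF \<nu>]

interpretation \<nu>: prob_space \<nu> by (rule log_integrableD(1)[OF \<nu>])

abbreviation \<S> :: "(nat \<Rightarrow> 'm \<Rightarrow> 'm) measure" where
  "\<S> \<equiv> PiM (UNIV :: nat set) (\<lambda>_. \<nu>)"

interpretation product_prob_space "\<lambda>_. \<nu>" "UNIV :: nat set" ..
interpretation sequence_space \<nu> ..

definition Hit :: "'x \<Rightarrow> ('m \<Rightarrow> 'm) set" where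
  "Hit y = {f \<in> G. act f y = x0}"

abbreviation \<nu>_hit :: "'x \<Rightarrow> ('m \<Rightarrow> 'm) measure" where
  "\<nu>_hit y \<equiv> hitting_measure A \<nu> (Hit y)"

definition first_return :: "'x \<Rightarrow> (nat \<Rightarrow> 'm \<Rightarrow> 'm) \<Rightarrow> 'm \<Rightarrow> 'm" where
  "first_return y \<omega> = walk \<omega> (hitting_time (Hit y) \<omega>)"

lemma G_subset: "G \<subseteq> Diff1 A"
  using sets.sets_into_space[OF G_sets] by simp

lemma Hit_sets: "Hit y \<in> sets \<D>"
proof -
  have "(\<lambda>f. act f y) -` {x0} \<inter> space \<D> \<in> sets \<D>"
    by (rule measurable_sets[OF act_measurable]) simp
  moreover have "Hit y = G \<inter> ((\<lambda>f. act f y) -` {x0} \<inter> space \<D>)"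
    using G_subset by (auto simp: Hit_def)
  ultimately show ?thesis using G_sets by simp
qed

lemma measurable_component: "(\<lambda>\<omega>. \<omega> n) \<in> \<S> \<rightarrow>\<^sub>M \<D>"
proof -
  have "(\<lambda>\<omega>. \<omega> n) \<in> \<S> \<rightarrow>\<^sub>M \<nu>" by measurable
  then show ?thesis using measurable_cong_sets[OF refl sets_\<nu>] by blast
qed

lemma measurable_walk: "(\<lambda>\<omega>. walk \<omega> n) \<in> \<S> \<rightarrow>\<^sub>M \<D>"
proof (induction n)
  case 0
  have "(\<lambda>\<omega>. id) \<in> \<S> \<rightarrow>\<^sub>M \<D>" using id_in_Diff1 by (intro measurable_const) (simp only: space_diff1_borel)
  then show ?case by (simp only: walk.simps)
next
  case (Suc n)
  from measurable_compose[OF measurable_Pair[OF measurable_component Suc] comp_measurable]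
  show ?case by (simp only: prod.case walk.simps)
qed

lemma pred_walk_Hit: "Measurable.pred \<S> (\<lambda>\<omega>. walk \<omega> n \<in> Hit y)"
  unfolding pred_def
proof -
  have eq: "(\<lambda>\<omega>. walk \<omega> n) -` Hit y \<inter> space \<S> = {\<omega> \<in> space \<S>. walk \<omega> n \<in> Hit y}"
    unfolding vimage_def Int_def mem_Collect_eq by (rule Collect_cong) (rule conj_commute)
  show "{\<omega> \<in> space \<S>. walk \<omega> n \<in> Hit y} \<in> sets \<S>"
    using measurable_sets[OF measurable_walk Hit_sets, of n y] unfolding eq .
qed

lemma measurable_hitting_time: "hitting_time (Hit y) \<in> \<S> \<rightarrow>\<^sub>M count_space UNIV"
proof -
  have "Measurable.pred \<S> (\<lambda>\<omega>. n \<ge> 1 \<and> walk \<omega> n \<in> Hit y)" for n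
    using pred_walk_Hit[of n y] by (cases "n \<ge> 1") simp_all
  then have "(\<lambda>\<omega>. LEAST n. n \<ge> 1 \<and> walk \<omega> n \<in> Hit y) \<in> \<S> \<rightarrow>\<^sub>M count_space UNIV"
    by (rule measurable_Least)
  then show ?thesis unfolding hitting_time_def[abs_def] .
qed

lemma measurable_first_return: "first_return y \<in> \<S> \<rightarrow>\<^sub>M \<D>"
  unfolding first_return_def[abs_def]
  by (rule measurable_compose_countable[OF measurable_walk measurable_hitting_time])

lemma \<nu>_hit_eq: "\<nu>_hit y = distr \<S> \<D> (first_return y)"
  unfolding hitting_measure_def first_return_def[abs_def] ..

lemma sets_\<nu>_hit [simp]: "sets (\<nu>_hit y) = sets \<D>"
  and space_\<nu>_hit [simp]: "space (\<nu>_hit y) = Diff1 A"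
  by (simp_all add: \<nu>_hit_eq)

lemma prob_space_\<nu>_hit: "prob_space (\<nu>_hit y)"
  unfolding \<nu>_hit_eq by (rule P.prob_space_distr[OF measurable_first_return])

definition in_G :: "(nat \<Rightarrow> 'm \<Rightarrow> 'm) \<Rightarrow> bool" where
  "in_G \<omega> \<longleftrightarrow> (\<forall>n. \<omega> n \<in> G)"

lemma AE_in_G: "AE \<omega> in \<S>. in_G \<omega>"
  unfolding in_G_def AE_all_countable
  using AE_PiM_component[of UNIV "\<lambda>_. \<nu>", OF _ _ AE_G] \<nu>.prob_space_axioms by auto

lemma walk_in_G: "in_G \<omega> \<Longrightarrow> walk \<omega> (Suc n) \<in> G"
  by (induction n) (auto simp: in_G_def intro: G_comp)

lemma Hit_comp:
  assumes "f \<in> G" "h \<in> G" "y \<in> F"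
  shows "h \<circ> f \<in> Hit y \<longleftrightarrow> h \<in> Hit (act f y)"
  using assms G_comp act_comp by (auto simp: Hit_def)

lemma walk_Suc_Suc_Hit:
  assumes "f \<in> G" "in_G \<omega>" "y \<in> F"
  shows "walk (case_nat f \<omega>) (Suc (Suc n)) \<in> Hit y \<longleftrightarrow> walk \<omega> (Suc n) \<in> Hit (act f y)"
  unfolding walk_case_nat[of f \<omega> "Suc n"] by (rule Hit_comp[OF assms(1) walk_in_G[OF assms(2)] assms(3)])

text \<open>
  If the walk never hits, \<open>hitting_time\<close> is an arbitrary number; statements about \<open>first_return\<close>
  are therefore restricted to hitting trajectories, which have probability one.
\<close>

definition hits :: "'x \<Rightarrow> (nat \<Rightarrow> 'm \<Rightarrow> 'm) \<Rightarrow> bool" where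
  "hits y \<omega> \<longleftrightarrow> (\<exists>n\<ge>1. walk \<omega> n \<in> Hit y)"

definition unhit :: "'x \<Rightarrow> (nat \<Rightarrow> 'm \<Rightarrow> 'm) \<Rightarrow> nat \<Rightarrow> bool" where
  "unhit y \<omega> i \<longleftrightarrow> (\<forall>j\<in>{1..i}. walk \<omega> j \<notin> Hit y)"

text \<open>
  The sum over \<open>i\<close> counts the steps up to the hitting time together with their distortions, so it
  bounds the distortion of the stopped walk and is infinite if the walk never hits.
\<close>

definition cost :: "'x \<Rightarrow> (nat \<Rightarrow> 'm \<Rightarrow> 'm) \<Rightarrow> nat \<Rightarrow> ennreal" where
  "cost y \<omega> i = (if unhit y \<omega> i then 1 + ennreal (log_distortion (\<omega> i)) else 0)"

text \<open>
  After a first step \<open>f\<close> that misses, the walk hits the set of \<open>y\<close> exactly when the shifted walk hits the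
  set of \<open>act f y\<close>.
\<close>

lemma first_return_case_nat:
  assumes f: "f \<in> G" and \<omega>: "in_G \<omega>" and y: "y \<in> F"
  shows "f \<in> Hit y \<Longrightarrow> first_return y (case_nat f \<omega>) = f"
    and "f \<notin> Hit y \<Longrightarrow> hits (act f y) \<omega> \<Longrightarrow> first_return y (case_nat f \<omega>) = first_return (act f y) \<omega> \<circ> f"
proof -
  let ?P = "\<lambda>n. n \<ge> 1 \<and> walk (case_nat f \<omega>) n \<in> Hit y"
  have w1: "walk (case_nat f \<omega>) 1 = f" by simp
  show "first_return y (case_nat f \<omega>) = f" if "f \<in> Hit y"
  proof -
    have "hitting_time (Hit y) (case_nat f \<omega>) = 1"
      unfolding hitting_time_def by (rule Least_equality) (use that w1 in auto)
    then show ?thesis using w1 by (simp only: first_return_def)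
  qed
  show "first_return y (case_nat f \<omega>) = first_return (act f y) \<omega> \<circ> f" if nf: "f \<notin> Hit y" and h: "hits (act f y) \<omega>"
  proof -
    let ?Q = "\<lambda>n. n \<ge> 1 \<and> walk \<omega> n \<in> Hit (act f y)"
    define k where "k = (LEAST n. ?Q n)"
    have k: "?Q k" unfolding k_def using h[unfolded hits_def] by (rule LeastI_ex)
    then obtain k' where k': "k = Suc k'" by (cases k) auto
    have "(LEAST n. ?P n) = Suc k"
    proof (rule Least_equality)
      show "?P (Suc k)" using k walk_Suc_Suc_Hit[OF f \<omega> y, of k'] unfolding k' by simp
      fix n assume n: "?P n"
      have "n \<noteq> 1" using n nf w1 by metis
      then obtain n' where n': "n = Suc (Suc n')" using n by (metis One_nat_def Suc_le_D not0_implies_Suc)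
      have "?Q (Suc n')" using n walk_Suc_Suc_Hit[OF f \<omega> y, of n'] unfolding n' by simp
      then have "k \<le> Suc n'" unfolding k_def by (rule Least_le)
      then show "Suc k \<le> n" by (simp add: n')
    qed
    then show ?thesis
      unfolding first_return_def hitting_time_def k_def[symmetric] by (simp only: walk_case_nat)
  qed
qed

lemma cost_case_nat:
  assumes f: "f \<in> G" and \<omega>: "in_G \<omega>" and y: "y \<in> F"
  shows "cost y (case_nat f \<omega>) 0 = 1 + ennreal (log_distortion f)"
    and "cost y (case_nat f \<omega>) (Suc i) = (if act f y = x0 then 0 else cost (act f y) \<omega> i)"
proof -
  show "cost y (case_nat f \<omega>) 0 = 1 + ennreal (log_distortion f)"
    by (simp add: cost_def unhit_def)
  have "unhit y (case_nat f \<omega>) (Suc i) \<longleftrightarrow> f \<notin> Hit y \<and> unhit (act f y) \<omega> i"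
  proof -
    have "(\<forall>j\<in>{1..Suc i}. walk (case_nat f \<omega>) j \<notin> Hit y) \<longleftrightarrow>
        walk (case_nat f \<omega>) 1 \<notin> Hit y \<and> (\<forall>j\<in>{1..i}. walk (case_nat f \<omega>) (Suc j) \<notin> Hit y)"
    proof -
      have eq: "{1..Suc i} = insert 1 (Suc ` {1..i})"
        by (simp add: image_Suc_atLeastAtMost) (simp add: Icc_eq_insert_lb_nat numeral_2_eq_2)
      show ?thesis unfolding eq by blast
    qed
    moreover have "walk (case_nat f \<omega>) (Suc j) \<notin> Hit y \<longleftrightarrow> walk \<omega> j \<notin> Hit (act f y)" if "j \<in> {1..i}" for j
      using walk_Suc_Suc_Hit[OF f \<omega> y, of "j - 1"] that by (cases j) auto
    ultimately show ?thesis unfolding unhit_def by simp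
  qed
  then show "cost y (case_nat f \<omega>) (Suc i) = (if act f y = x0 then 0 else cost (act f y) \<omega> i)"
    using f by (auto simp: cost_def Hit_def)
qed

lemma measurable_cost: "(\<lambda>\<omega>. cost y \<omega> i) \<in> borel_measurable \<S>"
proof -
  have "Measurable.pred \<S> (\<lambda>\<omega>. walk \<omega> n \<notin> Hit y)" for n
    by (intro pred_intros_logic pred_walk_Hit)
  then have [measurable]: "Measurable.pred \<S> (\<lambda>\<omega>. unhit y \<omega> i)"
    unfolding unhit_def by (intro pred_intros_finite) auto
  have [measurable]: "(\<lambda>\<omega>. log_distortion (\<omega> i)) \<in> borel_measurable \<S>"
    by (rule measurable_compose[OF measurable_component measurable_log_distortion])
  show ?thesis unfolding cost_def by measurable
qed

lemma nn_integral_first_step: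
  assumes "Y \<in> borel_measurable \<S>"
  shows "(\<integral>\<^sup>+ \<omega>. Y \<omega> \<partial>\<S>) = (\<integral>\<^sup>+ f. \<integral>\<^sup>+ \<omega>. Y (case_nat f \<omega>) \<partial>\<S> \<partial>\<nu>)"
proof -
  have c: "(\<lambda>(f, \<omega>). case_nat f \<omega>) \<in> \<nu> \<Otimes>\<^sub>M \<S> \<rightarrow>\<^sub>M \<S>"
    by measurable
  have "(\<integral>\<^sup>+ \<omega>. Y \<omega> \<partial>\<S>) = (\<integral>\<^sup>+ \<omega>. Y \<omega> \<partial>distr (\<nu> \<Otimes>\<^sub>M \<S>) \<S> (\<lambda>(f, \<omega>). case_nat f \<omega>))"
    by (simp only: PiM_iter)
  also have "\<dots> = (\<integral>\<^sup>+ p. Y (case_nat (fst p) (snd p)) \<partial>(\<nu> \<Otimes>\<^sub>M \<S>))"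
    using nn_integral_distr[OF c, of Y] assms by (simp add: split_beta')
  also have "\<dots> = (\<integral>\<^sup>+ f. \<integral>\<^sup>+ \<omega>. Y (case_nat f \<omega>) \<partial>\<S> \<partial>\<nu>)"
    using P.nn_integral_fst[of "\<lambda>p. Y (case_nat (fst p) (snd p))" \<nu>] measurable_compose[OF c assms]
    by (simp add: split_beta')
  finally show ?thesis .
qed

definition step_cost :: ennreal where
  "step_cost = (\<integral>\<^sup>+ f. 1 + ennreal (log_distortion f) \<partial>\<nu>)"

lemma step_cost_finite: "step_cost < \<infinity>"
proof -
  have "(\<integral>\<^sup>+ f. ennreal (log_distortion f) \<partial>\<nu>) = (\<integral>\<^sup>+ f. ennreal (norm (log_distortion f)) \<partial>\<nu>)"
    using space_\<nu> log_distortion_nonneg by (intro nn_integral_cong) auto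
  also have "\<dots> < \<infinity>" using log_integrableD(3)[OF \<nu>] by (simp only: integrable_iff_bounded)
  finally show ?thesis
    unfolding step_cost_def
    by (subst nn_integral_add) (simp_all add: measurable_\<D>[OF sets_\<nu>] measurable_log_distortion \<nu>.emeasure_space_1)
qed

lemma act_measurable_\<nu>: "(\<lambda>f. act f y) \<in> \<nu> \<rightarrow>\<^sub>M count_space UNIV"
  using act_measurable measurable_cong_sets[OF sets_\<nu> refl] by blast

text \<open>
  Wald's inequality by induction over the number of counted steps: the first step costs \<open>step_cost\<close> on
  average, and the supersolution property of \<open>t\<close> pays for it.
\<close>

lemma partial_cost_le:
  "y \<in> F \<Longrightarrow> (\<integral>\<^sup>+ \<omega>. (\<Sum>i<n. cost y \<omega> i) \<partial>\<S>) \<le> step_cost * t y"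
proof (induction n arbitrary: y)
  case (Suc n)
  let ?c = "\<lambda>y. \<integral>\<^sup>+ \<omega>. (\<Sum>i<n. cost y \<omega> i) \<partial>\<S>"
  have "(\<integral>\<^sup>+ \<omega>. (\<Sum>i<Suc n. cost y \<omega> i) \<partial>\<S>) =
      (\<integral>\<^sup>+ f. \<integral>\<^sup>+ \<omega>. (\<Sum>i<Suc n. cost y (case_nat f \<omega>) i) \<partial>\<S> \<partial>\<nu>)"
    by (intro nn_integral_first_step borel_measurable_sum measurable_cost)
  also have "\<dots> = (\<integral>\<^sup>+ f. (1 + ennreal (log_distortion f)) + (if act f y = x0 then 0 else ?c (act f y)) \<partial>\<nu>)"
  proof (rule nn_integral_cong_AE)
    show "AE f in \<nu>. (\<integral>\<^sup>+ \<omega>. (\<Sum>i<Suc n. cost y (case_nat f \<omega>) i) \<partial>\<S>) =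
        (1 + ennreal (log_distortion f)) + (if act f y = x0 then 0 else ?c (act f y))"
      using AE_G
    proof eventually_elim
      fix f assume f: "f \<in> G"
      have "(\<integral>\<^sup>+ \<omega>. (\<Sum>i<Suc n. cost y (case_nat f \<omega>) i) \<partial>\<S>) =
          (\<integral>\<^sup>+ \<omega>. (1 + ennreal (log_distortion f)) + (\<Sum>i<n. if act f y = x0 then 0 else cost (act f y) \<omega> i) \<partial>\<S>)"
      proof (rule nn_integral_cong_AE)
        show "AE \<omega> in \<S>. (\<Sum>i<Suc n. cost y (case_nat f \<omega>) i) =
          (1 + ennreal (log_distortion f)) + (\<Sum>i<n. if act f y = x0 then 0 else cost (act f y) \<omega> i)"
          using AE_in_G
        proof eventually_elim
          fix \<omega> assume \<omega>: "in_G \<omega>"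
          show "(\<Sum>i<Suc n. cost y (case_nat f \<omega>) i) =
            (1 + ennreal (log_distortion f)) + (\<Sum>i<n. if act f y = x0 then 0 else cost (act f y) \<omega> i)"
            unfolding sum.lessThan_Suc_shift cost_case_nat[OF f \<omega> Suc.prems] ..
        qed
      qed
      also have "\<dots> = (1 + ennreal (log_distortion f)) + (\<integral>\<^sup>+ \<omega>. (\<Sum>i<n. if act f y = x0 then 0 else cost (act f y) \<omega> i) \<partial>\<S>)"
      proof (subst nn_integral_add)
        show "(\<lambda>\<omega>. \<Sum>i<n. if act f y = x0 then 0 else cost (act f y) \<omega> i) \<in> borel_measurable \<S>"
          by (cases "act f y = x0") (auto intro!: borel_measurable_sum measurable_cost)
      qed (simp_all add: P.emeasure_space_1)
      also have "(\<integral>\<^sup>+ \<omega>. (\<Sum>i<n. if act f y = x0 then 0 else cost (act f y) \<omega> i) \<partial>\<S>) =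
          (if act f y = x0 then 0 else ?c (act f y))" by simp
      finally show "(\<integral>\<^sup>+ \<omega>. (\<Sum>i<Suc n. cost y (case_nat f \<omega>) i) \<partial>\<S>) =
        (1 + ennreal (log_distortion f)) + (if act f y = x0 then 0 else ?c (act f y))" .
    qed
  qed
  also have "\<dots> \<le> (\<integral>\<^sup>+ f. (1 + ennreal (log_distortion f)) + step_cost * (if act f y = x0 then 0 else t (act f y)) \<partial>\<nu>)"
    using Suc.IH act_in[OF _ Suc.prems] space_\<nu> by (intro nn_integral_mono add_left_mono) auto
  also have "\<dots> = step_cost + step_cost * (\<integral>\<^sup>+ f. (if act f y = x0 then 0 else t (act f y)) \<partial>\<nu>)"
  proof -
    have m1: "(\<lambda>f. (if act f y = x0 then 0 else t (act f y))) \<in> borel_measurable \<nu>"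
      using measurable_compose[OF act_measurable_\<nu>, of "\<lambda>z. if z = x0 then 0 else t z"] by simp
    have m2: "(\<lambda>f. 1 + ennreal (log_distortion f)) \<in> borel_measurable \<nu>"
      using measurable_\<D>[OF sets_\<nu> measurable_log_distortion] by simp
    have m3: "(\<lambda>f. step_cost * (if act f y = x0 then 0 else t (act f y))) \<in> borel_measurable \<nu>"
      by (intro borel_measurable_times_ennreal borel_measurable_const m1)
    show ?thesis
      unfolding nn_integral_add[OF m2 m3] nn_integral_cmult[OF m1] step_cost_def[symmetric] ..
  qed
  also have "\<dots> = step_cost * (1 + (\<integral>\<^sup>+ f. (if act f y = x0 then 0 else t (act f y)) \<partial>\<nu>))"
    by (simp only: distrib_left mult_1_right)
  also have "\<dots> \<le> step_cost * t y"
    by (intro mult_left_mono t_super Suc.prems) simp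
  finally show ?case .
qed simp

lemma total_cost_le:
  assumes y: "y \<in> F"
  shows "(\<integral>\<^sup>+ \<omega>. (\<Sum>i. cost y \<omega> i) \<partial>\<S>) \<le> step_cost * t y"
proof -
  have "(\<integral>\<^sup>+ \<omega>. (\<Sum>i. cost y \<omega> i) \<partial>\<S>) = (\<Sum>i. \<integral>\<^sup>+ \<omega>. cost y \<omega> i \<partial>\<S>)"
    by (rule nn_integral_suminf[OF measurable_cost])
  also have "\<dots> \<le> step_cost * t y"
  proof (rule suminf_le_const)
    fix n
    show "(\<Sum>i<n. \<integral>\<^sup>+ \<omega>. cost y \<omega> i \<partial>\<S>) \<le> step_cost * t y"
      using partial_cost_le[OF y, of n] by (subst (asm) nn_integral_sum) (auto simp: measurable_cost)
  qed simp
  finally show ?thesis .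
qed

lemma total_cost_finite: "y \<in> F \<Longrightarrow> step_cost * t y < \<infinity>"
  using step_cost_finite t_finite[of y] by (simp add: ennreal_mult_less_top)

text \<open>
  A trajectory that never hits has infinite total cost, while the mean cost is finite.
\<close>

lemma AE_hits:
  assumes y: "y \<in> F"
  shows "AE \<omega> in \<S>. hits y \<omega>"
proof -
  have "(\<integral>\<^sup>+ \<omega>. (\<Sum>i. cost y \<omega> i) \<partial>\<S>) \<noteq> \<infinity>"
    using total_cost_le[OF y] total_cost_finite[OF y] by (metis leD)
  moreover have "(\<lambda>\<omega>. \<Sum>i. cost y \<omega> i) \<in> borel_measurable \<S>"
    by (intro borel_measurable_suminf_order measurable_cost)
  ultimately have "AE \<omega> in \<S>. (\<Sum>i. cost y \<omega> i) \<noteq> \<infinity>"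
    by (intro nn_integral_PInf_AE)
  then show ?thesis
  proof eventually_elim
    fix \<omega> assume fin: "(\<Sum>i. cost y \<omega> i) \<noteq> \<infinity>"
    show "hits y \<omega>"
    proof (rule ccontr)
      assume "\<not> hits y \<omega>"
      then have "unhit y \<omega> i" for i by (auto simp: hits_def unhit_def)
      then have c: "1 \<le> cost y \<omega> i" for i by (simp add: cost_def)
      have "of_nat n \<le> (\<Sum>i. cost y \<omega> i)" for n
      proof -
        have "of_nat n = (\<Sum>i<n. 1 :: ennreal)" by simp
        also have "\<dots> \<le> (\<Sum>i<n. cost y \<omega> i)" by (intro sum_mono c)
        also have "\<dots> \<le> (\<Sum>i. cost y \<omega> i)" by (intro sum_le_suminf) auto
        finally show ?thesis .
      qed
      then have "(\<Sum>i. cost y \<omega> i) = \<infinity>"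
        using ennreal_Ex_less_of_nat[of "\<Sum>i. cost y \<omega> i"] by (metis infinity_ennreal_def less_top leD)
      then show False using fin by simp
    qed
  qed
qed

lemma log_distortion_walk_le:
  assumes "\<And>n. \<omega> n \<in> Diff1 A"
  shows "walk \<omega> n \<in> Diff1 A" "log_distortion (walk \<omega> n) \<le> (\<Sum>i<n. log_distortion (\<omega> i))"
proof (induction n)
  case 0
  have "log_distortion id = 0"
    using nonzero_tangents_nonempty(2) by (simp add: log_distortion_def)
  then show "walk \<omega> 0 \<in> Diff1 A" "log_distortion (walk \<omega> 0) \<le> (\<Sum>i<0. log_distortion (\<omega> i))"
    using id_in_Diff1 by simp_all
next
  case (Suc n)
  show "walk \<omega> (Suc n) \<in> Diff1 A" using Suc.IH(1) assms comp_in_Diff1 by simp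
  show "log_distortion (walk \<omega> (Suc n)) \<le> (\<Sum>i<Suc n. log_distortion (\<omega> i))"
    using log_distortion_comp[OF assms[of n] Suc.IH(1)] Suc.IH(2) by (simp del: comp_apply)
qed

lemma log_distortion_first_return_le:
  assumes \<omega>: "in_G \<omega>" "hits y \<omega>"
  shows "ennreal (log_distortion (first_return y \<omega>)) \<le> (\<Sum>i. cost y \<omega> i)"
proof -
  have D: "\<omega> n \<in> Diff1 A" for n using \<omega>(1) G_subset by (auto simp: in_G_def)
  define n where "n = hitting_time (Hit y) \<omega>"
  have un: "unhit y \<omega> i" if "i < n" for i
    unfolding unhit_def
  proof
    fix j assume j: "j \<in> {1..i}"
    then have "j < n" using that by simp
    then have "\<not> (j \<ge> 1 \<and> walk \<omega> j \<in> Hit y)" unfolding n_def hitting_time_def by (rule not_less_Least)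
    then show "walk \<omega> j \<notin> Hit y" using j by simp
  qed
  have "ennreal (log_distortion (first_return y \<omega>)) \<le> ennreal (\<Sum>i<n. log_distortion (\<omega> i))"
    unfolding first_return_def n_def[symmetric] by (intro ennreal_leI log_distortion_walk_le(2) D)
  also have "\<dots> = (\<Sum>i<n. ennreal (log_distortion (\<omega> i)))"
    by (intro sum_ennreal[symmetric] log_distortion_nonneg D)
  also have "\<dots> \<le> (\<Sum>i<n. cost y \<omega> i)"
    using un by (intro sum_mono) (simp add: cost_def)
  also have "\<dots> \<le> (\<Sum>i. cost y \<omega> i)" by (intro sum_le_suminf) auto
  finally show ?thesis .
qed

lemma log_integrable_\<nu>_hit:
  assumes y: "y \<in> F"
  shows "log_integrable (\<nu>_hit y)"
proof -
  have "(\<integral>\<^sup>+ f. ennreal (norm (log_distortion f)) \<partial>\<nu>_hit y) = (\<integral>\<^sup>+ \<omega>. ennreal (norm (log_distortion (first_return y \<omega>))) \<partial>\<S>)"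
    unfolding \<nu>_hit_eq
    by (intro nn_integral_distr measurable_first_return) (simp add: measurable_log_distortion)
  also have "\<dots> \<le> (\<integral>\<^sup>+ \<omega>. (\<Sum>i. cost y \<omega> i) \<partial>\<S>)"
  proof (rule nn_integral_mono_AE)
    show "AE \<omega> in \<S>. ennreal (norm (log_distortion (first_return y \<omega>))) \<le> (\<Sum>i. cost y \<omega> i)"
      using AE_in_G AE_hits[OF y] AE_space
    proof eventually_elim
      fix \<omega> assume \<omega>: "in_G \<omega>" "hits y \<omega>" "\<omega> \<in> space \<S>"
      have "first_return y \<omega> \<in> Diff1 A" using measurable_space[OF measurable_first_return \<omega>(3)] by simp
      then show "ennreal (norm (log_distortion (first_return y \<omega>))) \<le> (\<Sum>i. cost y \<omega> i)"
        using log_distortion_nonneg log_distortion_first_return_le[OF \<omega>(1,2)] by simp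
    qed
  qed
  also have "\<dots> < \<infinity>" using total_cost_le[OF y] total_cost_finite[OF y] by (rule order_le_less_trans)
  finally have "integrable (\<nu>_hit y) log_distortion"
    by (intro integrableI_bounded measurable_\<D>[OF sets_\<nu>_hit] measurable_log_distortion)
  then show ?thesis using prob_space_\<nu>_hit by (simp add: log_integrable_def)
qed

text \<open>
  Either the first step already hits, or the walk restarts at \<open>act f y\<close> with \<open>f\<close> composed on the
  right.
\<close>

lemma integral_first_step:
  fixes \<Psi> :: "('m \<Rightarrow> 'm) \<Rightarrow> real"
  assumes y: "y \<in> F" and \<Psi>: "\<Psi> \<in> borel_measurable \<D>" and int: "integrable (\<nu>_hit y) \<Psi>"
    and m: "(\<lambda>f. if act f y = x0 then \<Psi> f else (\<integral>h. \<Psi> (h \<circ> f) \<partial>\<nu>_hit (act f y))) \<in> borel_measurable \<nu>"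
  shows "(\<integral>f. \<Psi> f \<partial>\<nu>_hit y) = (\<integral>f. (if act f y = x0 then \<Psi> f else (\<integral>h. \<Psi> (h \<circ> f) \<partial>\<nu>_hit (act f y))) \<partial>\<nu>)"
proof -
  interpret PP: pair_sigma_finite \<nu> \<S> ..
  have c: "(\<lambda>(f, \<omega>). case_nat f \<omega>) \<in> \<nu> \<Otimes>\<^sub>M \<S> \<rightarrow>\<^sub>M \<S>"
    by measurable
  define Y where "Y \<omega> = \<Psi> (first_return y \<omega>)" for \<omega>
  have Y: "Y \<in> borel_measurable \<S>"
    unfolding Y_def[abs_def] by (rule measurable_compose[OF measurable_first_return \<Psi>])
  have "integrable \<S> Y"
    using int integrable_distr_eq[OF measurable_first_return \<Psi>, of y] unfolding \<nu>_hit_eq Y_def[abs_def] by simp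
  then have "integrable (distr (\<nu> \<Otimes>\<^sub>M \<S>) \<S> (\<lambda>(f, \<omega>). case_nat f \<omega>)) Y" by (simp only: PiM_iter)
  then have i: "integrable (\<nu> \<Otimes>\<^sub>M \<S>) (\<lambda>(f, \<omega>). Y (case_nat f \<omega>))"
    unfolding integrable_distr_eq[OF c Y] by (simp add: split_beta')
  have "(\<integral>f. \<Psi> f \<partial>\<nu>_hit y) = (\<integral>\<omega>. Y \<omega> \<partial>\<S>)"
    unfolding \<nu>_hit_eq Y_def by (rule integral_distr[OF measurable_first_return \<Psi>])
  also have "\<dots> = (\<integral>\<omega>. Y \<omega> \<partial>distr (\<nu> \<Otimes>\<^sub>M \<S>) \<S> (\<lambda>(f, \<omega>). case_nat f \<omega>))"
    by (simp only: PiM_iter)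
  also have "\<dots> = (\<integral>p. Y ((\<lambda>(f, \<omega>). case_nat f \<omega>) p) \<partial>(\<nu> \<Otimes>\<^sub>M \<S>))"
    by (rule integral_distr[OF c Y])
  also have "\<dots> = (\<integral>f. \<integral>\<omega>. Y (case_nat f \<omega>) \<partial>\<S> \<partial>\<nu>)"
    using PP.integral_fst[OF i] by (simp add: split_beta')
  also have "\<dots> = (\<integral>f. (if act f y = x0 then \<Psi> f else (\<integral>h. \<Psi> (h \<circ> f) \<partial>\<nu>_hit (act f y))) \<partial>\<nu>)"
  proof (rule integral_cong_AE[OF _ m])
    show "(\<lambda>f. \<integral>\<omega>. Y (case_nat f \<omega>) \<partial>\<S>) \<in> borel_measurable \<nu>"
      using PP.integrable_fst[OF i] by (rule borel_measurable_integrable)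
    show "AE f in \<nu>. (\<integral>\<omega>. Y (case_nat f \<omega>) \<partial>\<S>) =
        (if act f y = x0 then \<Psi> f else (\<integral>h. \<Psi> (h \<circ> f) \<partial>\<nu>_hit (act f y)))"
      using AE_G AE_space
    proof eventually_elim
      fix f assume f: "f \<in> G" "f \<in> space \<nu>"
      then have fD: "f \<in> Diff1 A" using G_subset by blast
      have cf: "case_nat f \<in> \<S> \<rightarrow>\<^sub>M \<S>"
        using measurable_compose[OF measurable_Pair1'[OF f(2)] c] by simp
      have Yf: "(\<lambda>\<omega>. Y (case_nat f \<omega>)) \<in> borel_measurable \<S>"
        by (rule measurable_compose[OF cf Y])
      show "(\<integral>\<omega>. Y (case_nat f \<omega>) \<partial>\<S>) = (if act f y = x0 then \<Psi> f else (\<integral>h. \<Psi> (h \<circ> f) \<partial>\<nu>_hit (act f y)))"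
      proof (cases "act f y = x0")
        case True
        then have h: "f \<in> Hit y" using f by (simp add: Hit_def)
        have "AE \<omega> in \<S>. Y (case_nat f \<omega>) = \<Psi> f"
          using AE_in_G by eventually_elim (simp add: Y_def first_return_case_nat(1)[OF f(1) _ y h])
        from integral_cong_AE[OF Yf _ this] show ?thesis using True by (simp add: P.prob_space)
      next
        case False
        then have h: "f \<notin> Hit y" by (simp add: Hit_def)
        have ay: "act f y \<in> F" by (rule act_in[OF fD y])
        have m\<Psi>: "(\<lambda>h. \<Psi> (h \<circ> f)) \<in> borel_measurable \<D>"
          by (rule measurable_compose[OF comp_right_measurable[OF fD] \<Psi>])
        have m2: "(\<lambda>\<omega>. \<Psi> (first_return (act f y) \<omega> \<circ> f)) \<in> borel_measurable \<S>"
          by (rule measurable_compose[OF measurable_first_return m\<Psi>])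
        have "AE \<omega> in \<S>. Y (case_nat f \<omega>) = \<Psi> (first_return (act f y) \<omega> \<circ> f)"
          using AE_in_G AE_hits[OF ay]
          by eventually_elim (simp only: Y_def first_return_case_nat(2)[OF f(1) _ y h])
        from integral_cong_AE[OF Yf m2 this]
        have "(\<integral>\<omega>. Y (case_nat f \<omega>) \<partial>\<S>) = (\<integral>\<omega>. \<Psi> (first_return (act f y) \<omega> \<circ> f) \<partial>\<S>)" .
        also have "\<dots> = (\<integral>h. \<Psi> (h \<circ> f) \<partial>\<nu>_hit (act f y))"
          unfolding \<nu>_hit_eq by (rule integral_distr[OF measurable_first_return m\<Psi>, symmetric])
        finally show ?thesis using False by simp
      qed
    qed
  qed
  finally show ?thesis .
qed

text \<open>
  The expected value of \<open>w\<close> at the time when \<open>y\<close> is first brought to \<open>x0\<close>, at least one step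
  being taken, even from \<open>x0\<close>.
\<close>

definition hit_mean :: "('m \<times> 'b \<Rightarrow> real) \<Rightarrow> 'x \<Rightarrow> 'm \<times> 'b \<Rightarrow> real" where
  "hit_mean w y q = (\<integral>h. w (Tmap A h q) \<partial>\<nu>_hit y)"

text \<open>
  In contrast to \<open>hit_mean\<close>, no step is taken from \<open>x0\<close>; the two are linked by the identity
  \<open>hit_mean_first_step\<close>.
\<close>

definition extended :: "('m \<times> 'b \<Rightarrow> real) \<Rightarrow> 'x \<Rightarrow> 'm \<times> 'b \<Rightarrow> real" where
  "extended w y q = (if y = x0 then w q else hit_mean w y q)"

context
  fixes w B
  assumes w_bound: "\<And>q. q \<in> nonzero_tangents \<Longrightarrow> \<bar>w q - log_norm q\<bar> \<le> B"
    and w_meas: "\<And>q. q \<in> nonzero_tangents \<Longrightarrow> (\<lambda>f. w (Tmap A f q)) \<in> borel_measurable \<D>"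
begin

lemma w_Tmap_bound: "f \<in> Diff1 A \<Longrightarrow> q \<in> nonzero_tangents \<Longrightarrow> \<bar>w (Tmap A f q)\<bar> \<le> (B + \<bar>log_norm q\<bar>) + log_distortion f"
  using w_bound[OF Tmap_nonzero[of f q]] log_norm_Tmap_abs[of f q] by linarith

lemma w_integrable: "log_integrable m \<Longrightarrow> q \<in> nonzero_tangents \<Longrightarrow> integrable m (\<lambda>f. w (Tmap A f q))"
  by (rule integrable_dominated[OF _ w_meas w_Tmap_bound])

lemma hit_mean_bound:
  assumes y: "y \<in> F" and q: "q \<in> nonzero_tangents"
  shows "\<bar>hit_mean w y q - log_norm q\<bar> \<le> B + (\<integral>f. log_distortion f \<partial>\<nu>_hit y)"
proof -
  note li = log_integrable_\<nu>_hit[OF y]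
  interpret prob_space "\<nu>_hit y" by (rule prob_space_\<nu>_hit)
  note i = w_integrable[OF li q]
  have "\<bar>hit_mean w y q - log_norm q\<bar> = \<bar>\<integral>f. w (Tmap A f q) - log_norm q \<partial>\<nu>_hit y\<bar>"
    using i by (simp add: hit_mean_def prob_space[unfolded space_\<nu>_hit])
  also have "\<dots> \<le> (\<integral>f. \<bar>w (Tmap A f q) - log_norm q\<bar> \<partial>\<nu>_hit y)"
    by (rule integral_abs_bound)
  also have "\<dots> \<le> (\<integral>f. B + log_distortion f \<partial>\<nu>_hit y)"
  proof (rule integral_mono)
    fix f assume "f \<in> space (\<nu>_hit y)"
    then have f: "f \<in> Diff1 A" by simp
    show "\<bar>w (Tmap A f q) - log_norm q\<bar> \<le> B + log_distortion f"
      using w_bound[OF Tmap_nonzero[OF f q]] log_distortion_upper[OF f q] by linarith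
  qed (use i log_integrableD(3)[OF li] in auto)
  also have "\<dots> = B + (\<integral>f. log_distortion f \<partial>\<nu>_hit y)"
    using log_integrableD(3)[OF li] by (simp add: prob_space[unfolded space_\<nu>_hit])
  finally show ?thesis .
qed

lemma hit_mean_Tmap:
  assumes "f \<in> Diff1 A"
  shows "hit_mean w y (Tmap A f q) = (\<integral>h. w (Tmap A (h \<circ> f) q) \<partial>\<nu>_hit y)"
  unfolding hit_mean_def
  by (rule Bochner_Integration.integral_cong) (simp_all add: Tmap_comp[OF Diff1_C1_map Diff1_C1_map[OF assms]])

lemma extended_measurable:
  assumes q: "q \<in> nonzero_tangents"
  shows "(\<lambda>f. extended w (act f y) (Tmap A f q)) \<in> borel_measurable \<D>"
proof (rule measurable_compose_countable[OF _ act_measurable])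
  fix z
  interpret H: prob_space "\<nu>_hit z" by (rule prob_space_\<nu>_hit)
  show "(\<lambda>f. extended w z (Tmap A f q)) \<in> borel_measurable \<D>"
  proof (cases "z = x0")
    case True
    then show ?thesis using w_meas[OF q] by (simp add: extended_def)
  next
    case False
    have "(\<lambda>(f, h). w (Tmap A (h \<circ> f) q)) \<in> borel_measurable (\<D> \<Otimes>\<^sub>M \<nu>_hit z)"
      using measurable_compose[OF comp_measurable_sets(2)[OF refl sets_\<nu>_hit] w_meas[OF q]]
      by (simp add: split_beta')
    from H.borel_measurable_lebesgue_integral[OF this]
    have "(\<lambda>f. hit_mean w z (Tmap A f q)) \<in> borel_measurable \<D>"
      by (rule measurable_cong[THEN iffD1, rotated]) (simp add: hit_mean_Tmap)
    then show ?thesis using False by (simp add: extended_def)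
  qed
qed

lemma hit_mean_first_step:
  assumes y: "y \<in> F" and q: "q \<in> nonzero_tangents"
  shows "hit_mean w y q = (\<integral>f. extended w (act f y) (Tmap A f q) \<partial>\<nu>)"
proof -
  have eq: "extended w (act f y) (Tmap A f q) =
      (if act f y = x0 then w (Tmap A f q) else (\<integral>h. w (Tmap A (h \<circ> f) q) \<partial>\<nu>_hit (act f y)))"
    if "f \<in> space \<nu>" for f
    using that hit_mean_Tmap[of f] space_\<nu> by (simp add: extended_def)
  have "(\<lambda>f. extended w (act f y) (Tmap A f q)) \<in> borel_measurable \<nu>"
    by (rule measurable_\<D>[OF sets_\<nu> extended_measurable[OF q]])
  then have "(\<lambda>f. if act f y = x0 then w (Tmap A f q) else (\<integral>h. w (Tmap A (h \<circ> f) q) \<partial>\<nu>_hit (act f y)))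
      \<in> borel_measurable \<nu>"
    by (rule measurable_cong[THEN iffD1, rotated]) (rule eq)
  from integral_first_step[OF y w_meas[OF q] w_integrable[OF log_integrable_\<nu>_hit[OF y] q] this]
  have "hit_mean w y q = (\<integral>f. (if act f y = x0 then w (Tmap A f q) else (\<integral>h. w (Tmap A (h \<circ> f) q) \<partial>\<nu>_hit (act f y))) \<partial>\<nu>)"
    by (simp only: hit_mean_def)
  also have "\<dots> = (\<integral>f. extended w (act f y) (Tmap A f q) \<partial>\<nu>)"
    by (rule Bochner_Integration.integral_cong[OF refl]) (rule eq[symmetric])
  finally show ?thesis .
qed

definition extended_radius :: real where
  "extended_radius = B + (\<Sum>y\<in>F. \<integral>f. log_distortion f \<partial>\<nu>_hit y)"

lemma extended_bound:
  assumes y: "y \<in> F" and q: "q \<in> nonzero_tangents"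
  shows "\<bar>extended w y q - log_norm q\<bar> \<le> extended_radius" "\<bar>hit_mean w y q - log_norm q\<bar> \<le> extended_radius" "B \<le> extended_radius"
proof -
  have nn: "0 \<le> (\<integral>f. log_distortion f \<partial>\<nu>_hit y)" for y
    using log_distortion_nonneg by (intro integral_nonneg_AE AE_I2) simp
  show "B \<le> extended_radius" using nn by (simp add: extended_radius_def sum_nonneg)
  have "(\<integral>f. log_distortion f \<partial>\<nu>_hit y) \<le> (\<Sum>y\<in>F. \<integral>f. log_distortion f \<partial>\<nu>_hit y)"
    using nn by (intro member_le_sum y finite_F) auto
  then show J: "\<bar>hit_mean w y q - log_norm q\<bar> \<le> extended_radius" using hit_mean_bound[OF assms] by (simp add: extended_radius_def)
  show "\<bar>extended w y q - log_norm q\<bar> \<le> extended_radius"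
    using J \<open>B \<le> extended_radius\<close> w_bound[OF q] by (auto simp: extended_def)
qed

lemma extended_Tmap_bound:
  assumes f: "f \<in> Diff1 A" and y: "y \<in> F" and q: "q \<in> nonzero_tangents"
  shows "\<bar>extended w (act f y) (Tmap A f q)\<bar> \<le> (extended_radius + \<bar>log_norm q\<bar>) + log_distortion f"
  using extended_bound(1)[OF act_in[OF f y] Tmap_nonzero[OF f q]] log_norm_Tmap_abs[OF f q] by linarith

lemma extended_integrable:
  "y \<in> F \<Longrightarrow> q \<in> nonzero_tangents \<Longrightarrow> integrable \<nu> (\<lambda>f. extended w (act f y) (Tmap A f q))"
  by (rule integrable_dominated[OF \<nu> extended_measurable extended_Tmap_bound])

text \<open>
  Let \<open>I\<close> be the infimum of the mean increments of \<open>w\<close> at hitting times. A first step gains \<open>\<epsilon>\<close> and is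
  followed either by nothing or by a mean increment of at least \<open>I\<close>. Hence \<open>I \<ge> \<epsilon> + min 0 I\<close>,
  which excludes \<open>I < 0\<close>.
\<close>

lemma drift_of_hitting_measure:
  assumes \<epsilon>: "\<epsilon> > 0" and drift: "\<And>q. q \<in> nonzero_tangents \<Longrightarrow> w q + \<epsilon> \<le> (\<integral>f. w (Tmap A f q) \<partial>\<nu>)"
    and q: "q \<in> nonzero_tangents"
  shows "w q + \<epsilon> \<le> (\<integral>f. w (Tmap A f q) \<partial>\<nu>_hit x0)"
proof -
  define X where "X = (\<lambda>(y, q). hit_mean w y q - w q) ` (F \<times> nonzero_tangents)"
  define I where "I = Inf X"
  have bdd: "bdd_below X"
  proof (rule bdd_belowI)
    fix x assume "x \<in> X"
    then obtain y q where yq: "y \<in> F" "q \<in> nonzero_tangents" "x = hit_mean w y q - w q" by (auto simp: X_def)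
    show "- (2 * extended_radius) \<le> x"
      using extended_bound(2,3)[OF yq(1,2)] w_bound[OF yq(2)] yq(3) by linarith
  qed
  have ne: "X \<noteq> {}" using x0 q by (auto simp: X_def)
  have lower: "I \<le> hit_mean w y q - w q" if "y \<in> F" "q \<in> nonzero_tangents" for y q
    unfolding I_def using that bdd by (intro cInf_lower) (auto simp: X_def)
  have step: "w q + \<epsilon> + min 0 I \<le> hit_mean w y q" if y: "y \<in> F" and q: "q \<in> nonzero_tangents" for y q
  proof -
    have "w q + \<epsilon> + min 0 I \<le> (\<integral>f. w (Tmap A f q) \<partial>\<nu>) + min 0 I" using drift[OF q] by simp
    also have "\<dots> = (\<integral>f. w (Tmap A f q) + min 0 I \<partial>\<nu>)"
      using w_integrable[OF \<nu> q] by (simp add: \<nu>.prob_space)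
    also have "\<dots> \<le> (\<integral>f. extended w (act f y) (Tmap A f q) \<partial>\<nu>)"
    proof (rule integral_mono)
      show "integrable \<nu> (\<lambda>f. w (Tmap A f q) + min 0 I)" using w_integrable[OF \<nu> q] by simp
      show "integrable \<nu> (\<lambda>f. extended w (act f y) (Tmap A f q))" by (rule extended_integrable[OF y q])
      fix f assume "f \<in> space \<nu>"
      then have f: "f \<in> Diff1 A" using space_\<nu> by simp
      show "w (Tmap A f q) + min 0 I \<le> extended w (act f y) (Tmap A f q)"
        using lower[OF act_in[OF f y] Tmap_nonzero[OF f q]] by (auto simp: extended_def)
    qed
    also have "\<dots> = hit_mean w y q" by (rule hit_mean_first_step[OF y q, symmetric])
    finally show ?thesis .
  qed
  have "\<epsilon> + min 0 I \<le> I"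
    unfolding I_def
  proof (rule cInf_greatest[OF ne])
    fix x assume "x \<in> X"
    then obtain y q where yq: "y \<in> F" "q \<in> nonzero_tangents" "x = hit_mean w y q - w q" by (auto simp: X_def)
    show "\<epsilon> + min 0 (Inf X) \<le> x" using step[OF yq(1,2)] yq(3) unfolding I_def by linarith
  qed
  then have "I \<ge> 0" using \<epsilon> by (auto simp: min_def split: if_splits)
  then show ?thesis using step[OF x0 q] by (simp add: hit_mean_def)
qed

text \<open>
  A bound for the expected hitting time that counts no step from \<open>x0\<close>.
\<close>

definition t_away :: "'x \<Rightarrow> real" where
  "t_away y = (if y = x0 then 0 else enn2real (t y))"

lemma t_away_step:
  assumes y: "y \<in> F"
  shows "integrable \<nu> (\<lambda>f. t_away (act f y))" "(\<integral>f. t_away (act f y) \<partial>\<nu>) \<le> enn2real (t y) - 1"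
proof -
  have m: "(\<lambda>f. t_away (act f y)) \<in> borel_measurable \<nu>"
    using measurable_compose[OF act_measurable_\<nu>, of t_away] by simp
  have eq: "(\<integral>\<^sup>+ f. ennreal (t_away (act f y)) \<partial>\<nu>) = (\<integral>\<^sup>+ f. (if act f y = x0 then 0 else t (act f y)) \<partial>\<nu>)"
  proof (rule nn_integral_cong)
    fix f assume "f \<in> space \<nu>"
    then have "act f y \<in> F" using act_in y space_\<nu> by blast
    then show "ennreal (t_away (act f y)) = (if act f y = x0 then 0 else t (act f y))"
      using t_finite by (simp add: t_away_def)
  qed
  \<comment> \<open>Passing from extended nonnegative to real values is possible because \<open>t\<close> is finite on \<open>F\<close>.\<close>
  have le: "1 + (\<integral>\<^sup>+ f. ennreal (t_away (act f y)) \<partial>\<nu>) \<le> t y" unfolding eq by (rule t_super[OF y])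
  then have fin: "(\<integral>\<^sup>+ f. ennreal (t_away (act f y)) \<partial>\<nu>) < \<infinity>"
    using t_finite[OF y] by (metis add_left_mono ennreal_add_less_top infinity_ennreal_def order_le_less_trans)
  have nn: "0 \<le> t_away z" for z by (simp add: t_away_def)
  show i: "integrable \<nu> (\<lambda>f. t_away (act f y))"
    using m fin nn by (intro integrableI_nonneg) auto
  have "1 + ennreal (\<integral>f. t_away (act f y) \<partial>\<nu>) \<le> t y"
    using le nn_integral_eq_integral[OF i] nn by simp
  also have "t y = ennreal (enn2real (t y))" using t_finite[OF y] by simp
  finally have "ennreal (1 + (\<integral>f. t_away (act f y) \<partial>\<nu>)) \<le> ennreal (enn2real (t y))"
    using nn by (subst ennreal_plus) (auto intro: integral_nonneg_AE)
  then show "(\<integral>f. t_away (act f y) \<partial>\<nu>) \<le> enn2real (t y) - 1"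
    by (subst (asm) ennreal_le_iff) auto
qed

text \<open>
  In mean, \<open>extended w\<close> is constant along a step from \<open>y \<noteq> x0\<close> and gains at least \<open>\<epsilon>\<close> from \<open>x0\<close>, whereas \<open>t_away\<close>
  loses at least 1 from \<open>y \<noteq> x0\<close> and gains at most \<open>t x0 - 1\<close> from \<open>x0\<close>. With \<open>\<delta> = \<epsilon> / t x0\<close> the
  function \<open>extended w - \<delta> t_away\<close> gains at least \<open>\<delta>\<close> in both cases.
\<close>

lemma expanding_of_hitting_drift:
  assumes \<epsilon>: "\<epsilon> > 0" and drift: "\<And>q. q \<in> nonzero_tangents \<Longrightarrow> w q + \<epsilon> \<le> (\<integral>f. w (Tmap A f q) \<partial>\<nu>_hit x0)"
  shows "expanding \<nu>"
proof -
  define r where "r = enn2real (t x0)"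
  define M where "M = (\<Sum>y\<in>F. t_away y)"
  have nn: "0 \<le> t_away z" for z by (simp add: t_away_def)
  have M: "t_away y \<le> M" if "y \<in> F" for y
    unfolding M_def using nn by (intro member_le_sum that finite_F) auto
  have r: "r \<ge> 1"
  proof -
    have "0 \<le> (\<integral>f. t_away (act f x0) \<partial>\<nu>)" using nn by (intro integral_nonneg_AE AE_I2)
    then show ?thesis using t_away_step(2)[OF x0] by (simp add: r_def)
  qed
  define \<delta> where "\<delta> = \<epsilon> / r"
  have \<delta>: "\<delta> > 0" "\<delta> * r = \<epsilon>" using \<epsilon> r by (auto simp: \<delta>_def)
  define W where "W = (\<lambda>(q, y). extended w y q - \<delta> * t_away y)"
  define T where "T = (\<lambda>f (q, y). (Tmap A f q, act f y))"
  have WT: "W (T f (q, y)) = extended w (act f y) (Tmap A f q) - \<delta> * t_away (act f y)" for f q y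
    by (simp add: W_def T_def)
  have W_meas: "(\<lambda>f. W (T f s)) \<in> borel_measurable \<D>" if "s \<in> nonzero_tangents \<times> F" for s
  proof -
    obtain q y where s: "s = (q, y)" by (cases s)
    have "(\<lambda>f. t_away (act f y)) \<in> borel_measurable \<D>"
      using measurable_compose[OF act_measurable, of t_away] by simp
    then show ?thesis using extended_measurable[of q y] that unfolding s WT by simp
  qed
  have W_bound: "\<bar>W (T f s)\<bar> \<le> (extended_radius + \<delta> * M + \<bar>log_norm (fst s)\<bar>) + log_distortion f"
    if f: "f \<in> Diff1 A" and s: "s \<in> nonzero_tangents \<times> F" for f s
  proof -
    obtain q y where qy: "s = (q, y)" "q \<in> nonzero_tangents" "y \<in> F" using s by auto
    have "0 \<le> \<delta> * t_away (act f y)" "\<delta> * t_away (act f y) \<le> \<delta> * M"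
      using \<delta>(1) nn M[OF act_in[OF f qy(3)]] by auto
    then show ?thesis using extended_Tmap_bound[OF f qy(3,2)] unfolding qy(1) WT fst_conv by linarith
  qed
  have W_drift: "W s + \<delta> \<le> (\<integral>f. W (T f s) \<partial>\<nu>)" if s: "s \<in> nonzero_tangents \<times> F" for s
  proof -
    obtain q y where qy: "s = (q, y)" "q \<in> nonzero_tangents" "y \<in> F" using s by auto
    have "(\<integral>f. W (T f s) \<partial>\<nu>) = hit_mean w y q - \<delta> * (\<integral>f. t_away (act f y) \<partial>\<nu>)"
      unfolding qy(1) WT
      using extended_integrable[OF qy(3,2)] t_away_step(1)[OF qy(3)] hit_mean_first_step[OF qy(3,2)] by simp
    also have "\<dots> \<ge> hit_mean w y q - \<delta> * (enn2real (t y) - 1)"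
      using t_away_step(2)[OF qy(3)] \<delta>(1) by simp
    finally have *: "hit_mean w y q - \<delta> * (enn2real (t y) - 1) \<le> (\<integral>f. W (T f s) \<partial>\<nu>)" .
    show ?thesis
    proof (cases "y = x0")
      case True
      have "hit_mean w x0 q \<ge> w q + \<epsilon>" using drift[OF qy(2)] by (simp add: hit_mean_def)
      moreover have "\<delta> * (enn2real (t y) - 1) = \<epsilon> - \<delta>"
        using \<delta>(2) True by (simp add: r_def algebra_simps)
      moreover have "W s = w q" using True by (simp add: W_def qy(1) extended_def t_away_def)
      ultimately show ?thesis using * True by simp
    next
      case False
      have "W s = hit_mean w y q - \<delta> * enn2real (t y)" using False by (simp add: W_def qy(1) extended_def t_away_def)
      then show ?thesis using * by (simp add: algebra_simps)
    qed
  qed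
  show ?thesis
  proof (rule expanding_of_linear_growth[OF \<nu> \<delta>(1), where F = "\<lambda>q f. W (T f (q, x0))" and c = w and B = "extended_radius + \<delta> * M"])
    fix q assume q: "q \<in> nonzero_tangents"
    have qx: "(q, x0) \<in> nonzero_tangents \<times> F" using q x0 by simp
    show "(\<lambda>f. W (T f (q, x0))) \<in> borel_measurable \<D>" by (rule W_meas[OF qx])
    have M0: "0 \<le> \<delta> * M" using M[OF x0] nn[of x0] \<delta>(1) by simp
    show "\<bar>w q - log_norm q\<bar> \<le> extended_radius + \<delta> * M"
      using w_bound[OF q] extended_bound(3)[OF x0 q] M0 by linarith
    show "\<bar>W (T f (q, x0)) - log_norm (Tmap A f q)\<bar> \<le> extended_radius + \<delta> * M" if f: "f \<in> Diff1 A" for f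
    proof -
      have "0 \<le> \<delta> * t_away (act f x0)" "\<delta> * t_away (act f x0) \<le> \<delta> * M"
        using \<delta>(1) nn M[OF act_in[OF f x0]] by auto
      then show ?thesis
        using extended_bound(1)[OF act_in[OF f x0] Tmap_nonzero[OF f q]] unfolding WT by linarith
    qed
    fix n :: nat assume n: "n \<ge> 1"
    have "W (q, x0) + real n * \<delta> \<le> (\<integral>f. W (T f (q, x0)) \<partial>conv_power A \<nu> n)"
    proof (rule drift_iterate[OF \<nu> G_sets _ AE_G _ _ W_meas W_bound W_drift n qx])
      show "f \<circ> h \<in> G" if "f \<in> G" "h \<in> G" for f h by (rule G_comp[OF that])
      show "T f s \<in> nonzero_tangents \<times> F" if "f \<in> G" "s \<in> nonzero_tangents \<times> F" for f s
        using that G_subset Tmap_nonzero act_in by (auto simp: T_def)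
      show "T (f \<circ> h) s = T f (T h s)" if "f \<in> G" "h \<in> G" "s \<in> nonzero_tangents \<times> F" for f h s
      proof -
        have "f \<in> Diff1 A" "h \<in> Diff1 A" using that G_subset by auto
        then show ?thesis
          using that(3) Tmap_comp[OF Diff1_C1_map Diff1_C1_map, of f h] act_comp[OF that(1,2)]
          by (auto simp only: T_def split_beta mem_Times_iff fst_conv snd_conv)
      qed
    qed
    then show "w q + real n * \<delta> \<le> (\<integral>f. W (T f (q, x0)) \<partial>conv_power A \<nu> n)"
      by (simp add: W_def extended_def t_away_def)
  qed
qed

end

theorem expanding_iff_hitting_expanding:
  "expanding \<nu> \<longleftrightarrow> expanding (\<nu>_hit x0)"
proof
  assume "expanding \<nu>"
  then obtain w where "lyapunov \<nu> w" using expanding_imp_lyapunov[OF \<nu>] by blast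
  then obtain B \<epsilon> where w: "\<And>q. q \<in> nonzero_tangents \<Longrightarrow> \<bar>w q - log_norm q\<bar> \<le> B"
    "\<And>q. q \<in> nonzero_tangents \<Longrightarrow> (\<lambda>f. w (Tmap A f q)) \<in> borel_measurable \<D>"
    "\<epsilon> > 0" "\<And>q. q \<in> nonzero_tangents \<Longrightarrow> w q + \<epsilon> \<le> (\<integral>f. w (Tmap A f q) \<partial>\<nu>)"
    unfolding lyapunov_def by blast
  have "lyapunov (\<nu>_hit x0) w"
    unfolding lyapunov_def using w(1-3) drift_of_hitting_measure[OF w] by blast
  then show "expanding (\<nu>_hit x0)"
    by (rule lyapunov_imp_expanding[OF log_integrable_\<nu>_hit[OF x0]])
next
  assume "expanding (\<nu>_hit x0)"
  then obtain w where "lyapunov (\<nu>_hit x0) w"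
    using expanding_imp_lyapunov[OF log_integrable_\<nu>_hit[OF x0]] by blast
  then obtain B \<epsilon> where w: "\<And>q. q \<in> nonzero_tangents \<Longrightarrow> \<bar>w q - log_norm q\<bar> \<le> B"
    "\<And>q. q \<in> nonzero_tangents \<Longrightarrow> (\<lambda>f. w (Tmap A f q)) \<in> borel_measurable \<D>"
    "\<epsilon> > 0" "\<And>q. q \<in> nonzero_tangents \<Longrightarrow> w q + \<epsilon> \<le> (\<integral>f. w (Tmap A f q) \<partial>\<nu>_hit x0)"
    unfolding lyapunov_def by blast
  show "expanding \<nu>" by (rule expanding_of_hitting_drift[OF w])
qed

end

section \<open>Finite expected hitting times and the equivalence\<close>

text \<open>
  Let \<open>d y\<close> be the least number of steps, at least one, from \<open>y\<close> to \<open>x0\<close> in the graph of transitions of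
  positive probability, and \<open>p\<close> the least of these probabilities. With probability at least \<open>p\<close> a step comes
  closer to \<open>x0\<close>, otherwise nothing is known about it. With \<open>r = p / 2\<close> and \<open>X = r^-N\<close>, where
  \<open>N\<close> is the largest \<open>d y\<close>, the bounded function \<open>X (1 - r^(d y))\<close> satisfies the inequality.
\<close>

lemma finite_chain_supersolution:
  fixes step :: "'f \<Rightarrow> 'x \<Rightarrow> 'x"
  assumes "prob_space \<nu>" and F: "finite F" "x0 \<in> F"
    and step_in: "\<And>f y. f \<in> space \<nu> \<Longrightarrow> y \<in> F \<Longrightarrow> step f y \<in> F"
    and meas: "\<And>y y'. {f \<in> space \<nu>. step f y = y'} \<in> sets \<nu>"
    and reach: "\<And>y. y \<in> F \<Longrightarrow> (y, x0) \<in> {(y, y'). y \<in> F \<and> y' \<in> F \<and> measure \<nu> {f \<in> space \<nu>. step f y = y'} > 0}\<^sup>+"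
  shows "\<exists>t :: 'x \<Rightarrow> ennreal. \<forall>y\<in>F. t y < \<infinity> \<and>
           1 + (\<integral>\<^sup>+ f. (if step f y = x0 then 0 else t (step f y)) \<partial>\<nu>) \<le> t y"
proof -
  interpret prob_space \<nu> by fact
  define P where "P y y' = measure \<nu> {f \<in> space \<nu>. step f y = y'}" for y y'
  define R where "R = {(y, y'). y \<in> F \<and> y' \<in> F \<and> P y y' > 0}"
  have reachR: "(y, x0) \<in> R\<^sup>+" if "y \<in> F" for y
    using reach[OF that] by (simp only: R_def P_def)
  define d where "d y = (LEAST k. k \<ge> 1 \<and> (y, x0) \<in> R ^^ k)" for y
  have d: "d y \<ge> 1 \<and> (y, x0) \<in> R ^^ d y" if "y \<in> F" for y
  proof -
    have "\<exists>k. k \<ge> 1 \<and> (y, x0) \<in> R ^^ k"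
      using reachR[OF that] unfolding trancl_power by (metis Suc_leI One_nat_def)
    then show ?thesis unfolding d_def by (rule LeastI_ex)
  qed
  have d_le: "d y \<le> k" if "k \<ge> 1" "(y, x0) \<in> R ^^ k" for y k
    unfolding d_def by (rule Least_le) (use that in blast)
  have "R \<subseteq> F \<times> F" by (auto simp: R_def)
  then have finR: "finite R" using F(1) finite_subset by blast
  have "R \<noteq> {}" using reachR[OF F(2)] by auto
  define p where "p = Min ((\<lambda>(y, y'). P y y') ` R)"
  have p: "p > 0" "\<And>y y'. (y, y') \<in> R \<Longrightarrow> p \<le> P y y'"
    using finR \<open>R \<noteq> {}\<close> by (auto simp: p_def R_def intro!: Min_le)
  have p1: "p \<le> 1"
  proof -
    obtain y y' where "(y, y') \<in> R" using \<open>R \<noteq> {}\<close> by auto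
    then have "p \<le> P y y'" by (rule p(2))
    also have "\<dots> \<le> 1" unfolding P_def by (rule prob_le_1)
    finally show ?thesis .
  qed
  define r where "r = p / 2"
  have r: "0 < r" "r < 1" using p(1) p1 by (auto simp: r_def)
  define N where "N = Max (d ` F)"
  define X where "X = 1 / r ^ N"
  have X: "X > 0" using r by (simp add: X_def)
  have Xr: "1 \<le> X * r ^ d y" if "y \<in> F" for y
  proof -
    have "d y \<le> N" unfolding N_def using that F(1) by (intro Max_ge) auto
    then have "r ^ N \<le> r ^ d y" using r by (intro power_decreasing) auto
    then show ?thesis using r by (simp add: X_def pos_le_divide_eq)
  qed
  define s where "s y = X * (1 - r ^ d y)" for y
  have s: "0 \<le> s y" "s y \<le> X" for y
    using X r by (auto simp: s_def power_le_one mult_le_cancel_left1)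
  have "1 + (\<integral>\<^sup>+ f. (if step f y = x0 then 0 else ennreal (s (step f y))) \<partial>\<nu>) \<le> ennreal (s y)" if y: "y \<in> F" for y
  proof -
    obtain k where k: "d y = Suc k" using d[OF y] by (cases "d y") auto
    obtain y' where y': "(y, y') \<in> R" "(y', x0) \<in> R ^^ k"
      using d[OF y] unfolding k by (metis relpow_Suc_E2)
    define E where "E = {f \<in> space \<nu>. step f y = y'}"
    have E: "E \<in> sets \<nu>" unfolding E_def by (rule meas)
    define b where "b f = X - X * r ^ k * indicator E f" for f
    have rk: "0 \<le> X * r ^ k" "X * r ^ k \<le> X" using X r by (auto simp: power_le_one mult_le_cancel_left1)
    have b0: "0 \<le> b f" for f using rk X by (auto simp: b_def indicator_def)
    have le: "(if step f y = x0 then 0 else s (step f y)) \<le> b f" if f: "f \<in> space \<nu>" for f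
    proof (cases "step f y = x0 \<or> f \<notin> E")
      case True
      then show ?thesis using b0[of f] s by (auto simp: b_def)
    next
      case False
      then have f': "step f y = y'" "y' \<noteq> x0" "f \<in> E" by (auto simp: E_def)
      have "k \<ge> 1" using y'(2) f'(2) by (cases k) auto
      then have "d y' \<le> k" using y'(2) by (rule d_le)
      then have "r ^ k \<le> r ^ d y'" using r by (intro power_decreasing) auto
      then have "X * r ^ k \<le> X * r ^ d y'" using X by (intro mult_left_mono) auto
      then show ?thesis using f' by (simp add: b_def s_def algebra_simps)
    qed
    have ib: "integrable \<nu> b" unfolding b_def using E by (auto simp: emeasure_eq_measure)
    have "(\<integral>\<^sup>+ f. (if step f y = x0 then 0 else ennreal (s (step f y))) \<partial>\<nu>) \<le> (\<integral>\<^sup>+ f. ennreal (b f) \<partial>\<nu>)"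
    proof (rule nn_integral_mono)
      fix f assume "f \<in> space \<nu>"
      from ennreal_leI[OF le[OF this]]
      show "(if step f y = x0 then 0 else ennreal (s (step f y))) \<le> ennreal (b f)" by (simp split: if_splits)
    qed
    also have "\<dots> = ennreal (\<integral>f. b f \<partial>\<nu>)"
      by (rule nn_integral_eq_integral[OF ib]) (use b0 in simp)
    also have "(\<integral>f. b f \<partial>\<nu>) = X - X * r ^ k * measure \<nu> E"
      unfolding b_def using E by (simp add: prob_space emeasure_eq_measure)
    finally have le2: "(\<integral>\<^sup>+ f. (if step f y = x0 then 0 else ennreal (s (step f y))) \<partial>\<nu>) \<le> ennreal (X - X * r ^ k * measure \<nu> E)" .
    have "measure \<nu> E \<le> 1" by (rule prob_le_1)
    then have nonneg: "0 \<le> X - X * r ^ k * measure \<nu> E"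
      using rk mult_left_le[of "measure \<nu> E" "X * r ^ k"] by linarith
    have "X * r ^ k * p \<le> X * r ^ k * measure \<nu> E"
      using p(2)[OF y'(1)] rk(1) by (intro mult_left_mono) (auto simp: P_def E_def)
    moreover have "X * r ^ k * p = 2 * (X * r ^ d y)" by (simp add: k r_def)
    moreover have "s y = X - X * r ^ d y" by (simp add: s_def right_diff_distrib)
    ultimately have "1 + (X - X * r ^ k * measure \<nu> E) \<le> s y"
      using Xr[OF y] by linarith
    from ennreal_leI[OF this]
    have "1 + ennreal (X - X * r ^ k * measure \<nu> E) \<le> ennreal (s y)"
      using nonneg by (subst (asm) ennreal_plus) auto
    then show ?thesis using add_left_mono[OF le2, of 1] by (rule order_trans[rotated])
  qed
  then show ?thesis by (intro exI[of _ "\<lambda>y. ennreal (s y)"]) simp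
qed

context compact_atlas
begin

lemma closed_subsemigroup_generated:
  assumes "S \<subseteq> Diff1 A"
  defines "G \<equiv> closed_subsemigroup_generated (C1_topology A) S"
  shows "closed_subsemigroup (C1_topology A) G" "S \<subseteq> G"
    "\<And>K. closed_subsemigroup (C1_topology A) K \<Longrightarrow> S \<subseteq> K \<Longrightarrow> G \<subseteq> K"
proof -
  let ?\<H> = "{H. closed_subsemigroup (C1_topology A) H \<and> S \<subseteq> H}"
  have "Diff1 A \<in> ?\<H>"
    using assms(1) closedin_topspace[of "C1_topology A"] by (simp add: closed_subsemigroup_def comp_in_Diff1)
  then have ne: "?\<H> \<noteq> {}" by blast
  have "closedin (C1_topology A) (\<Inter>?\<H>)"
    by (rule closedin_Inter[OF ne]) (simp add: closed_subsemigroup_def)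
  moreover have "\<forall>f\<in>\<Inter>?\<H>. \<forall>h\<in>\<Inter>?\<H>. f \<circ> h \<in> \<Inter>?\<H>"
    by (simp add: closed_subsemigroup_def)
  ultimately show "closed_subsemigroup (C1_topology A) G"
    by (simp only: closed_subsemigroup_def G_def closed_subsemigroup_generated_def)
  show "S \<subseteq> G" "\<And>K. closed_subsemigroup (C1_topology A) K \<Longrightarrow> S \<subseteq> K \<Longrightarrow> G \<subseteq> K"
    unfolding G_def closed_subsemigroup_generated_def by blast+
qed

end

theorem proposition3p3:
  fixes A :: "('m::t2_space, 'b::euclidean_space) chart set"
    and g :: "'m \<Rightarrow> 'b \<Rightarrow> 'b \<Rightarrow> real"
    and \<nu> :: "('m \<Rightarrow> 'm) measure"
    and p :: real
    and G H :: "('m \<Rightarrow> 'm) set"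
  assumes "compact_manifold A"
    and "riemannian_metric A g"
    and "prob_space \<nu>"
    and "sets \<nu> = sets (diff1_borel A)"
    and "p > 1"
    and "(\<integral>\<^sup>+ f. ennreal ((ln (C1_norm A g f) + ln (C1_norm A g (inv f))) powr p) \<partial>\<nu>) < \<infinity>"
    and "G = closed_subsemigroup_generated (C1_topology A) (measure_support (C1_topology A) \<nu>)"
    and "H \<subseteq> G"
    and "closed_subsemigroup (C1_topology A) H"
    and "finite_index (C1_topology A) G H"
  shows "uniformly_expanding A g \<nu> \<longleftrightarrow> uniformly_expanding A g (hitting_measure A \<nu> H)"
proof -
  interpret riemannian_atlas A g
    by unfold_locales fact+
  interpret \<nu>: prob_space \<nu> by fact
  let ?T = "C1_topology A"
  define S where "S = measure_support ?T \<nu>"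
  have sp: "space \<nu> = Diff1 A" using sets_eq_imp_space_eq[OF assms(4)] by simp
  have li: "log_integrable \<nu>"
    using integrable_log_distortion[OF assms(3-6)] assms(3,4) by (simp add: log_integrable_def)
  have S_sub: "S \<subseteq> Diff1 A" by (auto simp: S_def measure_support_def)
  have G_eq: "G = closed_subsemigroup_generated ?T S" using assms(7) by (simp add: S_def)
  note gen = closed_subsemigroup_generated[OF S_sub, folded G_eq]
  have G: "closedin ?T G" "\<And>f h. f \<in> G \<Longrightarrow> h \<in> G \<Longrightarrow> f \<circ> h \<in> G"
    using gen(1) by (auto simp: closed_subsemigroup_def)
  have G_sub: "G \<subseteq> Diff1 A" using closedin_subset[OF G(1)] by simp
  have G_sets: "G \<in> sets \<D>" by (rule closed_in_sets[OF G(1)])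
  have AE_G: "AE f in \<nu>. f \<in> G"
    using AE_measure_support[OF assms(4)] by eventually_elim (use gen(2) in \<open>auto simp: S_def\<close>)
  obtain F :: "nat set" and act0 x0 where x0: "x0 \<in> F" and F: "finite F"
    and cont: "continuous_map (prod_topology (subtopology ?T G) (discrete_topology F)) (discrete_topology F) (\<lambda>(f, x). act0 f x)"
    and act0': "\<forall>f\<in>G. \<forall>h\<in>G. \<forall>x\<in>F. act0 (f \<circ> h) x = act0 f (act0 h x)"
    and trans': "\<forall>x\<in>F. \<forall>y\<in>F. \<exists>f\<in>G. act0 f x = y"
    and H: "H = {f \<in> G. act0 f x0 = x0}"
    using assms(10) unfolding finite_index_def by (elim exE bexE conjE)
  have act0: "act0 (f \<circ> h) x = act0 f (act0 h x)" if "f \<in> G" "h \<in> G" "x \<in> F" for f h x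
    using act0' that by blast
  have trans: "\<exists>f\<in>G. act0 f x = y" if "x \<in> F" "y \<in> F" for x y
    using trans' that by blast
  have topG: "topspace (subtopology ?T G) = G" using G_sub by auto
  have cont1: "continuous_map (subtopology ?T G) (discrete_topology F) (\<lambda>f. act0 f y)" if y: "y \<in> F" for y
  proof -
    have "continuous_map (subtopology ?T G) (prod_topology (subtopology ?T G) (discrete_topology F)) (\<lambda>f. (f, y))"
      using y by (simp add: continuous_map_pairwise o_def)
    from continuous_map_compose[OF this cont] show ?thesis by (simp add: o_def)
  qed
  have act0_in: "act0 f y \<in> F" if "f \<in> G" "y \<in> F" for f y
    using cont1[OF that(2)] that(1) topG by (auto simp: continuous_map_def)
  have clop: "openin (subtopology ?T G) {f \<in> G. act0 f y \<in> Y}" "closedin ?T {f \<in> G. act0 f y \<in> Y}"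
    if y: "y \<in> F" and Y: "Y \<subseteq> F" for y Y
  proof -
    show "openin (subtopology ?T G) {f \<in> G. act0 f y \<in> Y}"
      using openin_continuous_map_preimage[OF cont1[OF y], of Y] Y unfolding topG by simp
    have "closedin (subtopology ?T G) {f \<in> G. act0 f y \<in> Y}"
      using closedin_continuous_map_preimage[OF cont1[OF y], of Y] Y unfolding topG by simp
    then show "closedin ?T {f \<in> G. act0 f y \<in> Y}"
      using closedin_trans_full G(1) by blast
  qed
  \<comment> \<open>Off \<open>G\<close> and \<open>F\<close> the given action is arbitrary, possibly not measurable; there it is replaced by \<open>x0\<close>.\<close>
  define act where "act f y = (if f \<in> G \<and> y \<in> F then act0 f y else x0)" for f y
  have act_in: "act f y \<in> F" for f y using act0_in x0 by (simp add: act_def)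
  have act_meas: "(\<lambda>f. act f y) \<in> \<D> \<rightarrow>\<^sub>M count_space UNIV" for y
  proof (cases "y \<in> F")
    case True
    show ?thesis
    proof (rule measurableI)
      fix Y :: "nat set"
      have "(\<lambda>f. act f y) -` Y \<inter> space \<D> =
          {f \<in> G. act0 f y \<in> Y \<inter> F} \<union> (if x0 \<in> Y then space \<D> - G else {})"
        using True G_sub act0_in by (auto simp: act_def split: if_splits)
      moreover have "{f \<in> G. act0 f y \<in> Y \<inter> F} \<in> sets \<D>"
        by (rule closed_in_sets[OF clop(2)[OF True]]) simp
      ultimately show "(\<lambda>f. act f y) -` Y \<inter> space \<D> \<in> sets \<D>"
        using G_sets sets.compl_sets[OF G_sets] by (auto simp del: space_diff1_borel)
    qed simp
  next
    case False
    then show ?thesis by (simp add: act_def)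
  qed
  have meas: "{f \<in> space \<nu>. act f y = y'} \<in> sets \<nu>" for y y'
  proof -
    have "(\<lambda>f. act f y) -` {y'} \<inter> space \<D> \<in> sets \<D>" by (rule measurable_sets[OF act_meas]) simp
    moreover have "(\<lambda>f. act f y) -` {y'} \<inter> space \<D> = {f \<in> space \<nu>. act f y = y'}" using sp by auto
    ultimately show ?thesis using assms(4) by simp
  qed
  define R where "R = {(y, y'). y \<in> F \<and> y' \<in> F \<and> measure \<nu> {f \<in> space \<nu>. act f y = y'} > 0}"
  have step: "(y, act0 f y) \<in> R" if f: "f \<in> S" and y: "y \<in> F" for f y
  proof -
    have fG: "f \<in> G" using f gen(2) by blast
    obtain V where V: "openin ?T V" "{h \<in> G. act0 h y \<in> {act0 f y}} = V \<inter> G"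
      using clop(1)[OF y, of "{act0 f y}"] act0_in[OF fG y] unfolding openin_subtopology by auto
    have "f \<in> V" using V(2) fG by blast
    then have "0 < emeasure \<nu> V" using f V(1) by (simp add: S_def measure_support_def)
    also have "\<dots> \<le> emeasure \<nu> {h \<in> space \<nu>. act h y = act0 f y}"
    proof (rule emeasure_mono_AE)
      show "AE h in \<nu>. h \<in> V \<longrightarrow> h \<in> {h \<in> space \<nu>. act h y = act0 f y}"
        using AE_G AE_space
      proof eventually_elim
        fix h assume h: "h \<in> G" "h \<in> space \<nu>"
        show "h \<in> V \<longrightarrow> h \<in> {h \<in> space \<nu>. act h y = act0 f y}"
        proof
          assume "h \<in> V"
          then have "act0 h y = act0 f y" using h(1) V(2) by blast
          then show "h \<in> {h \<in> space \<nu>. act h y = act0 f y}" using h y by (simp add: act_def)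
        qed
      qed
    qed (rule meas)
    finally show ?thesis
      using y act0_in[OF fG y] by (simp add: R_def \<nu>.emeasure_eq_measure)
  qed
  \<comment> \<open>The elements of \<open>G\<close> whose action is realised by transitions of positive probability. They form a
     closed subsemigroup that contains the support, and this gives all of \<open>G\<close>.\<close>
  define K where "K = {f \<in> G. \<forall>y\<in>F. (y, act0 f y) \<in> R\<^sup>+}"
  have "closed_subsemigroup ?T K"
    unfolding closed_subsemigroup_def
  proof (intro conjI ballI)
    have "K = (\<Inter>y\<in>F. {f \<in> G. act0 f y \<in> {y' \<in> F. (y, y') \<in> R\<^sup>+}})"
      using x0 act0_in by (auto simp: K_def)
    moreover have "closedin ?T (\<Inter>y\<in>F. {f \<in> G. act0 f y \<in> {y' \<in> F. (y, y') \<in> R\<^sup>+}})"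
      using x0 by (intro closedin_INT clop(2)) auto
    ultimately show "closedin ?T K" by simp
    fix f h assume fh: "f \<in> K" "h \<in> K"
    then have fhG: "f \<in> G" "h \<in> G" by (auto simp: K_def)
    have "(y, act0 (f \<circ> h) y) \<in> R\<^sup>+" if y: "y \<in> F" for y
    proof -
      have "(y, act0 h y) \<in> R\<^sup>+" using fh(2) y by (simp add: K_def)
      moreover have "(act0 h y, act0 f (act0 h y)) \<in> R\<^sup>+"
        using fh(1) act0_in[OF fhG(2) y] by (simp add: K_def)
      ultimately show ?thesis unfolding act0[OF fhG y] by (rule trancl_trans)
    qed
    then show "f \<circ> h \<in> K" using G(2)[OF fhG] by (simp add: K_def)
  qed
  moreover have "S \<subseteq> K" using step gen(2) by (auto simp: K_def)
  ultimately have "G \<subseteq> K" by (rule gen(3))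
  then have reach: "(y, x0) \<in> R\<^sup>+" if "y \<in> F" for y
    using trans[OF that x0] that by (auto simp: K_def)
  have "\<exists>t :: nat \<Rightarrow> ennreal. \<forall>y\<in>F. t y < \<infinity> \<and>
           1 + (\<integral>\<^sup>+ f. (if act f y = x0 then 0 else t (act f y)) \<partial>\<nu>) \<le> t y"
    by (rule finite_chain_supersolution[OF assms(3) F x0 act_in meas reach[unfolded R_def]])
  then obtain t :: "nat \<Rightarrow> ennreal" where t: "\<And>y. y \<in> F \<Longrightarrow> t y < \<infinity>"
    "\<And>y. y \<in> F \<Longrightarrow> 1 + (\<integral>\<^sup>+ f. (if act f y = x0 then 0 else t (act f y)) \<partial>\<nu>) \<le> t y"
    by blast
  have act_comp: "act (f \<circ> h) y = act f (act h y)" if "f \<in> G" "h \<in> G" "y \<in> F" for f h y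
    using that G(2) act0 act0_in by (simp add: act_def)
  interpret hitting_walk A g \<nu> G F act x0 t
  proof unfold_locales
    show "log_integrable \<nu>" "G \<in> sets \<D>" "AE f in \<nu>. f \<in> G" "finite F" "x0 \<in> F" by fact+
    show "f \<circ> h \<in> G" if "f \<in> G" "h \<in> G" for f h by (rule G(2)[OF that])
    show "act f y \<in> F" for f y by (rule act_in)
    show "act (f \<circ> h) y = act f (act h y)" if "f \<in> G" "h \<in> G" "y \<in> F" for f h y by (rule act_comp[OF that])
    show "(\<lambda>f. act f y) \<in> \<D> \<rightarrow>\<^sub>M count_space UNIV" for y by (rule act_meas)
    show "t y < \<infinity>" "1 + (\<integral>\<^sup>+ f. (if act f y = x0 then 0 else t (act f y)) \<partial>\<nu>) \<le> t y" if "y \<in> F" for y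
      using t[OF that] .
  qed
  have "H = Hit x0" using x0 by (auto simp: H Hit_def act_def)
  then show ?thesis
    using expanding_iff_hitting_expanding uniformly_expanding_iff[OF li]
      uniformly_expanding_iff[OF log_integrable_\<nu>_hit[OF x0]] by simp
qed

end
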